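(* Let $0<\alpha\le 1$ and $0<d<\pi$, and write $\mathscr{D}=\psi^{\mathrm{SE}}(\mathscr{D}_d)$. Let $gQ$ and $\mu Q$ belong to $\mathbf{L}_{\alpha}(\mathscr{D})$, let $k(z,\cdot)Q(\cdot)\in\mathbf{L}_{\alpha}(\mathscr{D})$ for all $z\in\mathscr{D}$, and let $k(\cdot,w)Q(w)\in\mathbf{H}^{\infty}(\mathscr{D})$ for all $w\in\mathscr{D}$. Furthermore, let $\mu$, $k(t,\cdot)Q(\cdot)$ and $k(\cdot,s)Q(s)$ belong to $C([a,b])$ for all $t\in[a,b]$ and $s\in[a,b]$. Let $u$ be the solution of $$u'(t)=g(t)+\mu(t)u(t)+\int_a^t k(t,r)u(r)\,dr\quad (a\le t\le b),\qquad u(a)=u_a ,$$ and let the $n\times n$ matrix $W^{\mathrm{SE}}_n$ ($n=2N+1$) and the SE-Sinc-Nystr\"om approximate solution $u^{\mathrm{SE}}_N$ be defined with mesh size $h=\sqrt{\pi d/(\alpha N)}$. Then there exists a positive integer $N_0$ such that for all $N\ge N_0$ the inverse of $(I_n-W^{\mathrm{SE}}_n)$ exists, and there exists a constant $C$ independent of $N$ such that (for all $N\ge N_0$) $$\max_{t\in[a,b]}|u(t)-u^{\mathrm{SE}}_N(t)|\le C\,e^{-\sqrt{\pi d\alpha N}} .$$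
   Context: Let $a<b$ be real numbers and $u_a$ a given initial value. Set $Q(z)=(z-a)(b-z)$ and $\mathcal{V}[u](s)=\int_a^s k(s,r)u(r)\,dr$. The initial value problem is treated in its integrated form $u(t)=u_a+\int_a^t\{g(s)+\mu(s)u(s)+\mathcal{V}[u](s)\}\,ds$, $a\le t\le b$. Functions are regarded as functions of complex variables. For $d>0$, $\mathscr{D}_d=\{\zeta\in\mathbb{C}:|\operatorname{Im}\zeta|<d\}$. The SE transformation is $\psi^{\mathrm{SE}}(x)=\frac{b-a}{2}\tanh\left(\frac{x}{2}\right)+\frac{b+a}{2}$, which maps $\mathbb{R}$ onto $(a,b)$, and $\psi^{\mathrm{SE}}(\mathscr{D}_d)=\{\psi^{\mathrm{SE}}(\zeta):\zeta\in\mathscr{D}_d\}$. For $\alpha>0$ and a bounded simply connected domain $\mathscr{D}\supset(a,b)$, $\mathbf{L}_{\alpha}(\mathscr{D})$ is the family of functions $f$ analytic on $\mathscr{D}$ for which there is a constant $K$ with $|f(z)|\le K|Q(z)|^{\alpha}$ for all $z\in\mathscr{D}$. $\mathbf{H}^{\infty}(\mathscr{D})$ is the family of functions $f$ analytic on $\mathscr{D}$ with $\sup_{z\in\mathscr{D}}|f(z)|<\infty$. The scheme. Let $N$ be a positive integer, $n=2N+1$, $h>0$ the mesh size. Put $\operatorname{Si}(x)=\int_0^x\frac{\sin\tau}{\tau}\,d\tau$, $J(j,h)(\xi)=h\left\{\frac12+\frac1\pi\operatorname{Si}[\pi(\xi/h-j)]\right\}$, $t^{\mathrm{SE}}_j=\psi^{\mathrm{SE}}(jh)$,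 and $w^{\mathrm{SE}}_j(t)=(\psi^{\mathrm{SE}})'(jh)\,J(j,h)((\psi^{\mathrm{SE}})^{-1}(t))$, extended to $t=a,b$ by continuity. Indices $i,j$ of vectors and matrices run over $-N,\dots,N$. Let $I_n$ be the identity matrix, $(I^{(-1)}_n)_{ij}=\frac12+\frac1\pi\operatorname{Si}[\pi(i-j)]$, $(K^{\mathrm{SE}}_n)_{ij}=k(t^{\mathrm{SE}}_i,t^{\mathrm{SE}}_j)$, $M^{\mathrm{SE}}_n=\operatorname{diag}[\mu(t^{\mathrm{SE}}_{-N}),\dots,\mu(t^{\mathrm{SE}}_N)]$, $D^{\mathrm{SE}}_n=\operatorname{diag}[(\psi^{\mathrm{SE}})'(-Nh),\dots,(\psi^{\mathrm{SE}})'(Nh)]$, and $$W^{\mathrm{SE}}_n=h\,I^{(-1)}_nM^{\mathrm{SE}}_nD^{\mathrm{SE}}_n+h^2\,I^{(-1)}_nD^{\mathrm{SE}}_n\,(I^{(-1)}_n\circ K^{\mathrm{SE}}_n)\,D^{\mathrm{SE}}_n ,$$ where $\circ$ is the Hadamard (entrywise) product. Let $\boldsymbol{g}^{\mathrm{SE}}_n$ be the vector with $i$th entry $u_a+\sum_{j=-N}^N g(t^{\mathrm{SE}}_j)w^{\mathrm{SE}}_j(t^{\mathrm{SE}}_i)$. Solve $(I_n-W^{\mathrm{SE}}_n)\boldsymbol{u}^{\mathrm{SE}}_n=\boldsymbol{g}^{\mathrm{SE}}_n$ and let $u^{\mathrm{SE}}_N(t^{\mathrm{SE}}_j)$ denote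 the $j$th entry of $\boldsymbol{u}^{\mathrm{SE}}_n$. Then $u^{\mathrm{SE}}_N$ is defined on $[a,b]$ by $$u^{\mathrm{SE}}_N(t)=u_a+\sum_{j=-N}^N\Big\{g(t^{\mathrm{SE}}_j)+\mu(t^{\mathrm{SE}}_j)u^{\mathrm{SE}}_N(t^{\mathrm{SE}}_j)+\sum_{m=-N}^N k(t^{\mathrm{SE}}_j,t^{\mathrm{SE}}_m)u^{\mathrm{SE}}_N(t^{\mathrm{SE}}_m)w^{\mathrm{SE}}_m(t^{\mathrm{SE}}_j)\Big\}w^{\mathrm{SE}}_j(t).$$
   Formalization: The condition that k(z,·)Q(·) belongs to L_α(D) for all z in D is taken with one constant K independent of z; with K depending on z the claim fails, since I_n − W_n can be singular for infinitely many N. *)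

theory Defs
  imports
    "HOL-Complex_Analysis.Complex_Analysis"
    "HOL-Probability.Sinc_Integral"
    "Jordan_Normal_Form.Matrix"
begin

definition Q :: "real \<Rightarrow> real \<Rightarrow> complex \<Rightarrow> complex" where
  "Q a b z = (z - of_real a) * (of_real b - z)"

definition strip :: "real \<Rightarrow> complex set" where
  "strip d = {\<zeta>. \<bar>Im \<zeta>\<bar> < d}"

text \<open>Polymorphic, so that the same expression is the conformal map on a strip (complex argument)
  and the change of variables on the real line (real argument).\<close>

definition psi_SE :: "real \<Rightarrow> real \<Rightarrow> 'a::{real_normed_field,banach} \<Rightarrow> 'a" where
  "psi_SE a b x = of_real ((b - a) / 2) * tanh (x / 2) + of_real ((b + a) / 2)"

definition L_class :: "real \<Rightarrow> real \<Rightarrow> real \<Rightarrow> complex set \<Rightarrow> (complex \<Rightarrow> complex) set" where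
  "L_class a b \<alpha> D =
     {f. f analytic_on D \<and> (\<exists>K. \<forall>z\<in>D. norm (f z) \<le> K * norm (Q a b z) powr \<alpha>)}"

definition H_inf :: "complex set \<Rightarrow> (complex \<Rightarrow> complex) set" where
  "H_inf D = {f. f analytic_on D \<and> bounded (f ` D)}"

definition volterra :: "real \<Rightarrow> (complex \<Rightarrow> complex \<Rightarrow> complex) \<Rightarrow> (real \<Rightarrow> complex) \<Rightarrow> real \<Rightarrow> complex"
  where "volterra a k u s = integral {a..s} (\<lambda>r. k (of_real s) (of_real r) * u r)"

text \<open>The initial value problem is taken in integrated form: \<open>g\<close> may be singular at the end points,
  where the differential equation itself need not make sense.\<close>

definition IVP_solution ::
  "real \<Rightarrow> real \<Rightarrow> complex \<Rightarrow> (complex \<Rightarrow> complex) \<Rightarrow> (complex \<Rightarrow> complex) \<Rightarrow>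
   (complex \<Rightarrow> complex \<Rightarrow> complex) \<Rightarrow> (real \<Rightarrow> complex) \<Rightarrow> bool" where
  "IVP_solution a b ua g \<mu> k u \<longleftrightarrow>
     continuous_on {a..b} u \<and>
     (\<forall>t\<in>{a..b}. u t = ua + integral {a..t}
        (\<lambda>s. g (of_real s) + \<mu> (of_real s) * u s + volterra a k u s))"

definition J_SE :: "int \<Rightarrow> real \<Rightarrow> real \<Rightarrow> real" where
  "J_SE j h x = h * (1 / 2 + 1 / pi * Si (pi * (x / h - of_int j)))"

definition t_SE :: "real \<Rightarrow> real \<Rightarrow> real \<Rightarrow> int \<Rightarrow> real" where
  "t_SE a b h j = psi_SE a b (of_int j * h)"

definition dpsi_SE :: "real \<Rightarrow> real \<Rightarrow> real \<Rightarrow> int \<Rightarrow> real" where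
  "dpsi_SE a b h j = deriv (psi_SE a b) (of_int j * h)"

definition w_SE_open :: "real \<Rightarrow> real \<Rightarrow> real \<Rightarrow> int \<Rightarrow> real \<Rightarrow> real" where
  "w_SE_open a b h j t = dpsi_SE a b h j * J_SE j h (inv_into UNIV (psi_SE a b) t)"

definition w_SE :: "real \<Rightarrow> real \<Rightarrow> real \<Rightarrow> int \<Rightarrow> real \<Rightarrow> real" where
  "w_SE a b h j t =
     (if t = a then Lim (at_right a) (w_SE_open a b h j)
      else if t = b then Lim (at_left b) (w_SE_open a b h j)
      else w_SE_open a b h j t)"

text \<open>Vectors and matrices have size \<open>2 * N + 1\<close> and are indexed from \<open>0\<close> by the library;
  library index \<open>p\<close> corresponds to the mathematical index \<open>ix N p\<close> in \<open>{-N..N}\<close>.\<close>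

definition ix :: "nat \<Rightarrow> nat \<Rightarrow> int" where
  "ix N p = int p - int N"

definition hadamard :: "'a::times mat \<Rightarrow> 'a mat \<Rightarrow> 'a mat" where
  "hadamard A B = Matrix.mat (dim_row A) (dim_col A) (\<lambda>(p, q). A $$ (p, q) * B $$ (p, q))"

definition I_mat :: "nat \<Rightarrow> complex mat" where
  "I_mat N = Matrix.mat (2 * N + 1) (2 * N + 1)
     (\<lambda>(p, q). of_real (1 / 2 + 1 / pi * Si (pi * of_int (ix N p - ix N q))))"

definition K_mat :: "real \<Rightarrow> real \<Rightarrow> real \<Rightarrow> (complex \<Rightarrow> complex \<Rightarrow> complex) \<Rightarrow> nat \<Rightarrow> complex mat" where
  "K_mat a b h k N = Matrix.mat (2 * N + 1) (2 * N + 1)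
     (\<lambda>(p, q). k (of_real (t_SE a b h (ix N p))) (of_real (t_SE a b h (ix N q))))"

definition M_mat :: "real \<Rightarrow> real \<Rightarrow> real \<Rightarrow> (complex \<Rightarrow> complex) \<Rightarrow> nat \<Rightarrow> complex mat" where
  "M_mat a b h \<mu> N = mat_diag (2 * N + 1) (\<lambda>p. \<mu> (of_real (t_SE a b h (ix N p))))"

definition D_mat :: "real \<Rightarrow> real \<Rightarrow> real \<Rightarrow> nat \<Rightarrow> complex mat" where
  "D_mat a b h N = mat_diag (2 * N + 1) (\<lambda>p. of_real (dpsi_SE a b h (ix N p)))"

definition W_mat :: "real \<Rightarrow> real \<Rightarrow> real \<Rightarrow> (complex \<Rightarrow> complex) \<Rightarrow>
    (complex \<Rightarrow> complex \<Rightarrow> complex) \<Rightarrow> nat \<Rightarrow> complex mat" where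
  "W_mat a b h \<mu> k N =
     of_real h \<cdot>\<^sub>m (I_mat N * M_mat a b h \<mu> N * D_mat a b h N)
     + of_real (h ^ 2) \<cdot>\<^sub>m
         (I_mat N * D_mat a b h N * hadamard (I_mat N) (K_mat a b h k N) * D_mat a b h N)"

definition g_vec :: "real \<Rightarrow> real \<Rightarrow> real \<Rightarrow> complex \<Rightarrow> (complex \<Rightarrow> complex) \<Rightarrow> nat \<Rightarrow> complex Matrix.vec"
  where
  "g_vec a b h ua g N = Matrix.vec (2 * N + 1)
     (\<lambda>p. ua + (\<Sum>j = - int N..int N.
        g (of_real (t_SE a b h j)) * of_real (w_SE a b h j (t_SE a b h (ix N p)))))"

definition u_vec :: "real \<Rightarrow> real \<Rightarrow> real \<Rightarrow> complex \<Rightarrow> (complex \<Rightarrow> complex) \<Rightarrow> (complex \<Rightarrow> complex) \<Rightarrow>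
    (complex \<Rightarrow> complex \<Rightarrow> complex) \<Rightarrow> nat \<Rightarrow> complex Matrix.vec" where
  "u_vec a b h ua g \<mu> k N =
     (THE v. v \<in> carrier_vec (2 * N + 1) \<and>
        (1\<^sub>m (2 * N + 1) - W_mat a b h \<mu> k N) *\<^sub>v v = g_vec a b h ua g N)"

definition u_node :: "real \<Rightarrow> real \<Rightarrow> real \<Rightarrow> complex \<Rightarrow> (complex \<Rightarrow> complex) \<Rightarrow> (complex \<Rightarrow> complex) \<Rightarrow>
    (complex \<Rightarrow> complex \<Rightarrow> complex) \<Rightarrow> nat \<Rightarrow> int \<Rightarrow> complex" where
  "u_node a b h ua g \<mu> k N j = vec_index (u_vec a b h ua g \<mu> k N) (nat (j + int N))"

definition u_SE :: "real \<Rightarrow> real \<Rightarrow> real \<Rightarrow> complex \<Rightarrow> (complex \<Rightarrow> complex) \<Rightarrow> (complex \<Rightarrow> complex) \<Rightarrow>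
    (complex \<Rightarrow> complex \<Rightarrow> complex) \<Rightarrow> nat \<Rightarrow> real \<Rightarrow> complex" where
  "u_SE a b h ua g \<mu> k N t =
     ua + (\<Sum>j = - int N..int N.
       (g (of_real (t_SE a b h j))
        + \<mu> (of_real (t_SE a b h j)) * u_node a b h ua g \<mu> k N j
        + (\<Sum>m = - int N..int N.
             k (of_real (t_SE a b h j)) (of_real (t_SE a b h m)) * u_node a b h ua g \<mu> k N m
             * of_real (w_SE a b h m (t_SE a b h j))))
       * of_real (w_SE a b h j t))"

definition mesh :: "real \<Rightarrow> real \<Rightarrow> nat \<Rightarrow> real" where
  "mesh \<alpha> d N = sqrt (pi * d / (\<alpha> * real N))"

end

theory Submission
  imports Defs "Jordan_Normal_Form.Determinant"
begin

text \<open>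
  In the variable of the strip, the problem becomes a Volterra equation on the half-lines
  \<open>(-\<infinity>, x]\<close> whose coefficients are holomorphic and bounded by \<open>exp (- \<alpha> \<bar>Re \<zeta>\<bar>)\<close>. Picard
  iteration in a norm with an exponential weight extends the solution to a bounded holomorphic function
  on the strip. Hence all integrands of the scheme satisfy the error bound \<open>exp (- sqrt (\<pi> d \<alpha> N))\<close> of
  sinc indefinite integration, which comes from the residue theorem on rectangles. Stability needs no
  compactness: the values \<open>1/2 + Si (\<pi> k) / \<pi>\<close> tend to the Heaviside function, so for small mesh
  size the system is a small perturbation of a strictly lower triangular one, and the discrete Gronwall
  inequality bounds its inverse uniformly in \<open>N\<close>.
\<close>

section \<open>Weights and primitives on the strip\<close>

text \<open>The derivative of the SE transformation psi is Q(psi) / (b - a). Hence the products of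
  \<open>g\<close>, \<open>\<mu>\<close> and \<open>k\<close> with \<open>Q\<close> in the
  hypotheses are, up to the constant b - a, the transformed coefficients with the Jacobian already
  included. The weight exp (- \<alpha> |x|) is replaced by the comparable
  \<open>bump \<alpha>\<close>, the derivative of a bounded increasing function. Every estimate of
  an integral over a half-line then becomes a mean value inequality against an explicit primitive,
  and improper integrals in the strip variable are avoided. Two obstacles shape the analytic half.
  The kernel is only separately holomorphic, so the integral of
  \<open>\<kappa> \<sigma> \<rho> * f \<rho>\<close> up to \<rho> = \<sigma> has to be
  differentiated by hand in \<sigma>. And nothing is assumed on the boundary of the strip, so
  contours run at height d' < d, and d' tends to d only in the final bound. In the discrete half the
  difficulty is uniformity: every constant must be free of N and h, which is why all sums over nodes
  are Riemann sums of \<open>bump\<close>.\<close>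

definition logistic :: "real \<Rightarrow> real \<Rightarrow> real" where
  "logistic \<alpha> x = 1 / (1 + exp (- (\<alpha> * x)))"

text \<open>The derivative of \<open>logistic\<close>. For \<alpha> > 0 it is comparable to exp (-
  \<alpha> |x|) (\<open>bump_le\<close>, \<open>exp_le_bump\<close>), and since its primitive runs
  from 0 to 1, its total mass is 1.\<close>

definition bump :: "real \<Rightarrow> real \<Rightarrow> real" where
  "bump \<alpha> x = \<alpha> * logistic \<alpha> x * (1 - logistic \<alpha> x)"

lemma logistic_pos: "0 < logistic \<alpha> x" and logistic_less_1: "logistic \<alpha> x < 1"
  by (simp_all add: logistic_def add_pos_pos)

lemma one_minus_logistic: "1 - logistic \<alpha> x = exp (- (\<alpha> * x)) * logistic \<alpha> x"
proof -
  have "1 + exp (- (\<alpha> * x)) \<noteq> 0"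
    by (smt (verit) exp_gt_zero)
  then show ?thesis by (simp add: logistic_def field_simps)
qed

lemma bump_pos: "0 < \<alpha> \<Longrightarrow> 0 < bump \<alpha> x"
  using logistic_pos[of \<alpha> x] logistic_less_1[of \<alpha> x] by (simp add: bump_def)

lemma logistic_minus: "logistic \<alpha> (- x) = 1 - logistic \<alpha> x"
proof -
  have "exp (- (\<alpha> * x)) * exp (\<alpha> * x) = 1" by (simp flip: exp_add)
  moreover have "1 + exp (- (\<alpha> * x)) > 0" "1 + exp (\<alpha> * x) > 0" by (simp_all add: add_pos_pos)
  ultimately show ?thesis by (simp add: logistic_def field_simps)
qed

lemma bump_minus: "bump \<alpha> (- x) = bump \<alpha> x"
  by (simp add: bump_def logistic_minus)

lemma DERIV_logistic: "(logistic \<alpha> has_real_derivative bump \<alpha> x) (at x)"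
proof -
  have nz: "1 + exp (- (\<alpha> * x)) \<noteq> 0"
    by (smt (verit) exp_gt_zero)
  have "(logistic \<alpha> has_real_derivative
      - (1 * (- (exp (- (\<alpha> * x)) * \<alpha>))) / ((1 + exp (- (\<alpha> * x))) * (1 + exp (- (\<alpha> * x))))) (at x)"
    unfolding logistic_def[abs_def]
    by (rule derivative_eq_intros refl nz | simp add: nz)+
  also have "- (1 * (- (exp (- (\<alpha> * x)) * \<alpha>))) / ((1 + exp (- (\<alpha> * x))) * (1 + exp (- (\<alpha> * x)))) = bump \<alpha> x"
    unfolding bump_def one_minus_logistic by (simp add: logistic_def)
  finally show ?thesis .
qed

lemma tendsto_logistic_at_bot: "0 < \<alpha> \<Longrightarrow> (logistic \<alpha> \<longlongrightarrow> 0) at_bot"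
  unfolding logistic_def[abs_def] by real_asymp

lemma bump_le:
  assumes "0 < \<alpha>" shows "bump \<alpha> x \<le> \<alpha> * exp (- (\<alpha> * \<bar>x\<bar>))"
proof (cases "0 \<le> x")
  case True
  have "logistic \<alpha> x * (1 - logistic \<alpha> x) \<le> 1 * (exp (- (\<alpha> * x)) * 1)"
    unfolding one_minus_logistic
    using logistic_pos[of \<alpha> x] logistic_less_1[of \<alpha> x] by (intro mult_mono) auto
  with True assms show ?thesis by (simp add: bump_def mult.assoc)
next
  case False
  have "logistic \<alpha> x \<le> exp (\<alpha> * x)"
  proof -
    have "logistic \<alpha> x \<le> 1 / exp (- (\<alpha> * x))"
      unfolding logistic_def by (intro divide_left_mono) (auto intro!: mult_pos_pos add_pos_pos)
    then show ?thesis by (simp add: exp_minus field_simps)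
  qed
  then have "logistic \<alpha> x * (1 - logistic \<alpha> x) \<le> exp (\<alpha> * x) * 1"
    using logistic_pos[of \<alpha> x] logistic_less_1[of \<alpha> x] by (intro mult_mono) auto
  with False assms show ?thesis by (simp add: bump_def mult.assoc)
qed

lemma exp_le_bump:
  assumes "0 < \<alpha>" shows "exp (- (\<alpha> * \<bar>x\<bar>)) \<le> 4 / \<alpha> * bump \<alpha> x"
proof -
  have half: "1 / 2 \<le> logistic \<alpha> y" if "0 \<le> y" for y
    unfolding logistic_def using that assms
    by (intro divide_left_mono) (auto intro!: mult_pos_pos add_pos_pos)
  have pos: "exp (- (\<alpha> * y)) \<le> 4 * (logistic \<alpha> y * (1 - logistic \<alpha> y))" if "0 \<le> y" for y
  proof -
    have "1 / 2 * 1 / 2 \<le> logistic \<alpha> y * logistic \<alpha> y"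
      using mult_mono[OF half[OF that] half[OF that]] logistic_pos[of \<alpha> y] by simp
    then show ?thesis unfolding one_minus_logistic
      by (simp add: mult.left_commute[of _ "exp _"])
  qed
  show ?thesis
  proof (cases "0 \<le> x")
    case True then show ?thesis using pos[of x] assms by (simp add: bump_def)
  next
    case False
    then show ?thesis using pos[of "-x"] assms
      by (simp add: bump_def logistic_minus mult.commute)
  qed
qed

text \<open>Mean value inequality on [y, x] with y sent to minus infinity. It takes the place of
  estimating an integral over a half-line.\<close>

lemma half_line_bound:
  fixes f :: "real \<Rightarrow> 'a::real_normed_vector"
  assumes f: "\<And>x. (f has_vector_derivative f' x) (at x)"
    and \<phi>: "\<And>x. (\<phi> has_real_derivative \<phi>' x) (at x)"
    and le: "\<And>x. norm (f' x) \<le> \<phi>' x"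
    and fl: "(f \<longlongrightarrow> l) at_bot" and \<phi>m: "(\<phi> \<longlongrightarrow> m) at_bot"
  shows "norm (f x - l) \<le> \<phi> x - m"
proof (rule tendsto_le)
  show "((\<lambda>y. norm (f x - f y)) \<longlongrightarrow> norm (f x - l)) at_bot"
    by (intro tendsto_intros fl)
  show "((\<lambda>y. \<phi> x - \<phi> y) \<longlongrightarrow> \<phi> x - m) at_bot"
    by (intro tendsto_intros \<phi>m)
  have "norm (f x - f y) \<le> \<phi> x - \<phi> y" if "y < x" for y
  proof (rule differentiable_bound_general[OF that])
    show "continuous_on {y..x} f"
      using f by (meson continuous_at_imp_continuous_on has_vector_derivative_continuous)
    show "continuous_on {y..x} \<phi>"
      using \<phi> by (meson DERIV_isCont continuous_at_imp_continuous_on)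
  qed (use f \<phi> le in \<open>auto simp: has_real_derivative_iff_has_vector_derivative\<close>)
  then show "\<forall>\<^sub>F y in at_bot. norm (f x - f y) \<le> \<phi> x - \<phi> y"
    by (auto simp: eventually_at_bot_dense)
qed simp

lemma increment_le_logistic:
  fixes f :: "real \<Rightarrow> 'a::real_normed_vector"
  assumes f: "\<And>x. (f has_vector_derivative f' x) (at x)"
    and le: "\<And>x. norm (f' x) \<le> c * bump \<alpha> x" and "y \<le> x"
  shows "norm (f x - f y) \<le> c * (logistic \<alpha> x - logistic \<alpha> y)"
proof (cases "y = x")
  case False
  have "norm (f x - f y) \<le> c * logistic \<alpha> x - c * logistic \<alpha> y"
  proof (rule differentiable_bound_general)
    show "continuous_on {y..x} f"
      using f by (meson continuous_at_imp_continuous_on has_vector_derivative_continuous)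
    show "continuous_on {y..x} (\<lambda>x. c * logistic \<alpha> x)"
      by (intro continuous_on_mult_left DERIV_continuous_on[where D = "bump \<alpha>"]
          has_field_derivative_at_within[OF DERIV_logistic])
    show "((\<lambda>x. c * logistic \<alpha> x) has_vector_derivative c * bump \<alpha> t) (at t)" for t
      unfolding has_real_derivative_iff_has_vector_derivative[symmetric]
      by (intro DERIV_cmult DERIV_logistic)
  qed (use f le \<open>y \<le> x\<close> False in auto)
  then show ?thesis by (simp add: algebra_simps)
qed simp

text \<open>Cauchy criterion: all increments to the left of x are at most
  \<open>c * logistic \<alpha> x\<close>, which vanishes at minus infinity.\<close>

lemma ex_limit_at_bot:
  fixes f :: "real \<Rightarrow> 'a::banach"
  assumes "0 < \<alpha>" and f: "\<And>x. (f has_vector_derivative f' x) (at x)"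
    and le: "\<And>x. norm (f' x) \<le> c * bump \<alpha> x"
  shows "\<exists>l. (f \<longlongrightarrow> l) at_bot"
proof -
  have c: "0 \<le> c"
    using order_trans[OF norm_ge_zero le[of 0]] bump_pos[OF \<open>0 < \<alpha>\<close>, of 0]
    by (simp add: zero_le_mult_iff)
  have inc: "norm (f x - f y) \<le> c * logistic \<alpha> x" if "y \<le> x" for x y
    using increment_le_logistic[OF f le that] logistic_pos[of \<alpha> y] c
    by (smt (verit, best) mult_left_mono)
  have lim0: "((\<lambda>x. c * logistic \<alpha> x) \<longlongrightarrow> 0) at_bot"
    using tendsto_mult_right_zero[OF tendsto_logistic_at_bot[OF \<open>0 < \<alpha>\<close>]] .
  have seq: "filterlim (\<lambda>n. - real n) at_bot sequentially" by real_asymp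
  have "Cauchy (\<lambda>n. f (- real n))"
  proof (rule CauchyI)
    fix e :: real assume "0 < e"
    from filterlim_compose[OF lim0 seq] \<open>0 < e\<close>
    have "\<forall>\<^sub>F n in sequentially. c * logistic \<alpha> (- real n) < e"
      using order_tendstoD(2) by blast
    then obtain M where M: "\<And>n. M \<le> n \<Longrightarrow> c * logistic \<alpha> (- real n) < e"
      by (auto simp: eventually_sequentially)
    have *: "norm (f (- real m) - f (- real n)) < e" if "M \<le> m" "m \<le> n" for m n
      using inc[of "- real n" "- real m"] M[of m] that by simp
    show "\<exists>M. \<forall>m\<ge>M. \<forall>n\<ge>M. norm (f (- real m) - f (- real n)) < e"
      using * by (metis nle_le norm_minus_commute)
  qed
  then obtain l where l: "(\<lambda>n. f (- real n)) \<longlonglongrightarrow> l"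
    using Cauchy_convergent convergent_def by blast
  \<comment> \<open>Passing to the limit in \<open>inc\<close> along -n carries the limit over from
    the integers to all real x, with a rate.\<close>
  have "norm (f x - l) \<le> c * logistic \<alpha> x" for x
  proof (rule tendsto_upperbound)
    show "(\<lambda>n. norm (f x - f (- real n))) \<longlonglongrightarrow> norm (f x - l)"
      by (intro tendsto_intros l)
    have "\<forall>\<^sub>F n in sequentially. - real n \<le> x"
      using seq by (simp add: filterlim_at_bot)
    then show "\<forall>\<^sub>F n in sequentially. norm (f x - f (- real n)) \<le> c * logistic \<alpha> x"
      by eventually_elim (rule inc)
  qed simp
  then have "((\<lambda>x. f x - l) \<longlongrightarrow> 0) at_bot"
    by (intro Lim_null_comparison[OF _ lim0]) auto
  then show ?thesis by (auto simp: LIM_zero_iff)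
qed

lemma ex_primitive_at_bot:
  fixes F :: "real \<Rightarrow> complex"
  assumes "0 < \<alpha>" and F: "continuous_on UNIV F" and le: "\<And>x. norm (F x) \<le> c * bump \<alpha> x"
  obtains H where "\<And>x. (H has_vector_derivative F x) (at x)" "(H \<longlongrightarrow> 0) at_bot"
proof -
  obtain H where H: "\<And>x. (H has_vector_derivative F x) (at x)"
    using einterval_antiderivative[of "-\<infinity>" \<infinity> F] F by (auto simp: continuous_on_eq_continuous_at)
  obtain l where l: "(H \<longlongrightarrow> l) at_bot"
    using ex_limit_at_bot[OF \<open>0 < \<alpha>\<close> H le] by blast
  show thesis
  proof (rule that)
    show "((\<lambda>x. H x - l) has_vector_derivative F x) (at x)" for x
      using has_vector_derivative_diff[OF H has_vector_derivative_const] by simp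
    show "((\<lambda>x. H x - l) \<longlongrightarrow> 0) at_bot"
      using l by (simp add: LIM_zero)
  qed
qed

section \<open>Primitives on the strip normalised at the left end\<close>

lemma convex_strip: "convex (strip d)" and open_strip: "open (strip d)"
proof -
  have eq: "strip d = {z. Im z < d} \<inter> {z. Im z > - d}" by (auto simp: strip_def)
  show "convex (strip d)" unfolding eq by (intro convex_Int convex_halfspace_Im_lt convex_halfspace_Im_gt)
  show "open (strip d)" unfolding eq by (intro open_Int open_halfspace_Im_lt open_halfspace_Im_gt)
qed

text \<open>This says that \<Phi> is l plus the integral of F from minus infinity to \<zeta> along a
  horizontal line. As a relation between derivative and limits it needs no improper complex
  integral, and linearity reduces to the rules for derivatives and limits.\<close>

definition bot_prim :: "real \<Rightarrow> complex \<Rightarrow> (complex \<Rightarrow> complex) \<Rightarrow> (complex \<Rightarrow> complex) \<Rightarrow> bool" where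
  "bot_prim d l F \<Phi> \<longleftrightarrow> (\<forall>\<zeta>\<in>strip d. (\<Phi> has_field_derivative F \<zeta>) (at \<zeta>)) \<and>
     (\<forall>y. \<bar>y\<bar> < d \<longrightarrow> ((\<lambda>x. \<Phi> (Complex x y)) \<longlongrightarrow> l) at_bot)"

lemma has_vector_derivative_horizontal:
  assumes "(\<Phi> has_field_derivative F) (at (Complex x y))"
  shows "((\<lambda>x. \<Phi> (Complex x y)) has_vector_derivative F) (at x)"
proof -
  have "((\<lambda>x. of_real x + Complex 0 y) has_vector_derivative 1) (at x)"
    by (auto intro!: derivative_eq_intros)
  moreover have "(\<lambda>x. of_real x + Complex 0 y) = (\<lambda>x. Complex x y)"
    by (auto simp: complex_eq_iff)
  ultimately have "((\<lambda>x. Complex x y) has_vector_derivative 1) (at x)" by simp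
  from field_vector_diff_chain_at[OF this assms] show ?thesis by (simp add: o_def)
qed

lemma bot_prim_holomorphic: "bot_prim d l F \<Phi> \<Longrightarrow> \<Phi> holomorphic_on strip d"
  unfolding bot_prim_def using open_strip[of d]
  by (auto simp: holomorphic_on_open)

lemma bot_prim_bound:
  assumes p: "bot_prim d l F \<Phi>" and z: "\<zeta> \<in> strip d"
    and \<phi>: "\<And>x. (\<phi> has_real_derivative \<phi>' x) (at x)" and m: "(\<phi> \<longlongrightarrow> m) at_bot"
    and le: "\<And>z. z \<in> strip d \<Longrightarrow> norm (F z) \<le> \<phi>' (Re z)"
  shows "norm (\<Phi> \<zeta> - l) \<le> \<phi> (Re \<zeta>) - m"
proof -
  have y: "\<bar>Im \<zeta>\<bar> < d" using z by (simp add: strip_def)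
  have s: "Complex x (Im \<zeta>) \<in> strip d" for x using y by (simp add: strip_def)
  have "norm (\<Phi> (Complex (Re \<zeta>) (Im \<zeta>)) - l) \<le> \<phi> (Re \<zeta>) - m"
  proof (rule half_line_bound[where f = "\<lambda>x. \<Phi> (Complex x (Im \<zeta>))"])
    show "((\<lambda>x. \<Phi> (Complex x (Im \<zeta>))) has_vector_derivative F (Complex x (Im \<zeta>))) (at x)" for x
      using p s by (auto simp: bot_prim_def intro: has_vector_derivative_horizontal)
    show "norm (F (Complex x (Im \<zeta>))) \<le> \<phi>' x" for x using le[OF s] by simp
    show "((\<lambda>x. \<Phi> (Complex x (Im \<zeta>))) \<longlongrightarrow> l) at_bot"
      using p y by (simp add: bot_prim_def)
  qed (use \<phi> m in auto)
  then show ?thesis by simp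
qed

lemma bot_prim_bound_bump:
  assumes p: "bot_prim d l F \<Phi>" and z: "\<zeta> \<in> strip d" and "0 < \<alpha>"
    and le: "\<And>z. z \<in> strip d \<Longrightarrow> norm (F z) \<le> c * bump \<alpha> (Re z)"
  shows "norm (\<Phi> \<zeta> - l) \<le> c"
proof -
  have "0 \<le> c"
    using order_trans[OF norm_ge_zero le[OF z]] bump_pos[OF \<open>0 < \<alpha>\<close>, of "Re \<zeta>"]
    by (simp add: zero_le_mult_iff)
  have "norm (\<Phi> \<zeta> - l) \<le> c * logistic \<alpha> (Re \<zeta>) - 0"
    by (rule bot_prim_bound[OF p z _ _ le])
      (auto intro!: DERIV_cmult DERIV_logistic tendsto_mult_right_zero tendsto_logistic_at_bot \<open>0 < \<alpha>\<close>)
  also have "\<dots> \<le> c"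
    using logistic_less_1[of \<alpha> "Re \<zeta>"] \<open>0 \<le> c\<close> by (simp add: mult_left_le)
  finally show ?thesis .
qed

lemma bot_prim_diff:
  assumes "bot_prim d l F \<Phi>" "bot_prim d l' G \<Gamma>"
  shows "bot_prim d (l - l') (\<lambda>z. F z - G z) (\<lambda>z. \<Phi> z - \<Gamma> z)"
  using assms by (auto simp: bot_prim_def intro!: derivative_intros tendsto_intros)

lemma bot_prim_cmult:
  assumes "bot_prim d l F \<Phi>"
  shows "bot_prim d (k * l) (\<lambda>z. k * F z) (\<lambda>z. k * \<Phi> z)"
  using assms by (auto simp: bot_prim_def intro!: tendsto_intros DERIV_cmult)

text \<open>Convexity gives a primitive, domination by \<open>bump\<close> gives a limit on each
  horizontal line. The limits on two lines agree because the vertical segment joining them at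
  abscissa x contributes at most its length times \<open>c * bump \<alpha> x\<close>, which vanishes
  at minus infinity. The common limit is then shifted to l.\<close>

lemma ex_bot_prim:
  assumes "0 < \<alpha>" "0 < d" and F: "F holomorphic_on strip d"
    and le: "\<And>z. z \<in> strip d \<Longrightarrow> norm (F z) \<le> c * bump \<alpha> (Re z)"
  obtains \<Phi> where "bot_prim d l F \<Phi>"
proof -
  obtain P where P: "\<And>z. z \<in> strip d \<Longrightarrow> (P has_field_derivative F z) (at z)"
    using holomorphic_convex_primitive'[OF convex_strip open_strip F] 
    by (metis at_within_open open_strip)
  have "\<exists>l. \<forall>y. \<bar>y\<bar> < d \<longrightarrow> ((\<lambda>x. P (Complex x y)) \<longlongrightarrow> l) at_bot"
  proof -
    have s: "Complex x y \<in> strip d" if "\<bar>y\<bar> < d" for x y using that by (simp add: strip_def)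
    have "\<exists>l. ((\<lambda>x. P (Complex x y)) \<longlongrightarrow> l) at_bot" if y: "\<bar>y\<bar> < d" for y
      by (rule ex_limit_at_bot[OF \<open>0 < \<alpha>\<close>, where f' = "\<lambda>x. F (Complex x y)" and c = c])
         (use P s[OF y] le[OF s[OF y]] in \<open>auto intro: has_vector_derivative_horizontal\<close>)
    then obtain l where l: "((\<lambda>x. P (Complex x 0)) \<longlongrightarrow> l) at_bot"
      using \<open>0 < d\<close> by fastforce
    have b0: "((\<lambda>x. c * bump \<alpha> x) \<longlongrightarrow> 0) at_bot"
      unfolding bump_def using tendsto_logistic_at_bot[OF \<open>0 < \<alpha>\<close>]
      by (auto intro!: tendsto_eq_intros)
    have "((\<lambda>x. P (Complex x y)) \<longlongrightarrow> l) at_bot" if y: "\<bar>y\<bar> < d" for y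
    proof -
      have "norm (P (Complex x y) - P (Complex x 0)) \<le> c * bump \<alpha> x * \<bar>y\<bar>" for x
      proof -
        have seg: "closed_segment (Complex x 0) (Complex x y) \<subseteq> {z. Re z = x} \<inter> strip d"
          using y by (auto simp: closed_segment_same_Re closed_segment_eq_real_ivl strip_def split: if_splits)
        have "norm (P (Complex x y) - P (Complex x 0)) \<le> c * bump \<alpha> x * norm (Complex x y - Complex x 0)"
        proof (rule field_differentiable_bound)
          show "convex (closed_segment (Complex x 0) (Complex x y))" by simp
          fix z assume z: "z \<in> closed_segment (Complex x 0) (Complex x y)"
          with seg have z': "z \<in> strip d" "Re z = x" by auto
          then show "(P has_field_derivative F z) (at z within closed_segment (Complex x 0) (Complex x y))"
            using P has_field_derivative_at_within by blast
          show "norm (F z) \<le> c * bump \<alpha> x" using le[OF z'(1)] z'(2) by simp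
        qed auto
        also have "norm (Complex x y - Complex x 0) = \<bar>y\<bar>"
          by (simp add: cmod_def minus_complex.ctr)
        finally show ?thesis .
      qed
      then have "((\<lambda>x. P (Complex x y) - P (Complex x 0)) \<longlongrightarrow> 0) at_bot"
        by (intro Lim_null_comparison[OF always_eventually tendsto_mult_left_zero[OF b0]] allI)
      from tendsto_add[OF this l] show ?thesis by simp
    qed
    then show ?thesis by blast
  qed
  then obtain k where k: "\<And>y. \<bar>y\<bar> < d \<Longrightarrow> ((\<lambda>x. P (Complex x y)) \<longlongrightarrow> k) at_bot" by blast
  show thesis
  proof (rule that[of "\<lambda>z. P z + (l - k)"])
    show "bot_prim d l F (\<lambda>z. P z + (l - k))"
      using P k by (auto simp: bot_prim_def intro!: derivative_eq_intros tendsto_eq_intros)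
  qed
qed

section \<open>The Volterra equation in the strip\<close>

lemma taylor_bounds:
  assumes f: "f holomorphic_on ball z r" and "0 < r"
    and le: "\<And>w. w \<in> ball z r \<Longrightarrow> norm (f w) \<le> B" and h: "norm h < r / 2"
  shows holomorphic_increment_bound: "norm (f (z + h) - f z) \<le> 4 * B / r * norm h"
    and holomorphic_taylor2_bound: "norm (f (z + h) - f z - h * deriv f z) \<le> 32 * B / r\<^sup>2 * (norm h)\<^sup>2"
proof -
  \<comment> \<open>Around each point of the ball of radius r/2 a closed disc of radius r/4 stays
    inside \<open>ball z r\<close>. The cases n = 1 and n = 2 produce the constants 4 and 2 * 16 =
    32.\<close>
  have cau: "norm ((deriv ^^ n) f w) \<le> fact n * B / (r / 4) ^ n" if w: "w \<in> ball z (r / 2)" for n w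
  proof (rule Cauchy_inequality)
    have sub: "cball w (r / 4) \<subseteq> ball z r"
    proof
      fix x assume "x \<in> cball w (r / 4)"
      then show "x \<in> ball z r"
        using w \<open>0 < r\<close> dist_triangle[of z x w] by simp
    qed
    show "f holomorphic_on ball w (r / 4)"
      using f sub ball_subset_cball holomorphic_on_subset by blast
    show "continuous_on (cball w (r / 4)) f"
      using f sub holomorphic_on_imp_continuous_on holomorphic_on_subset by blast
    show "norm (f x) \<le> B" if "norm (w - x) = r / 4" for x
      using le sub that by (simp add: subset_iff dist_norm)
  qed (use \<open>0 < r\<close> in simp)
  have der: "((deriv ^^ i) f has_field_derivative (deriv ^^ Suc i) f x) (at x within ball z (r / 2))"
    if "x \<in> ball z (r / 2)" for i x
  proof -
    have "(deriv ^^ i) f holomorphic_on ball z r"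
      using f by (simp add: holomorphic_higher_deriv)
    moreover have "x \<in> ball z r" using that \<open>0 < r\<close> by simp
    ultimately have "((deriv ^^ i) f has_field_derivative deriv ((deriv ^^ i) f) x) (at x)"
      by (metis holomorphic_derivI open_ball)
    then show ?thesis by (simp add: has_field_derivative_at_within)
  qed
  have mem: "z \<in> ball z (r / 2)" "z + h \<in> ball z (r / 2)"
    using h \<open>0 < r\<close> by (auto simp: dist_norm)
  show "norm (f (z + h) - f z) \<le> 4 * B / r * norm h"
    using field_Taylor[of "ball z (r / 2)" 0 "\<lambda>i. (deriv ^^ i) f" "fact 1 * B / (r / 4) ^ 1", OF convex_ball der _ mem]
      cau[of _ 1] by (simp add: mult.commute)
  show "norm (f (z + h) - f z - h * deriv f z) \<le> 32 * B / r\<^sup>2 * (norm h)\<^sup>2"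
    using field_Taylor[of "ball z (r / 2)" 1 "\<lambda>i. (deriv ^^ i) f" "fact 2 * B / (r / 4) ^ 2", OF convex_ball der _ mem]
      cau[of _ 2] by (simp add: mult.commute numeral_2_eq_2[symmetric] power_divide diff_diff_eq algebra_simps)
qed

lemma bot_prim_cong:
  assumes "bot_prim d l F \<Phi>" "\<And>z. z \<in> strip d \<Longrightarrow> F z = G z"
  shows "bot_prim d l G \<Phi>"
  using assms by (simp add: bot_prim_def)

text \<open>The steps from n on add up to at most 2 K / 2^n. The explicit rate is what makes
  pointwise limits of the iterates uniform on the strip.\<close>

lemma geometric_steps_limit:
  fixes x :: "nat \<Rightarrow> 'a::banach"
  assumes st: "\<And>n. norm (x (Suc n) - x n) \<le> K / 2 ^ n"
  shows "\<exists>l. \<forall>n. norm (l - x n) \<le> 2 * K / 2 ^ n"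
proof -
  have tel: "norm (x (n + k) - x n) \<le> 2 * K / 2 ^ n - 2 * K / 2 ^ (n + k)" for n k
  proof (induction k)
    case (Suc k)
    have "norm (x (n + Suc k) - x n) \<le> norm (x (Suc (n + k)) - x (n + k)) + norm (x (n + k) - x n)"
      using norm_triangle_ineq[of "x (Suc (n + k)) - x (n + k)" "x (n + k) - x n"] by simp
    also have "\<dots> \<le> K / 2 ^ (n + k) + (2 * K / 2 ^ n - 2 * K / 2 ^ (n + k))"
      by (intro add_mono st Suc)
    finally show ?case by (simp add: field_simps)
  qed simp
  have K: "0 \<le> K" using order_trans[OF norm_ge_zero st[of 0]] by simp
  have le: "norm (x m - x n) \<le> 2 * K / 2 ^ n" if "n \<le> m" for m n
  proof -
    have "0 \<le> 2 * K / 2 ^ m" using K by simp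
    with tel[of n "m - n"] that show ?thesis by simp
  qed
  have "Cauchy x"
  proof (rule CauchyI)
    fix e :: real assume "0 < e"
    have "(\<lambda>n. 2 * K / 2 ^ n) \<longlonglongrightarrow> 0" by real_asymp
    then have "\<forall>\<^sub>F n in sequentially. 2 * K / 2 ^ n < e"
      using order_tendstoD(2) \<open>0 < e\<close> by blast
    then obtain M where M: "\<And>n. M \<le> n \<Longrightarrow> 2 * K / 2 ^ n < e"
      by (auto simp: eventually_sequentially)
    have "norm (x m - x n) < e" if "M \<le> n" "n \<le> m" for m n
      using le[OF that(2)] M[OF that(1)] by simp
    then show "\<exists>M. \<forall>m\<ge>M. \<forall>n\<ge>M. norm (x m - x n) < e"
      by (metis nle_le norm_minus_commute)
  qed
  then obtain l where l: "x \<longlonglongrightarrow> l"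
    using Cauchy_convergent convergent_def by blast
  have "norm (l - x n) \<le> 2 * K / 2 ^ n" for n
  proof (rule tendsto_upperbound)
    show "(\<lambda>m. norm (x m - x n)) \<longlonglongrightarrow> norm (l - x n)" by (intro tendsto_intros l)
    show "\<forall>\<^sub>F m in sequentially. norm (x m - x n) \<le> 2 * K / 2 ^ n"
      using eventually_ge_at_top[of n] by eventually_elim (rule le)
  qed simp
  then show ?thesis by blast
qed

lemma ball_subset_strip: "ball z (d - \<bar>Im z\<bar>) \<subseteq> strip d"
proof
  fix w assume w: "w \<in> ball z (d - \<bar>Im z\<bar>)"
  have "\<bar>Im (w - z)\<bar> \<le> norm (w - z)" by (rule abs_Im_le_cmod)
  with w show "w \<in> strip d" by (simp add: strip_def dist_norm norm_minus_commute)
qed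

lemma holomorphic_on_strip_limit:
  assumes f: "\<And>n. f n holomorphic_on strip d" and K: "K \<longlonglongrightarrow> 0"
    and le: "\<And>n z. z \<in> strip d \<Longrightarrow> norm (f n z - g z) \<le> K n"
  shows "g holomorphic_on strip d"
proof (rule holomorphic_uniform_sequence[OF open_strip f])
  fix x assume "x \<in> strip d"
  then obtain e where e: "0 < e" "cball x e \<subseteq> strip d"
    using open_strip open_contains_cball by blast
  have "uniform_limit (cball x e) f g sequentially"
  proof (rule uniform_limitI)
    fix \<epsilon> :: real assume "0 < \<epsilon>"
    with K have "\<forall>\<^sub>F n in sequentially. K n < \<epsilon>" by (rule order_tendstoD(2))
    then show "\<forall>\<^sub>F n in sequentially. \<forall>z\<in>cball x e. dist (f n z) (g z) < \<epsilon>"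
    proof eventually_elim
      case (elim n)
      show ?case unfolding dist_norm
        using le[OF subsetD[OF e(2)], of _ n] elim by (blast intro: le_less_trans)
    qed
  qed
  with e show "\<exists>e. 0 < e \<and> cball x e \<subseteq> strip d \<and> uniform_limit (cball x e) f g sequentially"
    by blast
qed

lemma DERIV_exp_logistic:
  "((\<lambda>x. K * exp (r * logistic \<alpha> x)) has_real_derivative K * r * exp (r * logistic \<alpha> x) * bump \<alpha> x) (at x)"
  by (auto intro!: derivative_eq_intros DERIV_logistic)

lemma tendsto_exp_logistic:
  assumes "0 < \<alpha>"
  shows "((\<lambda>x. K * exp (r * logistic \<alpha> x)) \<longlongrightarrow> (K::real)) at_bot"
  using tendsto_mult[OF tendsto_const[of K] tendsto_exp[OF tendsto_mult_right_zero[OF tendsto_logistic_at_bot[OF assms]]], of r]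
  by simp

text \<open>Here e is the difference of two functions and h that of their Picard iterates. The
  weight exp (r * logistic) times r * bump is an exact derivative, so integrating against c * bump
  gains 1/r. The inner integral \<open>K s s\<close> costs at most a factor c, and the outer one
  then yields c (1 + c) / r \<le> 1/2 by the choice of r. Stated on a single line, it serves both
  the iteration in the strip and uniqueness on the reals.\<close>

lemma volterra_line_contraction:
  fixes e h :: "real \<Rightarrow> complex" and K :: "real \<Rightarrow> real \<Rightarrow> complex"
  assumes al: "0 < \<alpha>" and c: "0 \<le> c" and r: "r = 2 * (c * (1 + c)) + 1"
    and h: "\<And>s. (h has_vector_derivative m s * e s + p s * K s s) (at s)" and h0: "(h \<longlongrightarrow> 0) at_bot"
    and K: "\<And>s t. (K s has_vector_derivative kk s t * e t) (at t)" and K0: "\<And>s. (K s \<longlongrightarrow> 0) at_bot"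
    and m: "\<And>s. norm (m s) \<le> c * bump \<alpha> s" and p: "\<And>s. norm (p s) \<le> c * bump \<alpha> s"
    and kk: "\<And>s t. norm (kk s t) \<le> c * bump \<alpha> t"
    and M: "\<And>t. norm (e t) \<le> M * exp (r * logistic \<alpha> t)"
  shows "norm (h s) \<le> M / 2 * exp (r * logistic \<alpha> s)"
proof -
  let ?e = "\<lambda>x. exp (r * logistic \<alpha> x)"
  have r1: "1 \<le> r" using c by (simp add: r)
  have b0: "0 \<le> bump \<alpha> x" for x using bump_pos[OF al, of x] by simp
  have M0: "0 \<le> M"
    using order_trans[OF norm_ge_zero M[of 0]] by (simp add: zero_le_mult_iff)
  have V: "norm (K s s) \<le> c * M * ?e s" for s
  proof -
    have "norm (K s s - 0) \<le> c * M / r * ?e s - c * M / r"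
    proof (rule half_line_bound[OF K DERIV_exp_logistic _ K0 tendsto_exp_logistic[OF al]])
      fix t
      have "norm (kk s t * e t) \<le> c * bump \<alpha> t * (M * ?e t)"
        unfolding norm_mult using c b0 by (intro mult_mono kk M) auto
      also have "\<dots> = c * M / r * r * ?e t * bump \<alpha> t" using r1 by simp
      finally show "norm (kk s t * e t) \<le> c * M / r * r * ?e t * bump \<alpha> t" .
    qed
    also have "\<dots> \<le> c * M / r * ?e s" using r1 c M0 by simp
    \<comment> \<open>The gain 1/r of the inner integral is given away; the outer integral alone
      provides the factor 1/2.\<close>
    also have "\<dots> \<le> c * M / 1 * ?e s"
      using r1 c M0 by (intro mult_right_mono divide_left_mono) auto
    finally show ?thesis by simp
  qed
  have "norm (h s - 0) \<le> c * (1 + c) * M / r * ?e s - c * (1 + c) * M / r"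
  proof (rule half_line_bound[OF h DERIV_exp_logistic _ h0 tendsto_exp_logistic[OF al]])
    fix t
    have "norm (m t * e t + p t * K t t) \<le> norm (m t) * norm (e t) + norm (p t) * norm (K t t)"
      unfolding norm_mult[symmetric] by (rule norm_triangle_ineq)
    also have "\<dots> \<le> c * bump \<alpha> t * (M * ?e t) + c * bump \<alpha> t * (c * M * ?e t)"
      using c b0 by (intro add_mono mult_mono m p M V) auto
    also have "\<dots> = c * (1 + c) * M / r * r * ?e t * bump \<alpha> t"
    proof -
      have "c * (1 + c) * M / r * r = c * (1 + c) * M" using r1 by simp
      then show ?thesis by (simp only:) (simp add: algebra_simps)
    qed
    finally show "norm (m t * e t + p t * K t t) \<le> c * (1 + c) * M / r * r * ?e t * bump \<alpha> t" .
  qed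
  also have "\<dots> \<le> c * (1 + c) * M / r * ?e s" using r1 c M0 by simp
  also have "\<dots> \<le> M / 2 * ?e s"
  proof (rule mult_right_mono)
    have "c * (1 + c) / r \<le> 1 / 2" using r1 by (simp add: r field_simps)
    from mult_right_mono[OF this M0] show "c * (1 + c) * M / r \<le> M / 2" by (simp add: mult_ac)
  qed simp
  finally show ?thesis by simp
qed

section \<open>Holomorphy of the Volterra integral\<close>

locale volterra_kernel =
  fixes \<alpha> d c :: real and \<kappa> :: "complex \<Rightarrow> complex \<Rightarrow> complex"
  assumes alpha_pos: "0 < \<alpha>" and d_pos: "0 < d"
    and hol1: "\<And>w. w \<in> strip d \<Longrightarrow> (\<lambda>z. \<kappa> z w) holomorphic_on strip d"
    and hol2: "\<And>z. z \<in> strip d \<Longrightarrow> \<kappa> z holomorphic_on strip d"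
    and kernel_bound: "\<And>z w. z \<in> strip d \<Longrightarrow> w \<in> strip d \<Longrightarrow> norm (\<kappa> z w) \<le> c * bump \<alpha> (Re w)"
begin

lemma zero_in_strip: "0 \<in> strip d"
  using d_pos by (simp add: strip_def)

lemma c_nonneg: "0 \<le> c"
proof -
  from order_trans[OF norm_ge_zero kernel_bound[OF zero_in_strip zero_in_strip]] bump_pos[OF alpha_pos, of 0]
  show ?thesis by (simp add: zero_le_mult_iff)
qed

lemma bump_nonneg: "0 \<le> bump \<alpha> x"
  using bump_pos[OF alpha_pos] by (simp add: less_imp_le)

lemma kernel_mult_bound:
  assumes "z \<in> strip d" "w \<in> strip d" "norm x \<le> B"
  shows "norm (\<kappa> z w * x) \<le> c * B * bump \<alpha> (Re w)"
  using mult_mono[OF kernel_bound[OF assms(1,2)] assms(3)] c_nonneg bump_nonneg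
  by (simp add: norm_mult mult_ac)

definition d\<kappa> :: "complex \<Rightarrow> complex \<Rightarrow> complex" where
  "d\<kappa> \<sigma> \<rho> = deriv (\<lambda>z. \<kappa> z \<rho>) \<sigma>"

lemma radius_pos: "\<sigma> \<in> strip d \<Longrightarrow> 0 < d - \<bar>Im \<sigma>\<bar>"
  by (simp add: strip_def)

lemma kernel_increment:
  assumes s: "\<sigma> \<in> strip d" and r: "\<rho> \<in> strip d" and h: "norm h < (d - \<bar>Im \<sigma>\<bar>) / 2"
  shows "norm (\<kappa> (\<sigma> + h) \<rho> - \<kappa> \<sigma> \<rho>) \<le> 4 * (c * bump \<alpha> (Re \<rho>)) / (d - \<bar>Im \<sigma>\<bar>) * norm h"
    and "norm (\<kappa> (\<sigma> + h) \<rho> - \<kappa> \<sigma> \<rho> - h * d\<kappa> \<sigma> \<rho>) \<le> 32 * (c * bump \<alpha> (Re \<rho>)) / (d - \<bar>Im \<sigma>\<bar>)\<^sup>2 * (norm h)\<^sup>2"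
  using taylor_bounds[OF holomorphic_on_subset[OF hol1[OF r] ball_subset_strip] radius_pos[OF s] _ h,
      of "c * bump \<alpha> (Re \<rho>)"] kernel_bound[OF _ r] ball_subset_strip[of \<sigma> d]
  by (simp_all add: d\<kappa>_def subset_iff)

text \<open>Trading the decay in \<rho> for the constant \<alpha> leaves a remainder bound
  independent of \<rho>, so difference quotients in the first variable converge uniformly in
  \<rho>.\<close>

lemma kernel_taylor_uniform:
  assumes s: "\<sigma> \<in> strip d" and r: "\<rho> \<in> strip d" and h: "norm h < (d - \<bar>Im \<sigma>\<bar>) / 2"
  shows "norm (\<kappa> (\<sigma> + h) \<rho> - \<kappa> \<sigma> \<rho> - h * d\<kappa> \<sigma> \<rho>) \<le> 32 * (c * \<alpha>) / (d - \<bar>Im \<sigma>\<bar>)\<^sup>2 * (norm h)\<^sup>2"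
proof -
  have "bump \<alpha> (Re \<rho>) \<le> \<alpha> * 1"
    using bump_le[OF alpha_pos, of "Re \<rho>"] alpha_pos
    by (elim order_trans) (intro mult_left_mono, auto)
  then show ?thesis
    using kernel_increment(2)[OF assms] c_nonneg
    by (elim order_trans) (intro mult_right_mono divide_right_mono mult_left_mono, auto)
qed

text \<open>The derivative in the first variable is a uniform limit of difference quotients, each
  holomorphic in \<rho>. In this way separate holomorphy suffices.\<close>

lemma d\<kappa>_holomorphic:
  assumes s: "\<sigma> \<in> strip d" shows "d\<kappa> \<sigma> holomorphic_on strip d"
proof -
  define r where "r = d - \<bar>Im \<sigma>\<bar>"
  define h where "h n = r / (2 * real (n + 2))" for n :: nat
  have r: "0 < r" using radius_pos[OF s] by (simp add: r_def)
  have hpos: "0 < h n" and hlt: "h n < r / 2" for n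
    using r by (simp_all add: h_def field_simps add_pos_nonneg)
  have h0: "h \<longlonglongrightarrow> 0" unfolding h_def[abs_def] by real_asymp
  have sh: "\<sigma> + of_real (h n) \<in> strip d" for n
    using hlt[of n] hpos[of n] r ball_subset_strip[of \<sigma> d] by (auto simp: dist_norm r_def subset_iff)
  define K where "K = 32 * (c * \<alpha>) / r\<^sup>2"
  define f where "f n \<rho> = (\<kappa> (\<sigma> + of_real (h n)) \<rho> - \<kappa> \<sigma> \<rho>) / of_real (h n)" for n \<rho>
  have le: "norm (f n \<rho> - d\<kappa> \<sigma> \<rho>) \<le> K * h n" if "\<rho> \<in> strip d" for n \<rho>
  proof -
    have "f n \<rho> - d\<kappa> \<sigma> \<rho> = (\<kappa> (\<sigma> + of_real (h n)) \<rho> - \<kappa> \<sigma> \<rho> - of_real (h n) * d\<kappa> \<sigma> \<rho>) / of_real (h n)"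
      using hpos[of n] by (simp add: f_def field_simps)
    then have "norm (f n \<rho> - d\<kappa> \<sigma> \<rho>) = norm (\<kappa> (\<sigma> + of_real (h n)) \<rho> - \<kappa> \<sigma> \<rho> - of_real (h n) * d\<kappa> \<sigma> \<rho>) / h n"
      using hpos[of n] by (simp add: norm_divide)
    also have "\<dots> \<le> K * (h n)\<^sup>2 / h n"
      using kernel_taylor_uniform[OF s that, of "of_real (h n)"] hpos[of n] hlt[of n]
      by (intro divide_right_mono) (auto simp: K_def r_def)
    also have "\<dots> = K * h n" using hpos[of n] by (simp add: power2_eq_square)
    finally show ?thesis .
  qed
  show ?thesis
  proof (rule holomorphic_on_strip_limit[OF _ tendsto_mult_right_zero[OF h0] le])
    show "f n holomorphic_on strip d" for n
      unfolding f_def using hpos[of n] by (intro holomorphic_intros hol2 sh s) auto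
  qed
qed

lemma d\<kappa>_bound:
  assumes s: "\<sigma> \<in> strip d" and r: "\<rho> \<in> strip d"
  shows "norm (d\<kappa> \<sigma> \<rho>) \<le> 2 * c / (d - \<bar>Im \<sigma>\<bar>) * bump \<alpha> (Re \<rho>)"
proof -
  define R where "R = d - \<bar>Im \<sigma>\<bar>"
  have R: "0 < R" using radius_pos[OF s] by (simp add: R_def)
  have sub: "cball \<sigma> (R / 2) \<subseteq> strip d"
    using ball_subset_strip[of \<sigma> d] R by (force simp: R_def subset_iff)
  have "norm ((deriv ^^ 1) (\<lambda>z. \<kappa> z \<rho>) \<sigma>) \<le> fact 1 * (c * bump \<alpha> (Re \<rho>)) / (R / 2) ^ 1"
  proof (rule Cauchy_inequality)
    show "(\<lambda>z. \<kappa> z \<rho>) holomorphic_on ball \<sigma> (R / 2)"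
      using hol1[OF r] sub ball_subset_cball holomorphic_on_subset by blast
    show "continuous_on (cball \<sigma> (R / 2)) (\<lambda>z. \<kappa> z \<rho>)"
      using hol1[OF r] sub holomorphic_on_imp_continuous_on holomorphic_on_subset by blast
    show "norm (\<kappa> x \<rho>) \<le> c * bump \<alpha> (Re \<rho>)" if "norm (\<sigma> - x) = R / 2" for x
      using sub that r by (intro kernel_bound) (auto simp: subset_iff dist_norm)
  qed (use R in simp)
  then show ?thesis by (simp add: d\<kappa>_def R_def mult_ac)
qed

text \<open>For fixed \<sigma> the integral is an ordinary primitive; the point is the diagonal,
  where \<sigma> is both parameter and end point. Leibniz' rule gives its derivative as \<open>\<Xi>
  \<sigma> \<sigma> + \<kappa> \<sigma> \<sigma> * f \<sigma>\<close>, where \<Xi> integrates the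
  first-variable derivative of the kernel.\<close>

lemma ex_volterra:
  assumes f: "f holomorphic_on strip d" and B: "\<And>z. z \<in> strip d \<Longrightarrow> norm (f z) \<le> B"
  obtains \<Phi> where "\<And>\<sigma>. \<sigma> \<in> strip d \<Longrightarrow> bot_prim d 0 (\<lambda>\<rho>. \<kappa> \<sigma> \<rho> * f \<rho>) (\<Phi> \<sigma>)"
    "(\<lambda>\<sigma>. \<Phi> \<sigma> \<sigma>) holomorphic_on strip d"
proof -
  have B0: "0 \<le> B"
    using order_trans[OF norm_ge_zero B[OF zero_in_strip]] .
  have "\<exists>P. bot_prim d 0 (\<lambda>\<rho>. \<kappa> \<sigma> \<rho> * f \<rho>) P" if s: "\<sigma> \<in> strip d" for \<sigma>
  proof -
    have "norm (\<kappa> \<sigma> \<rho> * f \<rho>) \<le> c * B * bump \<alpha> (Re \<rho>)" if r: "\<rho> \<in> strip d" for \<rho>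
      by (rule kernel_mult_bound[OF s r B[OF r]])
    from ex_bot_prim[OF alpha_pos d_pos holomorphic_on_mult[OF hol2[OF s] f] this]
    show ?thesis by blast
  qed
  then obtain \<Phi> where \<Phi>: "\<And>\<sigma>. \<sigma> \<in> strip d \<Longrightarrow> bot_prim d 0 (\<lambda>\<rho>. \<kappa> \<sigma> \<rho> * f \<rho>) (\<Phi> \<sigma>)"
    by metis
  have "\<exists>P. bot_prim d 0 (\<lambda>\<rho>. d\<kappa> \<sigma> \<rho> * f \<rho>) P" if s: "\<sigma> \<in> strip d" for \<sigma>
  proof -
    have "norm (d\<kappa> \<sigma> \<rho> * f \<rho>) \<le> (2 * c / (d - \<bar>Im \<sigma>\<bar>)) * B * bump \<alpha> (Re \<rho>)" if r: "\<rho> \<in> strip d" for \<rho>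
      using mult_mono[OF d\<kappa>_bound[OF s r] B[OF r]] c_nonneg bump_nonneg radius_pos[OF s]
      by (simp add: norm_mult mult_ac)
    from ex_bot_prim[OF alpha_pos d_pos holomorphic_on_mult[OF d\<kappa>_holomorphic[OF s] f] this]
    show ?thesis by blast
  qed
  then obtain \<Xi> where \<Xi>: "\<And>\<sigma>. \<sigma> \<in> strip d \<Longrightarrow> bot_prim d 0 (\<lambda>\<rho>. d\<kappa> \<sigma> \<rho> * f \<rho>) (\<Xi> \<sigma>)"
    by metis
  have "((\<lambda>\<sigma>. \<Phi> \<sigma> \<sigma>) has_field_derivative (\<Xi> \<sigma> \<sigma> + \<kappa> \<sigma> \<sigma> * f \<sigma>)) (at \<sigma>)" if s: "\<sigma> \<in> strip d" for \<sigma>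
  proof -
    define R where "R = d - \<bar>Im \<sigma>\<bar>"
    have R: "0 < R" using radius_pos[OF s] by (simp add: R_def)
    \<comment> \<open>Taylor remainder in the parameter, taken at the moved end point. For fixed h
      it is the value of a primitive that vanishes at minus infinity, so the kernel remainder, of
      order |h|^2 * bump, integrates to order |h|^2.\<close>
    define E where "E h = \<Phi> (\<sigma> + h) (\<sigma> + h) - \<Phi> \<sigma> (\<sigma> + h) - h * \<Xi> \<sigma> (\<sigma> + h)" for h
    define K where "K = 32 * c * B / R\<^sup>2"
    have sh: "\<sigma> + h \<in> strip d" if "norm h < R" for h
      using ball_subset_strip[of \<sigma> d] that by (auto simp: dist_norm R_def subset_iff)
    have E: "norm (E h) \<le> K * (norm h)\<^sup>2" if h: "norm h < R / 2" for h
    proof -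
      have sh': "\<sigma> + h \<in> strip d" using sh h R by simp
      have "bot_prim d (0 - 0 - h * 0)
        (\<lambda>\<rho>. \<kappa> (\<sigma> + h) \<rho> * f \<rho> - \<kappa> \<sigma> \<rho> * f \<rho> - h * (d\<kappa> \<sigma> \<rho> * f \<rho>))
        (\<lambda>\<rho>. \<Phi> (\<sigma> + h) \<rho> - \<Phi> \<sigma> \<rho> - h * \<Xi> \<sigma> \<rho>)"
        by (intro bot_prim_diff bot_prim_cmult \<Phi> \<Xi> sh' s)
      then have bp: "bot_prim d 0
        (\<lambda>\<rho>. (\<kappa> (\<sigma> + h) \<rho> - \<kappa> \<sigma> \<rho> - h * d\<kappa> \<sigma> \<rho>) * f \<rho>)
        (\<lambda>\<rho>. \<Phi> (\<sigma> + h) \<rho> - \<Phi> \<sigma> \<rho> - h * \<Xi> \<sigma> \<rho>)"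
        by (simp add: algebra_simps)
      have "norm (E h - 0) \<le> K * (norm h)\<^sup>2"
        unfolding E_def
      proof (rule bot_prim_bound_bump[OF bp sh' alpha_pos])
        fix \<rho> assume r: "\<rho> \<in> strip d"
        have "norm ((\<kappa> (\<sigma> + h) \<rho> - \<kappa> \<sigma> \<rho> - h * d\<kappa> \<sigma> \<rho>) * f \<rho>)
          \<le> (32 * (c * bump \<alpha> (Re \<rho>)) / R\<^sup>2 * (norm h)\<^sup>2) * B"
          unfolding norm_mult
          using kernel_increment(2)[OF s r, of h] h B[OF r] c_nonneg bump_nonneg
          by (intro mult_mono) (auto simp: R_def)
        then show "norm ((\<kappa> (\<sigma> + h) \<rho> - \<kappa> \<sigma> \<rho> - h * d\<kappa> \<sigma> \<rho>) * f \<rho>)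
          \<le> K * (norm h)\<^sup>2 * bump \<alpha> (Re \<rho>)"
          by (simp add: K_def mult_ac)
      qed
      then show ?thesis by simp
    qed
    have near: "\<forall>\<^sub>F h in at 0. norm h < R / 2 \<and> h \<noteq> 0" for h :: complex
      unfolding eventually_at using R by (intro exI[of _ "R / 2"]) (auto simp: dist_norm)
    have lim1: "((\<lambda>h. E h / h) \<longlongrightarrow> 0) (at 0)"
    proof (rule Lim_null_comparison)
      show "\<forall>\<^sub>F h in at 0. norm (E h / h) \<le> K * norm h"
        using near
      proof eventually_elim
        case (elim h)
        then have "norm (E h) \<le> K * norm h * norm h" using E[of h] by (simp add: power2_eq_square)
        then show ?case using elim by (simp add: norm_divide field_simps)
      qed
      show "((\<lambda>h. K * norm h) \<longlongrightarrow> 0) (at (0::complex))"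
        by (auto intro!: tendsto_eq_intros)
    qed
    have "isCont (\<Xi> \<sigma>) \<sigma>"
      using \<Xi>[OF s] s DERIV_isCont unfolding bot_prim_def by blast
    then have lim2: "((\<lambda>h. \<Xi> \<sigma> (\<sigma> + h)) \<longlongrightarrow> \<Xi> \<sigma> \<sigma>) (at 0)"
      by (simp add: isCont_iff)
    have "(\<Phi> \<sigma> has_field_derivative \<kappa> \<sigma> \<sigma> * f \<sigma>) (at \<sigma>)"
      using \<Phi>[OF s] s unfolding bot_prim_def by blast
    then have lim3: "((\<lambda>h. (\<Phi> \<sigma> (\<sigma> + h) - \<Phi> \<sigma> \<sigma>) / h) \<longlongrightarrow> \<kappa> \<sigma> \<sigma> * f \<sigma>) (at 0)"
      by (simp add: DERIV_def)
    have "((\<lambda>h. E h / h + \<Xi> \<sigma> (\<sigma> + h) + (\<Phi> \<sigma> (\<sigma> + h) - \<Phi> \<sigma> \<sigma>) / h)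
        \<longlongrightarrow> 0 + \<Xi> \<sigma> \<sigma> + \<kappa> \<sigma> \<sigma> * f \<sigma>) (at 0)"
      by (intro tendsto_add lim1 lim2 lim3)
    then have "((\<lambda>h. (\<Phi> (\<sigma> + h) (\<sigma> + h) - \<Phi> \<sigma> \<sigma>) / h) \<longlongrightarrow> 0 + \<Xi> \<sigma> \<sigma> + \<kappa> \<sigma> \<sigma> * f \<sigma>) (at 0)"
    proof (rule Lim_transform_eventually)
      show "\<forall>\<^sub>F h in at 0. E h / h + \<Xi> \<sigma> (\<sigma> + h) + (\<Phi> \<sigma> (\<sigma> + h) - \<Phi> \<sigma> \<sigma>) / h
          = (\<Phi> (\<sigma> + h) (\<sigma> + h) - \<Phi> \<sigma> \<sigma>) / h"
        using near by eventually_elim (simp add: E_def field_simps)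
    qed
    then show ?thesis by (simp add: DERIV_def)
  qed
  then have "(\<lambda>\<sigma>. \<Phi> \<sigma> \<sigma>) holomorphic_on strip d"
    using open_strip[of d] by (auto simp: holomorphic_on_open)
  with \<Phi> show thesis by (rule that)
qed

end

text \<open>Coefficients of u' = G + m u + p V with limit \<open>ua\<close> at minus infinity, V
  being the integral of \<open>\<kappa> \<sigma> \<rho> * u \<rho>\<close> up to \<sigma>. In the
  application p is the Jacobian of the SE transformation.\<close>

locale volterra_strip = volterra_kernel +
  fixes G m p :: "complex \<Rightarrow> complex" and ua :: complex
  assumes G_hol: "G holomorphic_on strip d" and m_hol: "m holomorphic_on strip d"
    and p_hol: "p holomorphic_on strip d"
    and G_bound: "\<And>z. z \<in> strip d \<Longrightarrow> norm (G z) \<le> c * bump \<alpha> (Re z)"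
    and m_bound: "\<And>z. z \<in> strip d \<Longrightarrow> norm (m z) \<le> c * bump \<alpha> (Re z)"
    and p_bound: "\<And>z. z \<in> strip d \<Longrightarrow> norm (p z) \<le> c * bump \<alpha> (Re z)"
begin

text \<open>Here h is the Picard iterate of f, and \<open>\<Phi> \<sigma>\<close> a primitive for
  the inner integral. It is a relation because primitives come from existence statements; a solution
  is a fixed point \<open>picard U \<Phi> U\<close>.\<close>

definition picard :: "(complex \<Rightarrow> complex) \<Rightarrow> (complex \<Rightarrow> complex \<Rightarrow> complex) \<Rightarrow> (complex \<Rightarrow> complex) \<Rightarrow> bool" where
  "picard f \<Phi> h \<longleftrightarrow> (\<forall>\<sigma>\<in>strip d. bot_prim d 0 (\<lambda>\<rho>. \<kappa> \<sigma> \<rho> * f \<rho>) (\<Phi> \<sigma>)) \<and>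
     (\<lambda>\<sigma>. \<Phi> \<sigma> \<sigma>) holomorphic_on strip d \<and>
     bot_prim d ua (\<lambda>\<sigma>. G \<sigma> + m \<sigma> * f \<sigma> + p \<sigma> * \<Phi> \<sigma> \<sigma>) h"

lemma volterra_bound:
  assumes bp: "\<And>\<sigma>. \<sigma> \<in> strip d \<Longrightarrow> bot_prim d 0 (\<lambda>\<rho>. \<kappa> \<sigma> \<rho> * f \<rho>) (\<Phi> \<sigma>)"
    and B: "\<And>z. z \<in> strip d \<Longrightarrow> norm (f z) \<le> B" and s: "\<sigma> \<in> strip d"
  shows "norm (\<Phi> \<sigma> \<sigma>) \<le> c * B"
proof -
  have "norm (\<Phi> \<sigma> \<sigma> - 0) \<le> c * B"
  proof (rule bot_prim_bound_bump[OF bp[OF s] s alpha_pos])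
    show "norm (\<kappa> \<sigma> z * f z) \<le> c * B * bump \<alpha> (Re z)" if "z \<in> strip d" for z
      by (rule kernel_mult_bound[OF s that B[OF that]])
  qed
  then show ?thesis by simp
qed

lemma rhs_bound:
  assumes s: "\<sigma> \<in> strip d" and x: "norm x \<le> B" and y: "norm y \<le> c * B"
  shows "norm (G \<sigma> + m \<sigma> * x + p \<sigma> * y) \<le> (c + c * B + c * (c * B)) * bump \<alpha> (Re \<sigma>)"
proof -
  have "norm (G \<sigma> + m \<sigma> * x + p \<sigma> * y) \<le> norm (G \<sigma>) + norm (m \<sigma>) * norm x + norm (p \<sigma>) * norm y"
    unfolding norm_mult[symmetric]
    by (rule order_trans[OF norm_triangle_ineq add_right_mono[OF norm_triangle_ineq]])
  also have "\<dots> \<le> c * bump \<alpha> (Re \<sigma>) + c * bump \<alpha> (Re \<sigma>) * B + c * bump \<alpha> (Re \<sigma>) * (c * B)"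
    using c_nonneg bump_nonneg by (intro add_mono mult_mono G_bound m_bound p_bound x y s) auto
  finally show ?thesis by (simp add: algebra_simps)
qed

lemma ex_picard:
  assumes f: "f holomorphic_on strip d" and B: "\<And>z. z \<in> strip d \<Longrightarrow> norm (f z) \<le> B"
  shows "\<exists>\<Phi> h. picard f \<Phi> h"
proof -
  obtain \<Phi> where \<Phi>: "\<And>\<sigma>. \<sigma> \<in> strip d \<Longrightarrow> bot_prim d 0 (\<lambda>\<rho>. \<kappa> \<sigma> \<rho> * f \<rho>) (\<Phi> \<sigma>)"
    "(\<lambda>\<sigma>. \<Phi> \<sigma> \<sigma>) holomorphic_on strip d"
    using ex_volterra[OF f B] by blast
  have "(\<lambda>\<sigma>. G \<sigma> + m \<sigma> * f \<sigma> + p \<sigma> * \<Phi> \<sigma> \<sigma>) holomorphic_on strip d"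
    by (intro holomorphic_intros G_hol m_hol p_hol f \<Phi>(2))
  from ex_bot_prim[OF alpha_pos d_pos this rhs_bound[OF _ B volterra_bound[OF \<Phi>(1) B]]]
  obtain h where "bot_prim d ua (\<lambda>\<sigma>. G \<sigma> + m \<sigma> * f \<sigma> + p \<sigma> * \<Phi> \<sigma> \<sigma>) h" by blast
  with \<Phi> show ?thesis unfolding picard_def by blast
qed

lemma picard_bound:
  assumes "picard f \<Phi> h" and B: "\<And>z. z \<in> strip d \<Longrightarrow> norm (f z) \<le> B" and s: "\<sigma> \<in> strip d"
  shows "norm (h \<sigma>) \<le> norm ua + (c + c * B + c * (c * B))"
proof -
  have "norm (h \<sigma> - ua) \<le> c + c * B + c * (c * B)"
    using assms(1) by (intro bot_prim_bound_bump[OF _ s alpha_pos rhs_bound[OF _ B volterra_bound[where f = f and \<Phi> = \<Phi>, OF _ B]]])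
      (auto simp: picard_def)
  then show ?thesis using norm_triangle_ineq2[of "h \<sigma>" ua] by linarith
qed

text \<open>Rate of the exponential weight for which the Volterra operator halves the weighted norm.\<close>

definition rate :: real where "rate = 2 * (c * (1 + c)) + 1"

lemma rate_ge: "1 \<le> rate" using c_nonneg by (simp add: rate_def)

text \<open>G and \<open>ua\<close> cancel in the difference, and along the horizontal line through
  \<sigma> what remains is the setting of \<open>volterra_line_contraction\<close>.\<close>

lemma picard_contraction:
  assumes p1: "picard f \<Phi> h" and p2: "picard f' \<Phi>' h'"
    and M: "\<And>z. z \<in> strip d \<Longrightarrow> norm (f z - f' z) \<le> M * exp (rate * logistic \<alpha> (Re z))"
    and s: "\<sigma> \<in> strip d"
  shows "norm (h \<sigma> - h' \<sigma>) \<le> M / 2 * exp (rate * logistic \<alpha> (Re \<sigma>))"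
proof -
  let ?z = "\<lambda>x. Complex x (Im \<sigma>)"
  have y: "\<bar>Im \<sigma>\<bar> < d" using s by (simp add: strip_def)
  then have z: "?z x \<in> strip d" for x by (simp add: strip_def)
  have d1: "bot_prim d (0 - 0) (\<lambda>\<rho>. \<kappa> w \<rho> * f \<rho> - \<kappa> w \<rho> * f' \<rho>) (\<lambda>\<rho>. \<Phi> w \<rho> - \<Phi>' w \<rho>)" if "w \<in> strip d" for w
    using p1 p2 that by (intro bot_prim_diff) (auto simp: picard_def)
  have d2: "bot_prim d (ua - ua) (\<lambda>\<sigma>. (G \<sigma> + m \<sigma> * f \<sigma> + p \<sigma> * \<Phi> \<sigma> \<sigma>) - (G \<sigma> + m \<sigma> * f' \<sigma> + p \<sigma> * \<Phi>' \<sigma> \<sigma>)) (\<lambda>\<sigma>. h \<sigma> - h' \<sigma>)"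
    using p1 p2 by (intro bot_prim_diff) (auto simp: picard_def)
  have "norm (h (?z (Re \<sigma>)) - h' (?z (Re \<sigma>))) \<le> M / 2 * exp (rate * logistic \<alpha> (Re \<sigma>))"
  proof (rule volterra_line_contraction[OF alpha_pos c_nonneg rate_def, where
        h = "\<lambda>x. h (?z x) - h' (?z x)" and e = "\<lambda>x. f (?z x) - f' (?z x)" and m = "\<lambda>x. m (?z x)" and p = "\<lambda>x. p (?z x)"
        and K = "\<lambda>x y. \<Phi> (?z x) (?z y) - \<Phi>' (?z x) (?z y)" and kk = "\<lambda>x y. \<kappa> (?z x) (?z y)"])
    show "((\<lambda>x. h (?z x) - h' (?z x)) has_vector_derivative
        m (?z x) * (f (?z x) - f' (?z x)) + p (?z x) * (\<Phi> (?z x) (?z x) - \<Phi>' (?z x) (?z x))) (at x)" for x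
      using has_vector_derivative_horizontal[OF bspec[OF conjunct1[OF d2[unfolded bot_prim_def]] z]]
      by (simp add: algebra_simps)
    show "((\<lambda>t. \<Phi> (?z x) (?z t) - \<Phi>' (?z x) (?z t)) has_vector_derivative \<kappa> (?z x) (?z t) * (f (?z t) - f' (?z t))) (at t)" for x t
      using has_vector_derivative_horizontal[OF bspec[OF conjunct1[OF d1[OF z, unfolded bot_prim_def]] z]]
      by (simp add: algebra_simps)
    show "((\<lambda>x. h (?z x) - h' (?z x)) \<longlongrightarrow> 0) at_bot"
      using d2 y by (simp add: bot_prim_def)
    show "((\<lambda>t. \<Phi> (?z x) (?z t) - \<Phi>' (?z x) (?z t)) \<longlongrightarrow> 0) at_bot" for x
      using d1[OF z] y by (simp add: bot_prim_def)
  qed (use m_bound[OF z] p_bound[OF z] kernel_bound[OF z z] M[OF z] in simp_all)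
  then show ?thesis by simp
qed

lemma picard_cong:
  assumes "picard f \<Phi> h" "\<And>z. z \<in> strip d \<Longrightarrow> f z = f' z"
  shows "picard f' \<Phi> h"
  using assms unfolding picard_def by (auto intro: bot_prim_cong)

theorem ex_solution:
  obtains U \<Phi> B where "picard U \<Phi> U" "\<And>z. z \<in> strip d \<Longrightarrow> norm (U z) \<le> B"
proof -
  define P where "P f \<longleftrightarrow> f holomorphic_on strip d \<and> (\<exists>B. \<forall>z\<in>strip d. norm (f z) \<le> B)" for f :: "complex \<Rightarrow> complex"
  have ex: "\<exists>h \<Phi>. P h \<and> picard f \<Phi> h" if Pf: "P f" for f
  proof -
    obtain B where B: "\<And>z. z \<in> strip d \<Longrightarrow> norm (f z) \<le> B" using Pf unfolding P_def by blast
    obtain \<Phi> h where h: "picard f \<Phi> h" using ex_picard[of f, OF _ B] Pf unfolding P_def by blast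
    then have "P h" using picard_bound[OF h B] bot_prim_holomorphic unfolding P_def picard_def by blast
    with h show ?thesis by blast
  qed
  have "\<exists>f. f 0 = (\<lambda>_. 0) \<and> (\<forall>n. P (f n) \<and> (\<exists>\<Phi>. picard (f n) \<Phi> (f (Suc n))))"
  proof -
    have P0: "P (\<lambda>_. 0)" by (auto simp: P_def)
    \<comment> \<open>Dependent choice leaves the first function open; the clause on n = 0 in the
      invariant pins it to zero.\<close>
    have "\<exists>f. \<forall>n. (P (f n) \<and> (n = 0 \<longrightarrow> f n = (\<lambda>_. 0))) \<and> (\<exists>\<Phi>. picard (f n) \<Phi> (f (Suc n)))"
    proof (rule dependent_nat_choice)
      fix f :: "complex \<Rightarrow> complex" and n :: nat
      assume "P f \<and> (n = 0 \<longrightarrow> f = (\<lambda>_. 0))"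
      with ex[of f] show "\<exists>h. (P h \<and> (Suc n = 0 \<longrightarrow> h = (\<lambda>_. 0))) \<and> (\<exists>\<Phi>. picard f \<Phi> h)" by blast
    qed (use P0 in blast)
    then show ?thesis by blast
  qed
  then obtain f where f0: "f 0 = (\<lambda>_. 0)" and Pf: "\<And>n. P (f n)"
    and st: "\<And>n. \<exists>\<Phi>. picard (f n) \<Phi> (f (Suc n))" by blast
  obtain M where M: "\<And>z. z \<in> strip d \<Longrightarrow> norm (f (Suc 0) z) \<le> M"
    using Pf[of "Suc 0"] by (auto simp: P_def)
  have M0: "0 \<le> M"
    using order_trans[OF norm_ge_zero M[OF zero_in_strip]] .
  let ?e = "\<lambda>z. exp (rate * logistic \<alpha> (Re z))"
  \<comment> \<open>The weight lies between 1 and exp rate, so halving in the weighted norm means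
    geometric convergence uniformly on the strip.\<close>
  have e1: "1 \<le> ?e z" for z using rate_ge logistic_pos[of \<alpha> "Re z"] by simp
  have e2: "?e z \<le> exp rate" for z
    using rate_ge logistic_less_1[of \<alpha> "Re z"] logistic_pos[of \<alpha> "Re z"] by (simp add: mult_left_le)
  have diff: "norm (f (Suc n) z - f n z) \<le> M / 2 ^ n * ?e z" if "z \<in> strip d" for n z
    using that
  proof (induction n arbitrary: z)
    case 0
    have "norm (f (Suc 0) z) \<le> M * 1" using M[OF 0] by simp
    also have "\<dots> \<le> M * ?e z" using M0 e1 by (intro mult_left_mono) auto
    finally show ?case by (simp add: f0)
  next
    case (Suc n)
    obtain \<Phi> \<Phi>' where "picard (f (Suc n)) \<Phi> (f (Suc (Suc n)))" "picard (f n) \<Phi>' (f (Suc n))"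
      using st by blast
    from picard_contraction[OF this Suc.IH Suc.prems] show ?case by (simp add: field_simps)
  qed
  define K where "K = M * exp rate"
  have "norm (f (Suc n) z - f n z) \<le> K / 2 ^ n" if z: "z \<in> strip d" for n z
  proof -
    have "M / 2 ^ n * ?e z \<le> M / 2 ^ n * exp rate" using e2 M0 by (intro mult_left_mono) auto
    with diff[OF z, of n] show ?thesis by (simp add: K_def)
  qed
  then have "\<forall>z\<in>strip d. \<exists>l. \<forall>n. norm (l - f n z) \<le> 2 * K / 2 ^ n"
    using geometric_steps_limit[of "\<lambda>n. f n z" K for z] by blast
  then obtain U where U: "\<And>z n. z \<in> strip d \<Longrightarrow> norm (U z - f n z) \<le> 2 * K / 2 ^ n"
    by metis
  have U_hol: "U holomorphic_on strip d"
  proof (rule holomorphic_on_strip_limit)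
    show "f n holomorphic_on strip d" for n using Pf by (simp add: P_def)
    show "(\<lambda>n. 2 * K / 2 ^ n) \<longlonglongrightarrow> 0" by real_asymp
    show "norm (f n z - U z) \<le> 2 * K / 2 ^ n" if "z \<in> strip d" for n z
      using U[OF that] by (simp add: norm_minus_commute)
  qed
  have U_bd: "norm (U z) \<le> 2 * K" if "z \<in> strip d" for z
    using U[OF that, of 0] by (simp add: f0)
  obtain \<Phi> h where h: "picard U \<Phi> h" using ex_picard[OF U_hol U_bd] by blast
  \<comment> \<open>The limit is a fixed point: h is the iterate of U and \<open>f (Suc n)\<close>
    that of \<open>f n\<close>, so their weighted distance is at most half that of U and
    \<open>f n\<close>, which tends to 0.\<close>
  have "h z = U z" if z: "z \<in> strip d" for z
  proof -
    have "norm (h z - f (Suc n) z) \<le> K / 2 ^ n * exp rate" for n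
    proof -
      obtain \<Phi>' where p: "picard (f n) \<Phi>' (f (Suc n))" using st by blast
      have K0: "0 \<le> K" using M0 by (simp add: K_def)
      have "norm (h z - f (Suc n) z) \<le> (2 * K / 2 ^ n) / 2 * ?e z"
      proof (rule picard_contraction[OF h p _ z])
        fix z assume z: "z \<in> strip d"
        have "2 * K / 2 ^ n * 1 \<le> 2 * K / 2 ^ n * ?e z"
          using K0 by (intro mult_left_mono e1) auto
        with U[OF z, of n] show "norm (U z - f n z) \<le> 2 * K / 2 ^ n * ?e z" by simp
      qed
      also have "\<dots> \<le> K / 2 ^ n * exp rate" using e2 K0 by (intro mult_mono) auto
      finally show ?thesis .
    qed
    note hn = this
    have le: "norm (h z - U z) \<le> K / 2 ^ n * exp rate + 2 * K / 2 ^ Suc n" for n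
    proof -
      have "norm (h z - U z) \<le> norm (h z - f (Suc n) z) + norm (U z - f (Suc n) z)"
        using norm_triangle_ineq4[of "h z - f (Suc n) z" "U z - f (Suc n) z"] by simp
      with U[OF z, of "Suc n"] hn[of n] show ?thesis by linarith
    qed
    have "(\<lambda>n. K / 2 ^ n * exp rate + 2 * K / 2 ^ Suc n) \<longlonglongrightarrow> 0" by real_asymp
    from LIMSEQ_le_const[OF this, of "norm (h z - U z)"] le show ?thesis by simp
  qed
  then have "picard h \<Phi> h" "\<And>z. z \<in> strip d \<Longrightarrow> norm (h z) \<le> 2 * K"
    using picard_cong[OF h] U_bd by auto
  then show thesis by (rule that)
qed

end

section \<open>Sinc indefinite integration\<close>

text \<open>|sin w|^2 is sin^2 (Re w) + sinh^2 (Im w), and the first term is dropped.\<close>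

lemma cmod_sin_ge_sinh: "(exp \<bar>Im w\<bar> - exp (- \<bar>Im w\<bar>)) / 2 \<le> norm (sin w)"
proof (rule power2_le_imp_le)
  let ?v = "\<bar>Im w\<bar>"
  have e: "exp (2 * Im w) + inverse (exp (2 * Im w)) = (exp ?v)\<^sup>2 + (exp (- ?v))\<^sup>2"
    by (cases "0 \<le> Im w") (auto simp: exp_minus[symmetric] exp_double[symmetric])
  have "((exp ?v - exp (- ?v)) / 2)\<^sup>2 = ((exp ?v)\<^sup>2 + (exp (- ?v))\<^sup>2 - 2) / 4"
    by (simp add: power_divide power2_diff exp_minus)
  also have "\<dots> \<le> (norm (sin w))\<^sup>2"
    unfolding norm_sin_squared e using cos_le_one[of "2 * Re w"] by simp
  finally show "((exp ?v - exp (- ?v)) / 2)\<^sup>2 \<le> (norm (sin w))\<^sup>2" .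
qed simp

text \<open>At odd multiples of pi/2 the modulus is cosh (Im w). This is the situation on vertical
  lines halfway between two nodes.\<close>

lemma cmod_sin_ge_1:
  assumes "cos (2 * Re w) = -1" shows "1 \<le> norm (sin w)"
proof (rule power2_le_imp_le)
  have "0 \<le> (exp (Im w) - inverse (exp (Im w)))\<^sup>2" by simp
  also have "\<dots> = exp (2 * Im w) + inverse (exp (2 * Im w)) - 2"
    by (simp add: power2_diff exp_double power_inverse)
  finally show "1\<^sup>2 \<le> (norm (sin w))\<^sup>2"
    unfolding norm_sin_squared assms by simp
qed simp

lemma sin_of_real_over_h_eq_0:
  assumes "0 < h" shows "sin (of_real pi * z / of_real h) = (0::complex) \<longleftrightarrow> (\<exists>j::int. z = of_real (of_int j * h))"
  using assms unfolding sin_eq_0 by (simp add: field_simps)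

lemma sinc_node:
  assumes "0 < h"
  shows "sinc (pi * (of_int i * h / h - of_int j)) = (if i = j then 1 else 0)"
proof -
  have "sin (pi * (of_int i - of_int j)) = 0"
    by (metis mult.commute of_int_diff sin_npi_int)
  then show ?thesis using assms by auto
qed

text \<open>Residue theorem for F(z) / ((z - x) sin (pi z / h)) on a rectangle whose vertical sides
  lie halfway between nodes. The pole at x yields F(x) / sin (pi x / h), the nodes yield the
  cardinal series.\<close>

lemma sinc_interpolation_error:
  fixes F :: "complex \<Rightarrow> complex"
  assumes F: "F holomorphic_on strip d" and d': "0 < d'" "d' < d" and h: "0 < h"
    and R: "R = (real M + 1 / 2) * h" and x: "\<bar>x\<bar> < R"
  shows "F (of_real x) - (\<Sum>j = - int M..int M. F (of_real (of_int j * h)) * of_real (sinc (pi * (x / h - of_int j))))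
    = 1 / (2 * of_real pi * \<i>) * contour_integral (rectpath (Complex (- R) (- d')) (Complex R d'))
        (\<lambda>z. of_real (sin (pi * x / h)) * F z / ((z - of_real x) * sin (of_real pi * z / of_real h)))"
proof (cases "sin (pi * x / h) = 0")
  \<comment> \<open>Here x is itself a node, so the poles would collide. But the factor sin (pi x /
    h) kills the integrand, and the cardinal series reproduces F(x) exactly.\<close>
  case True
  then obtain i :: int where "pi * x / h = of_int i * pi" by (auto simp: sin_zero_iff_int2)
  then have xi: "x = of_int i * h" using h by (simp add: field_simps)
  have "\<bar>of_int i :: real\<bar> * h < (real M + 1 / 2) * h"
    using x h by (simp add: R xi abs_mult)
  then have "\<bar>of_int i :: real\<bar> < real M + 1 / 2" using h by simp
  then have iM: "i \<in> {- int M..int M}" by auto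
  have "(\<Sum>j = - int M..int M. F (of_real (of_int j * h)) * of_real (sinc (pi * (x / h - of_int j))))
     = (\<Sum>j = - int M..int M. if i = j then F (of_real (of_int j * h)) else 0)"
    unfolding xi sinc_node[OF h] by (intro sum.cong) auto
  also have "\<dots> = F (of_real x)" using iM by (simp add: xi)
  finally show ?thesis using True by simp
next
  case False
  define Sx where "Sx = sin (pi * x / h)"
  have Sx: "Sx \<noteq> 0" using False by (simp add: Sx_def)
  let ?s = "\<lambda>z::complex. sin (of_real pi * z / of_real h)"
  let ?n = "\<lambda>j::int. complex_of_real (of_int j * h)"
  define f where "f z = F z / ((z - of_real x) * ?s z)" for z
  \<comment> \<open>An open set around the closed rectangle, too narrow to contain the next zeros of
    the sine at abscissa (M + 1) h and its negative.\<close>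
  define S where "S = {z. \<bar>Re z\<bar> < (real M + 1) * h} \<inter> strip d"
  define nodes where "nodes = ?n ` {- int M..int M}"
  have S_eq: "S = ({z. Re z < (real M + 1) * h} \<inter> {z. Re z > - ((real M + 1) * h)}) \<inter> strip d"
    by (auto simp: S_def)
  have "convex S" unfolding S_eq
    by (intro convex_Int convex_halfspace_Re_lt convex_halfspace_Re_gt convex_strip)
  then have S_conn: "connected S" by (rule convex_connected)
  have S_open: "open S" unfolding S_eq
    by (intro open_Int open_halfspace_Re_lt open_halfspace_Re_gt open_strip)
  have Rlt: "R < (real M + 1) * h" and Rpos: "0 < R" and MR: "real M * h < R"
  proof -
    have eq: "R = real M * h + h / 2" "(real M + 1) * h = real M * h + h"
      by (simp_all add: R distrib_right)
    have "0 \<le> real M * h" using h by simp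
    with h show "R < (real M + 1) * h" "0 < R" "real M * h < R" unfolding eq by linarith+
  qed
  have nodeI: "z \<in> nodes" if s0: "?s z = 0" and Rz: "\<bar>Re z\<bar> < (real M + 1) * h" for z
  proof -
    obtain j :: int where j: "z = ?n j" using sin_of_real_over_h_eq_0[OF h, of z] s0 by blast
    have "\<bar>of_int j :: real\<bar> * h < (real M + 1) * h"
      using Rz h unfolding j Re_complex_of_real abs_mult by simp
    then have "\<bar>of_int j :: real\<bar> < real M + 1" using h by simp
    then have "real_of_int \<bar>j\<bar> < real_of_int (int M + 1)" by simp
    then have "\<bar>j\<bar> < int M + 1" by (simp only: of_int_less_iff)
    then have "j \<in> {- int M..int M}" by auto
    with j show ?thesis by (auto simp: nodes_def)
  qed
  have node0: "?s (?n j) = 0" for j using sin_of_real_over_h_eq_0[OF h, of "?n j"] by blast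
  have x_node: "of_real x \<noteq> ?n j" for j
  proof
    assume "of_real x = ?n j"
    then have "x = of_int j * h" using of_real_eq_iff by blast
    then have "pi * x / h = of_int j * pi" using h by simp
    with False show False using sin_npi_int[of j] by (simp add: mult.commute)
  qed
  have xS: "of_real x \<in> S" using x Rlt d' by (auto simp: S_def strip_def)
  have nS: "?n j \<in> S" if "j \<in> {- int M..int M}" for j
  proof -
    have "\<bar>of_int j :: real\<bar> * h \<le> real M * h" using that h by (intro mult_right_mono) auto
    then show ?thesis using MR Rlt d' h by (auto simp: S_def strip_def abs_mult)
  qed
  have fin: "finite nodes" by (simp add: nodes_def)
  have F_S: "F holomorphic_on T" if "T \<subseteq> S" for T
    using F that by (auto simp: S_def intro: holomorphic_on_subset)
  let ?\<gamma> = "rectpath (Complex (- R) (- d')) (Complex R d')"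
  have in_box: "z \<in> box (Complex (- R) (- d')) (Complex R d')" if "z \<in> insert (of_real x) nodes" for z
  proof -
    have "Im z = 0 \<and> \<bar>Re z\<bar> < R"
      using that
    proof
      assume "z \<in> nodes"
      then obtain j where j: "j \<in> {- int M..int M}" "z = ?n j" by (auto simp: nodes_def)
      have "\<bar>of_int j :: real\<bar> * h \<le> real M * h" using j h by (intro mult_right_mono) auto
      from le_less_trans[OF this MR] j h show ?thesis by (simp add: abs_mult)
    qed (use x in simp)
    then show ?thesis using d' by (auto simp: in_box_complex_iff)
  qed
  have cbox_S: "cbox (Complex (- R) (- d')) (Complex R d') \<subseteq> S"
    using Rlt d' by (auto simp: in_cbox_complex_iff S_def strip_def)
  have "contour_integral ?\<gamma> f = 2 * pi * \<i> *
      (\<Sum>p\<in>insert (of_real x) nodes. winding_number ?\<gamma> p * residue f p)"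
  proof (rule Residue_theorem[OF S_open S_conn])
    show "finite (insert (of_real x) nodes)" using fin by simp
    show "f holomorphic_on S - insert (of_real x) nodes"
      unfolding f_def using h nodeI by (auto intro!: holomorphic_intros F_S simp: S_def)
    show "path_image ?\<gamma> \<subseteq> S - insert (of_real x) nodes"
      using path_image_rectpath_subset_cbox[of "Complex (- R) (- d')" "Complex R d'"] cbox_S
        path_image_rectpath_inter_box[of "Complex (- R) (- d')" "Complex R d'"] in_box Rpos d'
      by auto
    show "\<forall>z. z \<notin> S \<longrightarrow> winding_number ?\<gamma> z = 0"
      using cbox_S Rpos d' by (auto intro!: winding_number_rectpath_outside)
  qed auto
  also have "(\<Sum>p\<in>insert (of_real x) nodes. winding_number ?\<gamma> p * residue f p)
      = (\<Sum>p\<in>insert (of_real x) nodes. residue f p)"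
    by (intro sum.cong) (use in_box in \<open>auto simp: winding_number_rectpath\<close>)
  also have "\<dots> = residue f (of_real x) + (\<Sum>p\<in>nodes. residue f p)"
    using fin x_node by (subst sum.insert) (auto simp: nodes_def)
  also have "residue f (of_real x) = F (of_real x) / of_real Sx"
  proof -
    have o: "open (S - nodes)" using S_open fin by (simp add: finite_imp_closed open_Diff)
    have hol: "(\<lambda>z. F z / ?s z) holomorphic_on S - nodes"
      using h nodeI by (auto intro!: holomorphic_intros F_S simp: S_def)
    have "f = (\<lambda>z. (F z / ?s z) / (z - of_real x))" by (simp add: f_def fun_eq_iff field_simps)
    moreover have "?s (of_real x) = of_real Sx"
      by (simp add: Sx_def flip: sin_of_real)
    ultimately show ?thesis
      using residue_simple[OF o _ hol, of "of_real x"] xS x_node by (auto simp: nodes_def)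
  qed
  also have "(\<Sum>p\<in>nodes. residue f p) = (\<Sum>j = - int M..int M. residue f (?n j))"
    unfolding nodes_def using h by (subst sum.reindex) (auto simp: inj_on_def)
  also have "\<dots> = (\<Sum>j = - int M..int M. - F (?n j) * of_real (sinc (pi * (x / h - of_int j))) / of_real Sx)"
  proof (rule sum.cong)
    fix j assume j: "j \<in> {- int M..int M}"
    \<comment> \<open>This is 1 or -1, hence its own inverse: the derivative of the sine at the node
      puts it in the denominator, the shift by pi j in sinc puts it in the numerator.\<close>
    define cj where "cj = cos (pi * of_int j)"
    have cj: "cj * cj = 1" 
      using sin_cos_squared_add[of "pi * of_int j"] by (simp add: cj_def power2_eq_square)
    then have cj0: "cj \<noteq> 0" by auto
    have cos_n: "cos (of_real pi * ?n j / of_real h) = of_real cj"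
    proof -
      have "of_real pi * ?n j / of_real h = complex_of_real (pi * of_int j)" using h by simp
      then show ?thesis by (simp only: cj_def cos_of_real)
    qed
    have o: "open (S - insert (of_real x) (nodes - {?n j}))"
      using S_open fin by (simp add: finite_imp_closed open_Diff)
    define c where "c = F (?n j) / ((?n j - of_real x) * (of_real (pi / h * cj)))"
    have "residue f (?n j) = c"
    proof (rule residue_simple'[OF o])
      show "?n j \<in> S - insert (of_real x) (nodes - {?n j})"
        using nS[OF j] x_node[of j] by auto
      show "f holomorphic_on S - insert (of_real x) (nodes - {?n j}) - {?n j}"
        unfolding f_def using h nodeI by (auto intro!: holomorphic_intros F_S simp: S_def)
      have "(?s has_field_derivative of_real (pi / h * cj)) (at (?n j))"
        by (rule derivative_eq_intros refl | use h cos_n in simp)+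
      then have "((\<lambda>z. (?s z - ?s (?n j)) / (z - ?n j)) \<longlongrightarrow> of_real (pi / h * cj)) (at (?n j))"
        by (simp only: has_field_derivative_iff)
      then have l1: "((\<lambda>z. ?s z / (z - ?n j)) \<longlongrightarrow> of_real (pi / h * cj)) (at (?n j))"
        by (simp only: node0 diff_zero)
      have "isCont F (?n j)"
        using holomorphic_on_imp_continuous_on[OF F] nS[OF j] continuous_on_eq_continuous_at[OF open_strip]
        by (auto simp: S_def)
      then have l2: "(F \<longlongrightarrow> F (?n j)) (at (?n j))" by (simp add: isCont_def)
      have "((\<lambda>z. F z / ((z - of_real x) * (?s z / (z - ?n j)))) \<longlongrightarrow> c) (at (?n j))"
        unfolding c_def using h cj0 x_node[of j]
        by (intro tendsto_divide l2 tendsto_mult l1 tendsto_diff tendsto_ident_at tendsto_const) auto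
      then show "((\<lambda>w. f w * (w - ?n j)) \<longlongrightarrow> c) (at (?n j))"
        by (rule Lim_transform_eventually) (auto simp: eventually_at_filter f_def)
    qed
    also have "c = - F (?n j) * of_real (sinc (pi * (x / h - of_int j))) / of_real Sx"
    proof -
      have xj: "x - of_int j * h \<noteq> 0" using x_node[of j] by (metis eq_iff_diff_eq_0)
      have ne: "pi * (x / h - of_int j) \<noteq> 0" using xj h by (auto simp: field_simps)
      have "sin (pi * (x / h - of_int j)) = Sx * cj"
        using sin_npi_int[of j] by (simp add: Sx_def cj_def right_diff_distrib sin_diff)
      then have "sinc (pi * (x / h - of_int j)) = Sx * cj / (pi * (x / h - of_int j))" using ne by simp
      also have "\<dots> = Sx * cj * h / (pi * (x - of_int j * h))" using h by (simp add: field_simps)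
      finally have sc: "sinc (pi * (x / h - of_int j)) = Sx * cj * h / (pi * (x - of_int j * h))" .
      have r: "1 / ((of_int j * h - x) * (pi / h * cj)) = - (sinc (pi * (x / h - of_int j)) / Sx)"
        unfolding sc using xj h cj0 Sx cj by (simp add: field_simps) (simp add: mult.assoc[symmetric] cj)
      have "c = F (?n j) * of_real (1 / ((of_int j * h - x) * (pi / h * cj)))"
        unfolding c_def by simp
      then show ?thesis unfolding r by simp
    qed
    finally show "residue f (?n j) = - F (?n j) * of_real (sinc (pi * (x / h - of_int j))) / of_real Sx" .
  qed simp
  finally have *: "contour_integral ?\<gamma> f = 2 * pi * \<i> * (F (of_real x) / of_real Sx +
      (\<Sum>j = - int M..int M. - F (?n j) * of_real (sinc (pi * (x / h - of_int j))) / of_real Sx))" .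
  have fint: "(\<lambda>z. of_real Sx * F z / ((z - of_real x) * ?s z)) = (\<lambda>z. of_real Sx * f z)"
    by (simp add: f_def fun_eq_iff)
  \<comment> \<open>Without integrability both sides are 0 by convention, because Sx is
    nonzero.\<close>
  have "contour_integral ?\<gamma> (\<lambda>z. of_real Sx * f z) = of_real Sx * contour_integral ?\<gamma> f"
    using Sx by (cases "f contour_integrable_on ?\<gamma>")
      (auto simp: contour_integral_lmul not_integrable_contour_integral contour_integrable_lmul_iff)
  also have "\<dots> = 2 * pi * \<i> * (F (of_real x) -
      (\<Sum>j = - int M..int M. F (?n j) * of_real (sinc (pi * (x / h - of_int j)))))"
  proof -
    have "(\<Sum>j = - int M..int M. - F (?n j) * of_real (sinc (pi * (x / h - of_int j))) / of_real Sx)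
      = - (\<Sum>j = - int M..int M. F (?n j) * of_real (sinc (pi * (x / h - of_int j)))) / of_real Sx"
      unfolding sum_divide_distrib sum_negf[symmetric] by (intro sum.cong) simp_all
    moreover have "s * (k * (A / s + - B / s)) = k * (A - B)" if "s \<noteq> 0" for s k A B :: complex
      using that by (simp add: field_simps)
    ultimately show ?thesis unfolding * using Sx by (simp only: of_real_eq_0_iff not_False_eq_True)
  qed
  finally show ?thesis unfolding Sx_def[symmetric] fint by simp
qed

text \<open>Integration by parts with the primitive - (h / pi) cos (pi x / h) gains the factor h.
  The new integrand is at most (h / pi) / |z - x|^2, whose integral over the whole line is at most h
  / |Im z|, so the bound does not depend on the length of the interval.\<close>

lemma oscillatory_integral_bound:
  assumes z: "Im z \<noteq> 0" and h: "0 < h" and X: "X < \<xi>"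
  shows "norm (contour_integral (linepath (of_real X) (of_real \<xi>))
      (\<lambda>x. sin (of_real pi * x / of_real h) / (z - x))) \<le> 2 * h / \<bar>Im z\<bar>"
proof -
  define \<delta> where "\<delta> = \<bar>Im z\<bar>"
  have \<delta>: "0 < \<delta>" using z by (simp add: \<delta>_def)
  have nz: "z - of_real x \<noteq> 0" for x using z by (metis Im_complex_of_real eq_iff_diff_eq_0)
  define q where "q x = of_real (sin (pi * x / h)) / (z - of_real x)" for x :: real
  define T where "T x = of_real (h / pi * cos (pi * x / h)) / (z - of_real x)" for x :: real
  have nle: "\<delta> \<le> norm (z - of_real x)" for x
    using abs_Im_le_cmod[of "z - of_real x"] by (simp add: \<delta>_def)
  have q_cont: "continuous_on A q" for A
    unfolding q_def using nz h by (intro continuous_intros) auto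
  have T_der: "(T has_vector_derivative (- q x + of_real (h / pi * cos (pi * x / h)) / (z - of_real x)\<^sup>2)) (at x)" for x
  proof -
    have 1: "((\<lambda>x. complex_of_real (h / pi * cos (pi * x / h))) has_vector_derivative of_real (- sin (pi * x / h))) (at x)"
      using h by (intro has_vector_derivative_of_real) (auto intro!: derivative_eq_intros)
    have "((\<lambda>x. z - of_real x) has_vector_derivative - 1) (at x)"
      by (auto intro!: derivative_eq_intros)
    moreover have "(inverse has_field_derivative - (inverse (z - of_real x) * inverse (z - of_real x))) (at (z - of_real x))"
      using DERIV_inverse'[OF DERIV_ident nz[of x]] by simp
    ultimately have 2: "((\<lambda>x. inverse (z - of_real x)) has_vector_derivative
        (- 1) * (- (inverse (z - of_real x) * inverse (z - of_real x)))) (at x)"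
      by (rule field_vector_diff_chain_at[unfolded o_def])
    show ?thesis
      using has_vector_derivative_mult[OF 1 2]
      by (simp add: T_def[abs_def] q_def divide_inverse power2_eq_square mult_ac add.commute)
  qed
  \<comment> \<open>Adding the boundary term T leaves a derivative with (z - x)^2 in the
    denominator, which is dominated by the derivative of the arctangent \<phi>.\<close>
  define f where "f x = integral {X..x} q + T x" for x
  define \<phi> where "\<phi> x = h / pi / \<delta> * arctan ((x - Re z) / \<delta>)" for x
  have "norm (f \<xi> - f X) \<le> \<phi> \<xi> - \<phi> X"
  proof (rule differentiable_bound_general[OF X])
    show "continuous_on {X..\<xi>} f" unfolding f_def
      using T_der by (intro continuous_on_add indefinite_integral_continuous_1 integrable_continuous_real q_cont
        continuous_at_imp_continuous_on ballI has_vector_derivative_continuous)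
    show "continuous_on {X..\<xi>} \<phi>" unfolding \<phi>_def using \<delta> by (intro continuous_intros) auto
    fix x assume x: "X < x" "x < \<xi>"
    have "((\<lambda>x. integral {X..x} q) has_vector_derivative q x) (at x within {X..\<xi>})"
      using x by (intro integral_has_vector_derivative q_cont) auto
    moreover have "at x within {X..\<xi>} = at x" using x by (intro at_within_interior) auto
    ultimately have "((\<lambda>x. integral {X..x} q) has_vector_derivative q x) (at x)" by simp
    from has_vector_derivative_add[OF this T_der]
    show "(f has_vector_derivative (of_real (h / pi * cos (pi * x / h)) / (z - of_real x)\<^sup>2)) (at x)"
      by (simp add: f_def[abs_def])
    have "(\<phi> has_real_derivative h / pi / \<delta> * (inverse (1 + ((x - Re z) / \<delta>)\<^sup>2) * (1 / \<delta>))) (at x)"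
    proof -
      have "((\<lambda>x. (x - Re z) / \<delta>) has_real_derivative 1 / \<delta>) (at x)"
        by (intro DERIV_cdivide) (auto intro!: derivative_eq_intros)
      from DERIV_cmult[OF DERIV_chain2[OF DERIV_arctan this]] show ?thesis
        by (simp only: \<phi>_def[abs_def])
    qed
    also have "h / pi / \<delta> * (inverse (1 + ((x - Re z) / \<delta>)\<^sup>2) * (1 / \<delta>)) = h / pi / (\<delta>\<^sup>2 + (x - Re z)\<^sup>2)"
    proof -
      have "h / pi / \<delta> * (inverse (1 + q) * (1 / \<delta>)) = h / pi / (\<delta>\<^sup>2 * (1 + q))" for q
        by (simp add: divide_inverse power2_eq_square mult_ac)
      moreover have "\<delta>\<^sup>2 * (1 + ((x - Re z) / \<delta>)\<^sup>2) = \<delta>\<^sup>2 + (x - Re z)\<^sup>2"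
        using \<delta> by (simp add: distrib_left power_divide)
      ultimately show ?thesis by (simp only:)
    qed
    finally show "(\<phi> has_vector_derivative h / pi / (\<delta>\<^sup>2 + (x - Re z)\<^sup>2)) (at x)"
      by (simp add: has_real_derivative_iff_has_vector_derivative)
    have "(norm (z - of_real x))\<^sup>2 = \<delta>\<^sup>2 + (x - Re z)\<^sup>2"
      by (simp add: cmod_power2 \<delta>_def power2_commute)
    then have "norm (of_real (h / pi * cos (pi * x / h)) / (z - of_real x)\<^sup>2)
        = h / pi * \<bar>cos (pi * x / h)\<bar> / (\<delta>\<^sup>2 + (x - Re z)\<^sup>2)"
      using h by (simp add: norm_divide norm_power abs_mult del: of_real_mult of_real_divide)
    also have "\<dots> \<le> h / pi * 1 / (\<delta>\<^sup>2 + (x - Re z)\<^sup>2)"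
      using h by (intro divide_right_mono mult_left_mono) auto
    finally show "norm (of_real (h / pi * cos (pi * x / h)) / (z - of_real x)\<^sup>2) \<le> h / pi / (\<delta>\<^sup>2 + (x - Re z)\<^sup>2)"
      by simp
  qed
  also have "\<phi> \<xi> - \<phi> X \<le> h / pi / \<delta> * pi"
  proof -
    have "arctan ((\<xi> - Re z) / \<delta>) - arctan ((X - Re z) / \<delta>) \<le> pi"
      using arctan_bounded[of "(\<xi> - Re z) / \<delta>"] arctan_bounded[of "(X - Re z) / \<delta>"] by linarith
    then have "h / pi / \<delta> * (arctan ((\<xi> - Re z) / \<delta>) - arctan ((X - Re z) / \<delta>)) \<le> h / pi / \<delta> * pi"
      using h \<delta> by (intro mult_left_mono) auto
    then show ?thesis by (simp add: \<phi>_def right_diff_distrib)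
  qed
  finally have b1: "norm (f \<xi> - f X) \<le> h / \<delta>" by simp
  have Tb: "norm (T x) \<le> h / pi / \<delta>" for x
  proof -
    have "norm (T x) = h / pi * \<bar>cos (pi * x / h)\<bar> / norm (z - of_real x)"
      using h by (simp add: T_def norm_divide abs_mult del: of_real_mult of_real_divide)
    also have "\<dots> \<le> h / pi * 1 / \<delta>"
      using h \<delta> nle[of x] by (intro frac_le mult_left_mono) auto
    finally show ?thesis by simp
  qed
  have "contour_integral (linepath (of_real X) (of_real \<xi>)) (\<lambda>x. sin (of_real pi * x / of_real h) / (z - x))
      = integral {X..\<xi>} q"
  proof -
    have "sin (of_real pi * of_real x / of_real h) = complex_of_real (sin (pi * x / h))" for x
      by (simp flip: sin_of_real)
    then show ?thesis
      using contour_integral_linepath_Reals_eq[of "of_real X" "of_real \<xi>" "\<lambda>x. sin (of_real pi * x / of_real h) / (z - x)"] X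
      by (simp add: q_def[abs_def])
  qed
  also have "integral {X..\<xi>} q = (f \<xi> - f X) - T \<xi> + T X" by (simp add: f_def)
  also have "norm \<dots> \<le> h / \<delta> + h / pi / \<delta> + h / pi / \<delta>"
    using norm_triangle_ineq[of "(f \<xi> - f X) - T \<xi>" "T X"] norm_triangle_ineq4[of "f \<xi> - f X" "T \<xi>"]
      b1 Tb[of \<xi>] Tb[of X] by linarith
  also have "\<dots> \<le> 2 * h / \<delta>"
  proof -
    have "h / pi / \<delta> \<le> h / 2 / \<delta>"
      using h \<delta> pi_ge_two by (intro divide_right_mono divide_left_mono) auto
    moreover have "2 * h / \<delta> = h / \<delta> + h / 2 / \<delta> + h / 2 / \<delta>" by simp
    ultimately show ?thesis by linarith
  qed
  finally show ?thesis by (simp add: \<delta>_def)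
qed

lemma contour_integral_horizontal_bound:
  assumes "a \<le> b" "0 \<le> C" and le: "\<And>t. a \<le> t \<Longrightarrow> t \<le> b \<Longrightarrow> norm (g (Complex t y)) \<le> C * bump \<alpha> t"
  shows "norm (contour_integral (linepath (Complex a y) (Complex b y)) g) \<le> C * (logistic \<alpha> b - logistic \<alpha> a)"
proof -
  let ?\<gamma> = "linepath (Complex a y) (Complex b y)"
  define L where "L t = C * logistic \<alpha> (a + t * (b - a))" for t
  have int: "((\<lambda>t. C * bump \<alpha> (a + t * (b - a)) * (b - a)) has_integral L 1 - L 0) {0..1}"
  proof (rule fundamental_theorem_of_calculus)
    fix t :: real
    have "((\<lambda>t. logistic \<alpha> (a + t * (b - a))) has_real_derivative bump \<alpha> (a + t * (b - a)) * (b - a)) (at t)"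
      by (rule DERIV_chain2[OF DERIV_logistic]) (auto intro!: derivative_eq_intros)
    from DERIV_cmult[OF this, of C]
    show "(L has_vector_derivative C * bump \<alpha> (a + t * (b - a)) * (b - a)) (at t within {0..1})"
      unfolding L_def has_real_derivative_iff_has_vector_derivative[symmetric]
      by (simp add: has_field_derivative_at_within mult.assoc)
  qed simp
  have pt: "?\<gamma> t = Complex (a + t * (b - a)) y" for t
    by (simp add: linepath_def complex_eq_iff algebra_simps)
  have dg: "Complex b y - Complex a y = of_real (b - a)" by (simp add: complex_eq_iff)
  have le': "norm (g (?\<gamma> t) * (Complex b y - Complex a y)) \<le> C * bump \<alpha> (a + t * (b - a)) * (b - a)"
    if "t \<in> {0..1}" for t
  proof -
    have "a + t * (b - a) \<le> b" using that assms(1) mult_right_mono[of t 1 "b - a"] by auto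
    with le[of "a + t * (b - a)"] that assms(1) show ?thesis
      unfolding pt dg norm_mult norm_of_real
      by (intro mult_mono) (auto intro: order_trans[OF norm_ge_zero])
  qed
  have "norm (contour_integral ?\<gamma> g) \<le> L 1 - L 0"
  proof (cases "(\<lambda>t. g (?\<gamma> t) * (Complex b y - Complex a y)) integrable_on {0..1}")
    case True
    have "norm (contour_integral ?\<gamma> g)
      \<le> integral {0..1} (\<lambda>t. C * bump \<alpha> (a + t * (b - a)) * (b - a))"
      unfolding contour_integral_integral vector_derivative_linepath_at
      by (rule Henstock_Kurzweil_Integration.integral_norm_bound_integral[OF True has_integral_integrable[OF int] le'])
    then show ?thesis unfolding integral_unique[OF int] .
  next
    \<comment> \<open>A non-integrable integrand has integral 0 by convention, so only nonnegativity
      of the bound is left. This spares an integrability proof for the integrand that arises from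
      exchanging the integrals.\<close>
    case False
    have "0 \<le> L 1 - L 0"
      using order_trans[OF norm_ge_zero le'] by (intro has_integral_nonneg[OF int]) auto
    then show ?thesis
      unfolding contour_integral_integral vector_derivative_linepath_at not_integrable_integral[OF False]
      by simp
  qed
  then show ?thesis by (simp add: L_def right_diff_distrib)
qed

section \<open>Integrated sinc functions and Riemann sums of the weight\<close>

lemma DERIV_J_SE:
  assumes "0 < h" shows "(J_SE j h has_real_derivative sinc (pi * (x / h - of_int j))) (at x)"
proof -
  have "((\<lambda>x. pi * (x / h - of_int j)) has_real_derivative pi / h) (at x)"
    using assms by (auto intro!: derivative_eq_intros)
  from DERIV_chain2[OF DERIV_Si this]
  have "((\<lambda>x. Si (pi * (x / h - of_int j))) has_real_derivative sinc (pi * (x / h - of_int j)) * (pi / h)) (at x)" .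
  from DERIV_cmult[OF DERIV_add[OF DERIV_const[of "1 / 2"] DERIV_cmult[OF this, of "1 / pi"]], of h]
  have "(J_SE j h has_real_derivative h * (0 + 1 / pi * (sinc (pi * (x / h - of_int j)) * (pi / h)))) (at x)"
    by (simp only: J_SE_def[abs_def])
  moreover have "h * (0 + 1 / pi * (s * (pi / h))) = s" for s using assms by simp
  ultimately show ?thesis by (simp only:)
qed

lemma tendsto_J_SE_at_bot:
  assumes "0 < h" shows "(J_SE j h \<longlongrightarrow> 0) at_bot"
proof -
  have neg: "Si (- t) = - Si t" for t
    using Si_neg[of t] Si_neg[of "- t"] by (cases "0 \<le> t") auto
  have "filterlim (\<lambda>x. - (pi * (x / h - of_int j))) at_top at_bot"
    using assms by real_asymp
  from filterlim_compose[OF Si_at_top this]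
  have "((\<lambda>x. - Si (pi * (x / h - of_int j))) \<longlongrightarrow> pi / 2) at_bot"
    by (simp only: neg)
  from tendsto_minus[OF this]
  have "((\<lambda>x. Si (pi * (x / h - of_int j))) \<longlongrightarrow> - (pi / 2)) at_bot"
    by simp
  then have "((\<lambda>x. h * (1 / 2 + 1 / pi * Si (pi * (x / h - of_int j)))) \<longlongrightarrow> h * (1 / 2 + 1 / pi * (- (pi / 2)))) at_bot"
    by (intro tendsto_intros)
  then show ?thesis by (simp add: J_SE_def[abs_def])
qed

text \<open>A bound for the normalised sine integral on the whole real line. Its value is
  immaterial, hence the choice operator.\<close>

definition step_const :: real where
  "step_const = (SOME B. 0 \<le> B \<and> (\<forall>T. \<bar>1 / 2 + 1 / pi * Si T\<bar> \<le> B))"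

lemma step_const: "0 \<le> step_const" "\<bar>1 / 2 + 1 / pi * Si T\<bar> \<le> step_const"
proof -
  obtain B where B: "\<And>T. \<bar>Si T\<bar> \<le> B" using bounded_Si by blast
  have "\<bar>1 / 2 + 1 / pi * Si T\<bar> \<le> 1 / 2 + 1 / pi * B" for T
  proof -
    have "\<bar>1 / 2 + 1 / pi * Si T\<bar> \<le> 1 / 2 + \<bar>1 / pi * Si T\<bar>"
      by (rule order_trans[OF abs_triangle_ineq]) simp
    also have "\<dots> \<le> 1 / 2 + 1 / pi * B" unfolding abs_mult using B[of T]
      by (intro add_left_mono mult_mono) auto
    finally show ?thesis .
  qed
  then have "\<exists>B. 0 \<le> B \<and> (\<forall>T. \<bar>1 / 2 + 1 / pi * Si T\<bar> \<le> B)"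
    by (meson abs_ge_zero order_trans)
  from someI_ex[OF this] show "0 \<le> step_const" "\<bar>1 / 2 + 1 / pi * Si T\<bar> \<le> step_const"
    unfolding step_const_def[symmetric] by auto
qed

lemma J_SE_bound: "0 \<le> h \<Longrightarrow> \<bar>J_SE j h x\<bar> \<le> h * step_const"
  using step_const(2) by (simp add: J_SE_def abs_mult mult_left_mono)

lemma sum_symmetric_int:
  fixes f :: "int \<Rightarrow> 'a::comm_monoid_add"
  shows "(\<Sum>j = - int M..int M. f j) = f 0 + (\<Sum>i<M. f (int (Suc i)) + f (- int (Suc i)))"
proof (induction M)
  case (Suc M)
  have "{- int (Suc M)..int (Suc M)} = insert (int (Suc M)) (insert (- int (Suc M)) {- int M..int M})"
    by auto
  then have "(\<Sum>j = - int (Suc M)..int (Suc M). f j) = f (int (Suc M)) + (f (- int (Suc M)) + (\<Sum>j = - int M..int M. f j))"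
    by (simp only:) (subst sum.insert; simp)+
  with Suc show ?case by (simp add: ac_simps)
qed simp

text \<open>By 1 + q \<le> exp q each term times q is at most a difference of consecutive
  exponentials, and these telescope. Keeping the factor q on the left avoids a bound with 1/q, which
  would blow up for small mesh size.\<close>

lemma geometric_tail:
  fixes q :: real assumes "0 < q"
  shows "q * (\<Sum>i = N..<M. exp (- (q * real (Suc i)))) \<le> exp (- (q * real N))"
proof (cases "N \<le> M")
  case True
  have e: "q * exp (- (q * real (Suc i))) \<le> exp (- (q * real i)) - exp (- (q * real (Suc i)))" for i
  proof -
    have "1 + q \<le> exp q" by (rule exp_ge_add_one_self)
    then have "(1 + q) * exp (- (q * real (Suc i))) \<le> exp q * exp (- (q * real (Suc i)))"
      by (rule mult_right_mono) simp
    also have "\<dots> = exp (- (q * real i))" by (simp add: exp_add[symmetric] algebra_simps)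
    finally show ?thesis by (simp add: algebra_simps)
  qed
  have "q * (\<Sum>i = N..<M. exp (- (q * real (Suc i)))) \<le> (\<Sum>i = N..<M. exp (- (q * real i)) - exp (- (q * real (Suc i))))"
    unfolding sum_distrib_left by (intro sum_mono e)
  also have "\<dots> = exp (- (q * real N)) - exp (- (q * real M))"
    using sum_Suc_diff'[OF True, of "\<lambda>i. - exp (- (q * real i))"] by (simp add: sum_negf[symmetric])
  also have "\<dots> \<le> exp (- (q * real N))" by simp
  finally show ?thesis .
qed simp

lemma bump_node_le:
  assumes "0 < \<alpha>" "0 < h" shows "bump \<alpha> (of_int j * h) \<le> \<alpha> * exp (- (\<alpha> * h * real_of_int \<bar>j\<bar>))"
  using bump_le[OF assms(1), of "of_int j * h"] assms by (simp add: abs_mult mult_ac)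

text \<open>Both tails are bounded by right-end Riemann sums of the decreasing function \<alpha> exp
  (- \<alpha> x) beyond N h, so neither M nor a power of 1/h appears.\<close>

lemma sum_bump_tail_le:
  assumes "0 < \<alpha>" "0 < h" "N \<le> M"
  shows "(\<Sum>j \<in> {- int M..int M} - {- int N..int N}. h * bump \<alpha> (of_int j * h)) \<le> 2 * exp (- (\<alpha> * h * real N))"
proof -
  let ?b = "\<lambda>j::int. h * bump \<alpha> (of_int j * h)"
  let ?e = "\<lambda>i. \<alpha> * h * exp (- (\<alpha> * h * real (Suc i)))"
  have b: "?b j \<le> \<alpha> * h * exp (- (\<alpha> * h * real_of_int \<bar>j\<bar>))" for j
    using mult_left_mono[OF bump_node_le[OF assms(1,2), of j], of h] assms by (simp add: mult_ac)
  have "(\<Sum>j \<in> {- int M..int M} - {- int N..int N}. ?b j) = (\<Sum>j = - int M..int M. ?b j) - (\<Sum>j = - int N..int N. ?b j)"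
    using assms by (intro sum_diff) auto
  also have "\<dots> = (\<Sum>i<M. ?b (int (Suc i)) + ?b (- int (Suc i))) - (\<Sum>i<N. ?b (int (Suc i)) + ?b (- int (Suc i)))"
    unfolding sum_symmetric_int by simp
  also have "\<dots> = (\<Sum>i\<in>{..<M} - {..<N}. ?b (int (Suc i)) + ?b (- int (Suc i)))"
    using assms by (intro sum_diff[symmetric]) auto
  also have "{..<M} - {..<N} = {N..<M}" by auto
  also have "(\<Sum>i = N..<M. ?b (int (Suc i)) + ?b (- int (Suc i))) \<le> (\<Sum>i = N..<M. ?e i + ?e i)"
    using b[of "int (Suc i)" for i] b[of "- int (Suc i)" for i]
    by (intro add_mono sum_mono) (simp_all only: abs_of_nat abs_minus of_int_of_nat_eq)
  also have "\<dots> = 2 * (\<alpha> * h * (\<Sum>i = N..<M. exp (- (\<alpha> * h * real (Suc i)))))"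
    by (simp add: sum.distrib sum_distrib_left mult.assoc)
  also have "\<dots> \<le> 2 * exp (- (\<alpha> * h * real N))"
    using geometric_tail[of "\<alpha> * h" N M] assms by (intro mult_left_mono) simp_all
  finally show ?thesis .
qed

text \<open>The node 0 contributes at most \<alpha>, the two tails beyond it at most 2.\<close>

lemma sum_bump_le:
  assumes "0 < \<alpha>" "0 < h" "h \<le> 1"
  shows "(\<Sum>j = - int N..int N. h * bump \<alpha> (of_int j * h)) \<le> \<alpha> + 2"
proof -
  let ?b = "\<lambda>j::int. h * bump \<alpha> (of_int j * h)"
  have "?b 0 \<le> 1 * (\<alpha> * 1)"
    using bump_le[OF assms(1), of 0] bump_pos[OF assms(1), of 0] assms by (intro mult_mono) auto
  moreover have "(\<Sum>j = - int N..int N. ?b j) = ?b 0 + (\<Sum>j \<in> {- int N..int N} - {- int 0..int 0}. ?b j)"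
    by (subst sum.remove[of _ 0]) auto
  ultimately show ?thesis using sum_bump_tail_le[OF assms(1,2), of 0 N] by simp
qed

lemma contour_integral_linepath_bound:
  assumes "0 \<le> B" "\<And>z. z \<in> closed_segment a b \<Longrightarrow> norm (f z) \<le> B"
  shows "norm (contour_integral (linepath a b) f) \<le> B * norm (b - a)"
proof (cases "f contour_integrable_on linepath a b")
  case True then show ?thesis using assms by (rule contour_integral_bound_linepath)
next
  case False then show ?thesis using assms by (simp add: not_integrable_contour_integral)
qed

text \<open>Exchanging the integral over \<open>{X..\<xi>}\<close> with the contour integral turns the interpolation kernel
  into the bounded one of \<open>oscillatory_integral_bound\<close>; the pointwise interpolation error only decays
  like \<open>1 / \<bar>x\<bar>\<close> and cannot be integrated directly.\<close>

lemma sinc_indefinite_rectangle: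
  fixes F :: "complex \<Rightarrow> complex"
  assumes F: "F holomorphic_on strip d" and al: "0 < \<alpha>"
    and le: "\<And>z. z \<in> strip d \<Longrightarrow> norm (F z) \<le> c * bump \<alpha> (Re z)"
    and \<Phi>: "\<And>z. z \<in> strip d \<Longrightarrow> (\<Phi> has_field_derivative F z) (at z)"
    and d': "0 < d'" "d' < d" and h: "0 < h" and X: "X < \<xi>"
    and R: "R = (real M + 1 / 2) * h" and XR: "\<bar>X\<bar> + 1 \<le> R" "\<bar>\<xi>\<bar> + 1 \<le> R"
  shows "norm (\<Phi> (of_real \<xi>) - \<Phi> (of_real X)
      - (\<Sum>j = - int M..int M. F (of_real (of_int j * h)) * of_real (J_SE j h \<xi> - J_SE j h X)))
    \<le> 4 * c * h / (d' * (exp (pi * d' / h) - exp (- (pi * d' / h)))) + 2 * d' * (\<xi> - X) * (c * bump \<alpha> R)"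
proof -
  let ?n = "\<lambda>j::int. complex_of_real (of_int j * h)"
  let ?s = "\<lambda>z::complex. sin (of_real pi * z / of_real h)"
  define f where "f x z = ?s x * F z / ((z - x) * ?s z)" for x z :: complex
  define LX where "LX = linepath (complex_of_real X) (of_real \<xi>)"
  \<comment> \<open>This is sinh (pi d' / h), the lower bound for the sine on the horizontal sides
    and the source of the exponentially small discretisation error.\<close>
  define E where "E = (exp (pi * d' / h) - exp (- (pi * d' / h))) / 2"
  have E: "0 < E" using d' h by (simp add: E_def)
  have str0: "complex_of_real x \<in> strip d" for x using d' by (simp add: strip_def)
  have c0: "0 \<le> c"
    using order_trans[OF norm_ge_zero le[OF str0[of 0]]] bump_pos[OF al, of 0]
    by (simp add: zero_le_mult_iff)
  have Rpos: "0 < R" using XR by linarith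
  define p1 p2 p3 p4 where p_defs: "p1 = Complex (- R) (- d')" "p2 = Complex R (- d')"
    "p3 = Complex R d'" "p4 = Complex (- R) d'"
  have re: "rectpath p1 p3 = linepath p1 p2 +++ linepath p2 p3 +++ linepath p3 p4 +++ linepath p4 p1"
    by (simp add: rectpath_def Let_def p_defs)
  define segs where "segs = closed_segment p1 p2 \<union> closed_segment p2 p3 \<union> closed_segment p3 p4 \<union> closed_segment p4 p1"
  have segs: "\<bar>Im z\<bar> \<le> d'" "\<bar>Im z\<bar> = d' \<or> \<bar>Re z\<bar> = R" if "z \<in> segs" for z
    using that d' Rpos by (auto simp: segs_def p_defs closed_segment_same_Re closed_segment_same_Im closed_segment_eq_real_ivl split: if_splits)
  have sin_h: "E \<le> norm (?s z)" if "\<bar>Im z\<bar> = d'" for z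
  proof -
    have "Im (of_real pi * z / of_real h) = pi * Im z / h" by simp
    then have "\<bar>Im (of_real pi * z / of_real h)\<bar> = pi * d' / h" using that h by (simp add: abs_mult)
    with cmod_sin_ge_sinh[of "of_real pi * z / of_real h"] show ?thesis by (simp add: E_def)
  qed
  have sin_v: "1 \<le> norm (?s z)" if "\<bar>Re z\<bar> = R" for z
  proof (rule cmod_sin_ge_1)
    have "cos (2 * (pi * R / h)) = -1"
    proof -
      have "2 * (pi * R / h) = pi * real (2 * M + 1)" using h by (simp add: R field_simps)
      then show ?thesis by (simp add: cos_npi2 del: of_nat_Suc of_nat_add of_nat_mult)
    qed
    moreover have "Re (of_real pi * z / of_real h) = pi * Re z / h" by simp
    moreover have "Re z = R \<or> Re z = - R" using that by linarith
    ultimately show "cos (2 * Re (of_real pi * z / of_real h)) = -1" by auto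
  qed
  have s_nz: "?s z \<noteq> 0" if "z \<in> segs" for z
    using segs(2)[OF that] sin_h[of z] sin_v[of z] E by auto
  have x_real: "\<exists>x. z = of_real x \<and> X \<le> x \<and> x \<le> \<xi>" if "z \<in> path_image LX" for z
    using that X unfolding LX_def path_image_linepath
    by (auto simp: closed_segment_of_real closed_segment_eq_real_ivl)
  have x_ne: "z \<noteq> x" if z: "z \<in> segs" and x: "x \<in> path_image LX" for z x
  proof -
    obtain y where y: "x = of_real y" "X \<le> y" "y \<le> \<xi>" using x_real[OF x] by blast
    then have "\<bar>Re x\<bar> < R" "Im x = 0" using XR by auto
    with segs(2)[OF z] d' show ?thesis by auto
  qed
  have segs_strip: "segs \<subseteq> strip d" using segs(1) d' by (fastforce simp: strip_def)
  have F_cont: "continuous_on segs F"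
    using holomorphic_on_imp_continuous_on[OF F] segs_strip continuous_on_subset by blast
  have f_cont2: "continuous_on (path_image LX \<times> segs) (\<lambda>(x, z). f x z)"
    unfolding f_def case_prod_unfold using h x_ne s_nz
    by (intro continuous_intros continuous_on_compose2[OF F_cont]) auto
  have f_cont: "continuous_on segs (f x)" if "x \<in> path_image LX" for x
    unfolding f_def using h x_ne[OF _ that] s_nz
    by (intro continuous_intros F_cont) auto
  have seg_sub: "closed_segment p1 p2 \<subseteq> segs" "closed_segment p2 p3 \<subseteq> segs" "closed_segment p3 p4 \<subseteq> segs" "closed_segment p4 p1 \<subseteq> segs"
    by (auto simp: segs_def)
  define I where "I p q x = contour_integral (linepath p q) (f x)" for p q x
  have I_cont: "continuous_on (path_image LX) (I p q)" if "closed_segment p q \<subseteq> segs" for p q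
  proof -
    have "continuous_on (path_image LX \<times> cbox 0 1) (\<lambda>(x, t). f x (linepath p q t) * (q - p))"
    proof -
      have "continuous_on (path_image LX \<times> cbox (0::real) 1) ((\<lambda>(x, z). f x z) \<circ> (\<lambda>(x, t). (x, linepath p q t)))"
        using that linepath_in_path[of _ p q]
        by (intro continuous_on_compose continuous_on_subset[OF f_cont2])
           (auto simp: case_prod_unfold linepath_def intro!: continuous_intros)
      then have "continuous_on (path_image LX \<times> cbox (0::real) 1) (\<lambda>(x, t). f x (linepath p q t))"
        by (simp add: o_def case_prod_unfold)
      then show ?thesis unfolding case_prod_unfold by (intro continuous_intros)
    qed
    from integral_continuous_on_param[OF this] show ?thesis
      by (simp add: I_def[abs_def] contour_integral_integral)
  qed
  have I_int: "I p q contour_integrable_on LX" if "closed_segment p q \<subseteq> segs" for p q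
    unfolding LX_def using I_cont[OF that]
    by (intro contour_integrable_continuous_linepath) (simp add: LX_def)
  have ctr: "contour_integral (rectpath p1 p3) (f x) = I p1 p2 x + (I p2 p3 x + (I p3 p4 x + I p4 p1 x))"
    if "x \<in> path_image LX" for x
  proof -
    have ii: "f x contour_integrable_on linepath p q" if "closed_segment p q \<subseteq> segs" for p q
      using continuous_on_subset[OF f_cont[OF \<open>x \<in> path_image LX\<close>] that]
      by (rule contour_integrable_continuous_linepath)
    show ?thesis
      unfolding re I_def
      by (simp add: ii seg_sub contour_integrable_join valid_path_join)
  qed
  define A where "A z = contour_integral LX (\<lambda>x. ?s x / (z - x))" for z
  have swap: "contour_integral LX (I p q) = contour_integral (linepath p q) (\<lambda>z. F z / ?s z * A z)"
    if "closed_segment p q \<subseteq> segs" for p q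
  proof -
    have "contour_integral LX (I p q) = contour_integral (linepath p q) (\<lambda>z. contour_integral LX (\<lambda>x. f x z))"
      unfolding I_def LX_def
    proof (rule contour_integral_swap)
      show "continuous_on (path_image (linepath (complex_of_real X) (complex_of_real \<xi>)) \<times> path_image (linepath p q)) (\<lambda>(y1, y2). f y1 y2)"
        using that by (intro continuous_on_subset[OF f_cont2]) (auto simp: LX_def)
    qed auto
    also have "\<dots> = contour_integral (linepath p q) (\<lambda>z. F z / ?s z * A z)"
    proof (rule contour_integral_cong)
      fix z assume "z \<in> path_image (linepath p q)"
      then have z: "z \<in> segs" using that by auto
      have "(\<lambda>x. f x z) = (\<lambda>x. F z / ?s z * (?s x / (z - x)))" by (simp add: f_def fun_eq_iff mult_ac)
      moreover have "(\<lambda>x. ?s x / (z - x)) contour_integrable_on LX"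
        unfolding LX_def using h x_ne[OF z]
        by (intro contour_integrable_continuous_linepath continuous_intros) (auto simp: LX_def)
      ultimately show "contour_integral LX (\<lambda>x. f x z) = F z / ?s z * A z"
        unfolding A_def by (simp only: contour_integral_lmul)
    qed simp
    finally show ?thesis .
  qed
  have bumpR: "bump \<alpha> (Re z) = bump \<alpha> R" if "\<bar>Re z\<bar> = R" for z
  proof -
    have "Re z = R \<or> Re z = - R" using that by linarith
    then show ?thesis by (auto simp: bump_minus)
  qed
  \<comment> \<open>A crude estimate is enough on the vertical sides: it grows with \<xi> - X but
    carries \<open>bump \<alpha> R\<close>, and will vanish as M tends to infinity.\<close>
  have vert: "norm (contour_integral LX (I p q)) \<le> 2 * d' * (\<xi> - X) * (c * bump \<alpha> R)"
    if sub: "closed_segment p q \<subseteq> segs" and RR: "\<And>z. z \<in> closed_segment p q \<Longrightarrow> \<bar>Re z\<bar> = R"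
      and len: "norm (q - p) = 2 * d'" for p q
  proof -
    have b0: "0 \<le> c * bump \<alpha> R" using c0 bump_pos[OF al, of R] by simp
    have "norm (I p q x) \<le> c * bump \<alpha> R * norm (q - p)" if x: "x \<in> path_image LX" for x
      unfolding I_def
    proof (rule contour_integral_linepath_bound[OF b0])
      fix z assume z: "z \<in> closed_segment p q"
      obtain y where y: "x = of_real y" "X \<le> y" "y \<le> \<xi>" using x_real[OF x] by blast
      have "norm (?s x) \<le> 1"
      proof -
        have "?s x = of_real (sin (pi * y / h))" by (simp add: y flip: sin_of_real)
        then show ?thesis by (simp only: norm_of_real abs_sin_le_one)
      qed
      moreover have "norm (F z) \<le> c * bump \<alpha> R"
        using le[of z] z sub segs_strip bumpR[OF RR[OF z]] by auto
      moreover have "1 \<le> norm (z - x)"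
      proof -
        have "1 \<le> \<bar>Re (z - x)\<bar>" using RR[OF z] XR y by auto
        also have "\<dots> \<le> norm (z - x)" by (rule abs_Re_le_cmod)
        finally show ?thesis .
      qed
      moreover have "1 \<le> norm (?s z)" by (rule sin_v[OF RR[OF z]])
      ultimately have "norm (f x z) \<le> (1 * (c * bump \<alpha> R)) / (1 * 1)"
        unfolding f_def norm_divide norm_mult by (intro frac_le mult_mono) (use b0 in auto)
      then show "norm (f x z) \<le> c * bump \<alpha> R" by simp
    qed
    then have "norm (contour_integral LX (I p q)) \<le> c * bump \<alpha> R * norm (q - p) * norm (complex_of_real \<xi> - of_real X)"
      unfolding LX_def using b0 by (intro contour_integral_linepath_bound) auto
    also have "norm (complex_of_real \<xi> - of_real X) = \<xi> - X"
      using X by (simp flip: of_real_diff)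
    finally show ?thesis unfolding len by (simp only: mult_ac)
  qed
  \<comment> \<open>On the horizontal sides A contributes 2 h / d' and the sine 1 / E; integrating
    \<open>bump\<close> along the side costs at most 1, whatever R is.\<close>
  have hor: "norm (contour_integral (linepath (Complex (- R) y) (Complex R y)) (\<lambda>z. F z / ?s z * A z)) \<le> c / E * (2 * h / d')"
    if y: "\<bar>y\<bar> = d'" for y
  proof -
    have "norm (contour_integral (linepath (Complex (- R) y) (Complex R y)) (\<lambda>z. F z / ?s z * A z))
      \<le> c / E * (2 * h / d') * (logistic \<alpha> R - logistic \<alpha> (- R))"
    proof (rule contour_integral_horizontal_bound)
      fix t :: real
      let ?z = "Complex t y"
      have "norm (F ?z) \<le> c * bump \<alpha> t" using le[of ?z] y d' by (simp add: strip_def)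
      moreover have "E \<le> norm (?s ?z)" using sin_h[of ?z] y by simp
      moreover have "norm (A ?z) \<le> 2 * h / d'"
        unfolding A_def LX_def using oscillatory_integral_bound[of ?z h X \<xi>] y d' h X by auto
      ultimately have "norm (F ?z / ?s ?z * A ?z) \<le> c * bump \<alpha> t / E * (2 * h / d')"
        unfolding norm_divide norm_mult using E 
        by (intro frac_le mult_mono) (use c0 bump_pos[OF al, of t] in auto)
      then show "norm (F ?z / ?s ?z * A ?z) \<le> c / E * (2 * h / d') * bump \<alpha> t" by (simp add: mult_ac)
    qed (use Rpos c0 E h d' in auto)
    also have "\<dots> \<le> c / E * (2 * h / d') * 1"
      using logistic_less_1[of \<alpha> R] logistic_pos[of \<alpha> "- R"] c0 E h d' by (intro mult_left_mono) auto
    finally show ?thesis by simp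
  qed
  have h12: "norm (contour_integral LX (I p1 p2)) \<le> c / E * (2 * h / d')"
    unfolding swap[OF seg_sub(1)] using hor[of "- d'"] d' by (simp add: p_defs)
  have h34: "norm (contour_integral LX (I p3 p4)) \<le> c / E * (2 * h / d')"
  proof -
    have "contour_integral (linepath p3 p4) (\<lambda>z. F z / ?s z * A z) = - contour_integral (linepath p4 p3) (\<lambda>z. F z / ?s z * A z)"
      using contour_integral_reversepath[of "linepath p4 p3"] by simp
    then show ?thesis unfolding swap[OF seg_sub(3)] using hor[of d'] d' by (simp add: p_defs)
  qed
  have len: "norm (p3 - p2) = 2 * d'" "norm (p1 - p4) = 2 * d'"
  proof -
    have "p3 - p2 = of_real (2 * d') * \<i>" "p1 - p4 = - (of_real (2 * d') * \<i>)"
      by (simp_all add: p_defs complex_eq_iff)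
    then show "norm (p3 - p2) = 2 * d'" "norm (p1 - p4) = 2 * d'"
      using d' by (simp_all add: norm_mult)
  qed
  have v23: "norm (contour_integral LX (I p2 p3)) \<le> 2 * d' * (\<xi> - X) * (c * bump \<alpha> R)"
    using Rpos by (intro vert seg_sub len) (auto simp: p_defs closed_segment_same_Re)
  have v41: "norm (contour_integral LX (I p4 p1)) \<le> 2 * d' * (\<xi> - X) * (c * bump \<alpha> R)"
    using Rpos by (intro vert seg_sub len) (auto simp: p_defs closed_segment_same_Re)
  define Err where "Err x = F (of_real x) - (\<Sum>j = - int M..int M. F (?n j) * of_real (sinc (pi * (x / h - of_int j))))" for x
  \<comment> \<open>Primitive minus its sinc quadrature. Since \<open>J_SE\<close> is a primitive of
    the sinc function, the derivative of P is the interpolation error, to which the residue formula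
    applies.\<close>
  define P where "P x = \<Phi> (of_real x) - (\<Sum>j = - int M..int M. F (?n j) * of_real (J_SE j h x))" for x
  have P_der: "(P has_vector_derivative Err x) (at x)" for x
  proof -
    have 1: "((\<lambda>x. \<Phi> (of_real x)) has_vector_derivative F (of_real x)) (at x)"
      using has_vector_derivative_horizontal[of \<Phi> "F (of_real x)" x 0] \<Phi>[OF str0[of x]]
      by (simp add: complex_of_real_def)
    have 2: "((\<lambda>x. F (?n j) * of_real (J_SE j h x)) has_vector_derivative F (?n j) * of_real (sinc (pi * (x / h - of_int j)))) (at x)" for j
    proof -
      have "((\<lambda>x. complex_of_real (J_SE j h x)) has_vector_derivative of_real (sinc (pi * (x / h - of_int j)))) (at x)"
        using DERIV_J_SE[OF h, of j x] by (rule has_vector_derivative_of_real)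
      from has_vector_derivative_mult_right[OF this] show ?thesis .
    qed
    show ?thesis unfolding P_def[abs_def] Err_def
      by (intro has_vector_derivative_diff 1 has_vector_derivative_sum 2)
  qed
  have err_eq: "Err x = 1 / (2 * of_real pi * \<i>) * contour_integral (rectpath p1 p3) (f (of_real x))"
    if "X \<le> x" "x \<le> \<xi>" for x
  proof -
    have "\<bar>x\<bar> < R" using XR that by linarith
    from sinc_interpolation_error[OF F d' h R this] show ?thesis
      by (simp add: Err_def f_def[abs_def] p_defs flip: sin_of_real)
  qed
  have "P \<xi> - P X = integral {X..\<xi>} Err"
    using X P_der by (intro integral_unique[symmetric] fundamental_theorem_of_calculus)
      (auto intro: has_vector_derivative_at_within)
  also have "\<dots> = integral {X..\<xi>} (\<lambda>x. 1 / (2 * of_real pi * \<i>) *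
      (I p1 p2 (of_real x) + (I p2 p3 (of_real x) + (I p3 p4 (of_real x) + I p4 p1 (of_real x)))))"
  proof (rule integral_cong)
    fix x assume x: "x \<in> {X..\<xi>}"
    then have "of_real x \<in> path_image LX"
      using X by (auto simp: LX_def closed_segment_of_real closed_segment_eq_real_ivl)
    from ctr[OF this] x show "Err x = 1 / (2 * of_real pi * \<i>) *
      (I p1 p2 (of_real x) + (I p2 p3 (of_real x) + (I p3 p4 (of_real x) + I p4 p1 (of_real x))))"
      by (simp add: err_eq)
  qed
  also have "\<dots> = contour_integral LX (\<lambda>x. 1 / (2 * of_real pi * \<i>) *
      (I p1 p2 x + (I p2 p3 x + (I p3 p4 x + I p4 p1 x))))"
    unfolding LX_def using X by (subst contour_integral_linepath_Reals_eq) auto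
  also have "\<dots> = 1 / (2 * of_real pi * \<i>) * (contour_integral LX (I p1 p2) + (contour_integral LX (I p2 p3)
      + (contour_integral LX (I p3 p4) + contour_integral LX (I p4 p1))))"
    by (simp only: contour_integral_lmul contour_integral_add contour_integrable_add I_int seg_sub)
  also have "norm \<dots> \<le> 1 * (c / E * (2 * h / d') + (2 * d' * (\<xi> - X) * (c * bump \<alpha> R)
      + (c / E * (2 * h / d') + 2 * d' * (\<xi> - X) * (c * bump \<alpha> R))) ) / 2"
  proof -
    have "norm (1 / (2 * of_real pi * \<i>)) \<le> (1 / 2 :: real)"
      using pi_ge_two by (simp add: norm_divide norm_mult field_simps)
    moreover have "norm (contour_integral LX (I p1 p2) + (contour_integral LX (I p2 p3)
      + (contour_integral LX (I p3 p4) + contour_integral LX (I p4 p1))))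
      \<le> c / E * (2 * h / d') + (2 * d' * (\<xi> - X) * (c * bump \<alpha> R)
      + (c / E * (2 * h / d') + 2 * d' * (\<xi> - X) * (c * bump \<alpha> R)))"
      by (intro norm_triangle_le add_mono h12 v23 h34 v41 order_trans[OF norm_triangle_ineq])
    ultimately show ?thesis unfolding norm_mult
      using mult_mono[of "norm (1 / (2 * of_real pi * \<i>))" "1 / 2"] by fastforce
  qed
  also have "\<dots> = c / E * (2 * h / d') + 2 * d' * (\<xi> - X) * (c * bump \<alpha> R)" by simp
  also have "c / E * (2 * h / d') = 4 * c * h / (d' * (exp (pi * d' / h) - exp (- (pi * d' / h))))"
    by (simp add: E_def mult_ac)
  finally have "norm (P \<xi> - P X) \<le> 4 * c * h / (d' * (exp (pi * d' / h) - exp (- (pi * d' / h)))) + 2 * d' * (\<xi> - X) * (c * bump \<alpha> R)" .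
  moreover have "P \<xi> - P X = \<Phi> (of_real \<xi>) - \<Phi> (of_real X)
      - (\<Sum>j = - int M..int M. F (?n j) * of_real (J_SE j h \<xi> - J_SE j h X))"
    by (simp add: P_def right_diff_distrib sum_subtractf)
  ultimately show ?thesis by (simp only:)
qed

text \<open>The mesh size solves \<alpha> h N = pi d / h, so that the truncation error exp (-
  \<alpha> h N) and the discretisation error exp (- pi d / h) decay alike.\<close>

lemma mesh_facts:
  assumes "0 < \<alpha>" "0 < d" "0 < N"
  shows mesh_pos: "0 < mesh \<alpha> d N" and mesh_le: "mesh \<alpha> d N \<le> sqrt (pi * d / \<alpha>)"
    and mesh_decay: "\<alpha> * mesh \<alpha> d N * real N = sqrt (pi * d * \<alpha> * real N)"
    and mesh_strip: "pi * d / mesh \<alpha> d N = sqrt (pi * d * \<alpha> * real N)"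
proof -
  let ?h = "mesh \<alpha> d N" and ?x = "pi * d / (\<alpha> * real N)"
  have x: "0 < ?x" using assms by simp
  then show h: "0 < ?h" by (simp only: mesh_def real_sqrt_gt_0_iff)
  have "\<alpha> * 1 \<le> \<alpha> * real N" using assms by (intro mult_left_mono) auto
  then have "?x \<le> pi * d / \<alpha>" using assms by (intro divide_left_mono) auto
  then show "?h \<le> sqrt (pi * d / \<alpha>)" by (simp add: mesh_def)
  have "(\<alpha> * real N)\<^sup>2 * ?x = pi * d * \<alpha> * real N"
    using assms by (simp add: power2_eq_square)
  then have "sqrt (pi * d * \<alpha> * real N) = sqrt ((\<alpha> * real N)\<^sup>2) * sqrt ?x"
    by (metis real_sqrt_mult)
  also have "sqrt ((\<alpha> * real N)\<^sup>2) = \<alpha> * real N" using assms by (intro real_sqrt_unique) auto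
  finally show d: "\<alpha> * ?h * real N = sqrt (pi * d * \<alpha> * real N)"
    by (simp add: mesh_def mult_ac)
  have "?h * ?h = ?x" using x unfolding mesh_def by (metis less_imp_le real_sqrt_mult_self abs_of_nonneg)
  then have "(\<alpha> * ?h * real N) * ?h = pi * d" using assms by (simp add: field_simps)
  then show "pi * d / ?h = sqrt (pi * d * \<alpha> * real N)" using h unfolding d by (simp add: field_simps)
qed

text \<open>The rectangle estimate is used with M much larger than N. Discarding the nodes beyond N
  costs a tail of the Riemann sum, and M tending to infinity removes the vertical sides.\<close>

lemma sinc_indefinite_truncated:
  fixes F :: "complex \<Rightarrow> complex"
  assumes F: "F holomorphic_on strip d" and al: "0 < \<alpha>"
    and le: "\<And>z. z \<in> strip d \<Longrightarrow> norm (F z) \<le> c * bump \<alpha> (Re z)"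
    and \<Phi>: "\<And>z. z \<in> strip d \<Longrightarrow> (\<Phi> has_field_derivative F z) (at z)"
    and d': "0 < d'" "d' < d" and h: "0 < h" and X: "X < \<xi>"
  shows "norm (\<Phi> (of_real \<xi>) - \<Phi> (of_real X)
      - (\<Sum>j = - int N..int N. F (of_real (of_int j * h)) * of_real (J_SE j h \<xi> - J_SE j h X)))
    \<le> 4 * c * h / (d' * (exp (pi * d' / h) - exp (- (pi * d' / h)))) + 4 * step_const * c * exp (- (\<alpha> * h * real N))"
    (is "norm ?L \<le> ?B1 + ?B2")
proof -
  let ?t = "\<lambda>j. F (of_real (of_int j * h)) * of_real (J_SE j h \<xi> - J_SE j h X)"
  let ?R = "\<lambda>M. (real M + 1 / 2) * h"
  have str0: "complex_of_real x \<in> strip d" for x using d' by (simp add: strip_def)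
  have c0: "0 \<le> c"
    using order_trans[OF norm_ge_zero le[OF str0[of 0]]] bump_pos[OF al, of 0]
    by (simp add: zero_le_mult_iff)
  have tail: "norm (\<Sum>j \<in> {- int M..int M} - {- int N..int N}. ?t j) \<le> ?B2" if "N \<le> M" for M
  proof -
    have "norm (\<Sum>j \<in> {- int M..int M} - {- int N..int N}. ?t j)
      \<le> (\<Sum>j \<in> {- int M..int M} - {- int N..int N}. 2 * step_const * c * (h * bump \<alpha> (of_int j * h)))"
    proof (rule sum_norm_le)
      fix j
      have "norm (F (of_real (of_int j * h))) \<le> c * bump \<alpha> (of_int j * h)"
        using le[OF str0[of "of_int j * h"]] by simp
      moreover have "\<bar>J_SE j h \<xi> - J_SE j h X\<bar> \<le> h * step_const + h * step_const"
        using J_SE_bound[of h j \<xi>] J_SE_bound[of h j X] h by linarith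
      ultimately have "norm (?t j) \<le> c * bump \<alpha> (of_int j * h) * (h * step_const + h * step_const)"
        unfolding norm_mult norm_of_real using c0 bump_pos[OF al, of "of_int j * h"] by (intro mult_mono) auto
      then show "norm (?t j) \<le> 2 * step_const * c * (h * bump \<alpha> (of_int j * h))" by (simp add: mult_ac)
    qed
    also have "\<dots> \<le> 2 * step_const * c * (2 * exp (- (\<alpha> * h * real N)))"
      unfolding sum_distrib_left[where r = "2 * step_const * c", symmetric]
      by (intro mult_left_mono sum_bump_tail_le[OF al h that]) (use c0 step_const(1) in auto)
    finally show ?thesis by simp
  qed
  have lim: "(\<lambda>M. ?B1 + 2 * d' * (\<xi> - X) * (c * bump \<alpha> (?R M)) + ?B2) \<longlonglongrightarrow> ?B1 + 2 * d' * (\<xi> - X) * (c * 0) + ?B2"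
  proof (intro tendsto_intros)
    show "(\<lambda>M. bump \<alpha> (?R M)) \<longlonglongrightarrow> 0"
      unfolding bump_def logistic_def using al h by real_asymp
  qed
  have Rtop: "filterlim ?R at_top sequentially" using h by real_asymp
  have "\<forall>\<^sub>F M in sequentially. \<bar>X\<bar> + 1 \<le> ?R M \<and> \<bar>\<xi>\<bar> + 1 \<le> ?R M \<and> N \<le> M"
    using Rtop by (intro eventually_conj eventually_ge_at_top) (auto simp: filterlim_at_top)
  then have ev: "\<forall>\<^sub>F M in sequentially. norm ?L \<le> ?B1 + 2 * d' * (\<xi> - X) * (c * bump \<alpha> (?R M)) + ?B2"
  proof eventually_elim
    case (elim M)
    have "(\<Sum>j = - int M..int M. ?t j) = (\<Sum>j \<in> {- int M..int M} - {- int N..int N}. ?t j) + (\<Sum>j = - int N..int N. ?t j)"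
      by (rule sum.subset_diff) (use elim in auto)
    then have "?L = (\<Phi> (of_real \<xi>) - \<Phi> (of_real X) - (\<Sum>j = - int M..int M. ?t j)) + (\<Sum>j \<in> {- int M..int M} - {- int N..int N}. ?t j)"
      by simp
    also have "norm \<dots> \<le> (?B1 + 2 * d' * (\<xi> - X) * (c * bump \<alpha> (?R M))) + ?B2"
      using elim by (intro norm_triangle_mono sinc_indefinite_rectangle[OF F al le \<Phi> d' h X refl] tail) auto
    finally show ?case .
  qed
  show ?thesis using tendsto_lowerbound[OF lim ev] by simp
qed

text \<open>In the first summand h is replaced by its value at N = 1, and sqrt (pi * d * \<alpha>)
  is the value at N = 1 of s = sqrt (pi * d * \<alpha> * N): exp s - exp (- s) is bounded below by
  exp s times the factor in parentheses. The second summand is the truncation error.\<close>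

definition sinc_err :: "real \<Rightarrow> real \<Rightarrow> real" where
  "sinc_err \<alpha> d = 4 * sqrt (pi * d / \<alpha>) / (d * (1 - exp (- (2 * sqrt (pi * d * \<alpha>))))) + 4 * step_const"

text \<open>Two limits of the truncated estimate: d' tends to d, where the bound is continuous
  although F is controlled on the open strip only, and X tends to minus infinity, where
  \<open>J_SE\<close> vanishes and \<Phi> tends to l.\<close>

lemma sinc_indefinite_error:
  fixes F :: "complex \<Rightarrow> complex"
  assumes F: "F holomorphic_on strip d" and al: "0 < \<alpha>" and d: "0 < d" and N: "0 < N"
    and le: "\<And>z. z \<in> strip d \<Longrightarrow> norm (F z) \<le> c * bump \<alpha> (Re z)"
    and bp: "bot_prim d l F \<Phi>"
  shows "norm (\<Phi> (of_real \<xi>) - l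
      - (\<Sum>j = - int N..int N. F (of_real (of_int j * mesh \<alpha> d N)) * of_real (J_SE j (mesh \<alpha> d N) \<xi>)))
    \<le> sinc_err \<alpha> d * c * exp (- sqrt (pi * d * \<alpha> * real N))"
proof -
  define h where "h = mesh \<alpha> d N"
  define s where "s = sqrt (pi * d * \<alpha> * real N)"
  define s1 where "s1 = sqrt (pi * d * \<alpha>)"
  note h = mesh_facts[OF al d N, folded h_def s_def]
  have s1: "0 < s1" "s1 \<le> s"
  proof -
    show "0 < s1" using al d by (simp add: s1_def)
    have "pi * d * \<alpha> * 1 \<le> pi * d * \<alpha> * real N" using al d N by (intro mult_left_mono) auto
    then show "s1 \<le> s" by (simp add: s1_def s_def)
  qed
  have \<Phi>: "\<And>z. z \<in> strip d \<Longrightarrow> (\<Phi> has_field_derivative F z) (at z)" using bp by (simp add: bot_prim_def)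
  have c0: "0 \<le> c"
    using order_trans[OF norm_ge_zero le[of 0]] bump_pos[OF al, of 0] d
    by (simp add: zero_le_mult_iff strip_def)
  let ?S = "\<lambda>X. \<Phi> (of_real \<xi>) - \<Phi> (of_real X)
      - (\<Sum>j = - int N..int N. F (of_real (of_int j * h)) * of_real (J_SE j h \<xi> - J_SE j h X))"
  let ?B = "\<lambda>d'. 4 * c * h / (d' * (exp (pi * d' / h) - exp (- (pi * d' / h)))) + 4 * step_const * c * exp (- (\<alpha> * h * real N))"
  have e0: "exp (- (pi * d / h)) < exp (pi * d / h)" using h(1) d by simp
  have 1: "norm (?S X) \<le> ?B d" if X: "X < \<xi>" for X
  proof (rule tendsto_lowerbound)
    show "(?B \<longlongrightarrow> ?B d) (at_left d)"
      using e0 d h(1) by (intro tendsto_intros) auto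
    have "\<forall>\<^sub>F d' in at_left d. d' \<in> {0<..<d}"
      using eventually_at_left_real[OF d] .
    then show "\<forall>\<^sub>F d' in at_left d. norm (?S X) \<le> ?B d'"
      by eventually_elim (rule sinc_indefinite_truncated[OF F al le \<Phi> _ _ h(1) X], auto)
  qed simp
  have "norm (\<Phi> (of_real \<xi>) - l - (\<Sum>j = - int N..int N. F (of_real (of_int j * h)) * of_real (J_SE j h \<xi> - 0))) \<le> ?B d"
  proof (rule tendsto_upperbound)
    have "((\<lambda>X. \<Phi> (of_real X)) \<longlongrightarrow> l) at_bot"
      using bp d by (auto simp: bot_prim_def complex_of_real_def dest: spec[of _ 0])
    then show "((\<lambda>X. norm (?S X)) \<longlongrightarrow> norm (\<Phi> (of_real \<xi>) - l - (\<Sum>j = - int N..int N. F (of_real (of_int j * h)) * of_real (J_SE j h \<xi> - 0)))) at_bot"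
      by (intro tendsto_intros tendsto_J_SE_at_bot h(1))
    show "\<forall>\<^sub>F X in at_bot. norm (?S X) \<le> ?B d"
      using eventually_gt_at_bot[of \<xi>] 1 by (auto simp: eventually_at_bot_dense)
  qed simp
  also have "?B d \<le> sinc_err \<alpha> d * c * exp (- s)"
  proof -
    have e1: "0 < 1 - exp (- (2 * s1))" using s1 by simp
    have "exp s - exp (- s) = exp s * (1 - exp (- (2 * s)))"
      by (simp add: right_diff_distrib exp_add[symmetric])
    also have "\<dots> \<ge> exp s * (1 - exp (- (2 * s1)))" using s1 by (intro mult_left_mono) auto
    finally have "exp s * (1 - exp (- (2 * s1))) \<le> exp s - exp (- s)" .
    then have "4 * c * h / (d * (exp s - exp (- s))) \<le> 4 * c * sqrt (pi * d / \<alpha>) / (d * (exp s * (1 - exp (- (2 * s1)))))"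
      using e1 d c0 h al by (intro frac_le mult_left_mono mult_pos_pos mult_nonneg_nonneg) auto
    also have "\<dots> = 4 * sqrt (pi * d / \<alpha>) / (d * (1 - exp (- (2 * s1)))) * c * exp (- s)"
      using e1 d by (simp add: exp_minus field_simps)
    finally show ?thesis
      unfolding h(3,4) sinc_err_def s1_def[symmetric] by (simp add: distrib_right)
  qed
  finally show ?thesis by (simp add: h_def s_def)
qed

section \<open>Stability of the discrete system\<close>

text \<open>The induction runs on the right-hand side rather than on v, each step using 1 + a \<le>
  exp a. The sums stop before i, as for a strictly lower triangular matrix.\<close>

lemma gronwall_int:
  fixes v a :: "int \<Rightarrow> real"
  assumes v: "\<And>i. i \<in> {m..n} \<Longrightarrow> v i \<le> \<rho> + (\<Sum>j = m..<i. a j * v j)"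
    and a: "\<And>j. 0 \<le> a j" and "0 \<le> \<rho>" and i: "i \<in> {m..n}"
  shows "v i \<le> \<rho> * exp (\<Sum>j = m..<i. a j)"
proof -
  have "m \<le> i" using i by simp
  then have "i \<le> n \<longrightarrow> \<rho> + (\<Sum>j = m..<i. a j * v j) \<le> \<rho> * exp (\<Sum>j = m..<i. a j)"
  proof (induction i rule: int_ge_induct)
    case (step i)
    show ?case
    proof
      assume n: "i + 1 \<le> n"
      let ?T = "\<rho> + (\<Sum>j = m..<i. a j * v j)"
      have T: "?T \<le> \<rho> * exp (\<Sum>j = m..<i. a j)" using step n by simp
      have ins: "{m..<i + 1} = insert i {m..<i}" using step by auto
      have "\<rho> + (\<Sum>j = m..<i + 1. a j * v j) = ?T + a i * v i" unfolding ins by simp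
      also have "\<dots> \<le> ?T + a i * ?T"
        using v[of i] step n a[of i] by (intro add_left_mono mult_left_mono) auto
      also have "\<dots> = ?T * (1 + a i)" by (simp add: algebra_simps)
      also have "\<dots> \<le> (\<rho> * exp (\<Sum>j = m..<i. a j)) * exp (a i)"
        using T a[of i] exp_ge_add_one_self[of "a i"] \<open>0 \<le> \<rho>\<close> by (intro mult_mono) auto
      also have "\<dots> = \<rho> * exp (\<Sum>j = m..<i + 1. a j)" unfolding ins by (simp add: exp_add add.commute)
      finally show "\<rho> + (\<Sum>j = m..<i + 1. a j * v j) \<le> \<rho> * exp (\<Sum>j = m..<i + 1. a j)" .
    qed
  qed simp
  with v[OF i] i show ?thesis by simp
qed

text \<open>The entries of \<open>I_mat\<close> as a function of the index difference, equivalently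
  the values of \<open>J_SE\<close> at nodes divided by h.\<close>

definition step_fun :: "int \<Rightarrow> real" where
  "step_fun k = 1 / 2 + 1 / pi * Si (pi * of_int k)"

text \<open>The Heaviside function is given the value 0 at 0, so that the comparison matrix is
  strictly lower triangular; the diagonal entry 1/2 counts as defect.\<close>

definition step_defect :: "int \<Rightarrow> real" where
  "step_defect k = step_fun k - (if 0 < k then 1 else 0)"

lemma J_SE_node: "0 < h \<Longrightarrow> J_SE j h (of_int i * h) = h * step_fun (i - j)"
  by (simp add: J_SE_def step_fun_def)

lemma abs_step_fun_le: "\<bar>step_fun k\<bar> \<le> step_const"
  unfolding step_fun_def by (rule step_const)

lemma abs_step_defect_le: "\<bar>step_defect k\<bar> \<le> step_const + 1"
  using abs_step_fun_le[of k] unfolding step_defect_def by (simp split: if_split) arith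

lemma step_defect_small:
  assumes "0 < \<eta>"
  shows "\<exists>M::nat. \<forall>k. int M < \<bar>k\<bar> \<longrightarrow> \<bar>step_defect k\<bar> \<le> \<eta>"
proof -
  have "\<forall>\<^sub>F t in at_top. dist (Si t) (pi / 2) < \<eta>"
    using tendstoD[OF Si_at_top assms] .
  then obtain T where T: "\<And>t. T \<le> t \<Longrightarrow> \<bar>Si t - pi / 2\<bar> < \<eta>"
    by (auto simp: eventually_at_top_linorder dist_real_def)
  obtain M :: nat where M: "T \<le> real M" using real_arch_simple by blast
  have neg: "Si (- t) = - Si t" for t
    using Si_neg[of t] Si_neg[of "- t"] by (cases "0 \<le> t") auto
  have pos: "\<bar>1 / pi * Si (pi * of_int k) - 1 / 2\<bar> \<le> \<eta>" if "int M < k" for k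
  proof -
    have "real M \<le> 1 * of_int k" using that by linarith
    also have "\<dots> \<le> pi * of_int k" using that pi_ge_two by (intro mult_right_mono) auto
    finally have "\<bar>Si (pi * of_int k) - pi / 2\<bar> < \<eta>" using M by (intro T) simp
    then have "\<bar>1 / pi * (Si (pi * of_int k) - pi / 2)\<bar> \<le> 1 * \<eta>"
      unfolding abs_mult using pi_ge_two by (intro mult_mono) (auto simp: field_simps)
    then show ?thesis by (simp add: right_diff_distrib)
  qed
  have "\<bar>step_defect k\<bar> \<le> \<eta>" if "int M < \<bar>k\<bar>" for k
  proof (cases "0 < k")
    case True
    with pos[of k] that show ?thesis by (simp add: step_defect_def step_fun_def)
  next
    case False
    then have "\<bar>1 / pi * Si (pi * of_int (- k)) - 1 / 2\<bar> \<le> \<eta>" using that by (intro pos) simp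
    then have "\<bar>- (1 / pi * Si (pi * of_int k)) - 1 / 2\<bar> \<le> \<eta>"
      by (simp only: of_int_minus mult_minus_right neg)
    then have "\<bar>1 / 2 + 1 / pi * Si (pi * of_int k)\<bar> \<le> \<eta>" by linarith
    with False show ?thesis unfolding step_defect_def step_fun_def by simp
  qed
  then show ?thesis by blast
qed

lemma bump_le_rate: "0 < \<alpha> \<Longrightarrow> bump \<alpha> x \<le> \<alpha>"
  by (rule order_trans[OF bump_le]) (auto simp: mult_le_cancel_left2)

text \<open>At distance more than M from the diagonal the defect is at most \<eta>, while the
  weights sum to at most \<alpha> + 2. Within distance M there are at most 2 M + 1 indices, each of
  weight O(h). M depends on \<epsilon> only and is fixed before h is made small.\<close>

lemma weighted_defect_small:
  assumes al: "0 < \<alpha>" and eps: "0 < \<epsilon>"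
  shows "\<exists>h0. 0 < h0 \<and> h0 \<le> 1 \<and> (\<forall>h N i. 0 < h \<longrightarrow> h \<le> h0 \<longrightarrow>
     (\<Sum>j = - int N..int N. h * bump \<alpha> (of_int j * h) * \<bar>step_defect (i - j)\<bar>) \<le> \<epsilon>)"
proof -
  define \<eta> where "\<eta> = \<epsilon> / (2 * (\<alpha> + 2))"
  have eta: "0 < \<eta>" using al eps by (simp add: \<eta>_def)
  obtain M :: nat where M: "\<And>k. int M < \<bar>k\<bar> \<Longrightarrow> \<bar>step_defect k\<bar> \<le> \<eta>"
    using step_defect_small[OF eta] by blast
  define B where "B = \<alpha> * (step_const + 1) * (2 * real M + 1)"
  have B: "0 \<le> B" using al step_const by (simp add: B_def)
  define h0 where "h0 = min 1 (\<epsilon> / (2 * (B + 1)))"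
  have h0: "0 < h0" "h0 \<le> 1" "h0 * B \<le> \<epsilon> / 2"
  proof -
    show "0 < h0" "h0 \<le> 1" using eps B by (simp_all add: h0_def)
    have "h0 * B \<le> \<epsilon> / (2 * (B + 1)) * (B + 1)"
      using eps B by (intro mult_mono) (auto simp: h0_def)
    also have "\<epsilon> / (2 * (B + 1)) * (B + 1) = \<epsilon> / 2" using B by (simp add: field_simps)
    finally show "h0 * B \<le> \<epsilon> / 2" .
  qed
  have "(\<Sum>j = - int N..int N. h * bump \<alpha> (of_int j * h) * \<bar>step_defect (i - j)\<bar>) \<le> \<epsilon>"
    if h: "0 < h" "h \<le> h0" for h N i
  proof -
    have b: "0 \<le> h * bump \<alpha> x" for x using bump_pos[OF al, of x] h by simp
    have "h * bump \<alpha> (of_int j * h) * \<bar>step_defect (i - j)\<bar>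
      \<le> \<eta> * (h * bump \<alpha> (of_int j * h)) + (if j \<in> {i - int M..i + int M} then h * \<alpha> * (step_const + 1) else 0)" for j
    proof (cases "j \<in> {i - int M..i + int M}")
      case True
      have "h * bump \<alpha> (of_int j * h) * \<bar>step_defect (i - j)\<bar> \<le> h * \<alpha> * (step_const + 1)"
        using h al bump_le_rate[OF al] bump_pos[OF al] abs_step_defect_le step_const(1)
        by (intro mult_mono) (auto intro: less_imp_le)
      moreover have "0 \<le> \<eta> * (h * bump \<alpha> (of_int j * h))" using b eta by simp
      ultimately show ?thesis using True by simp
    next
      case False
      then have "\<bar>step_defect (i - j)\<bar> \<le> \<eta>" by (intro M) auto
      from mult_left_mono[OF this b] show ?thesis
        unfolding if_not_P[OF False] by (simp add: mult.commute)
    qed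
    then have "(\<Sum>j = - int N..int N. h * bump \<alpha> (of_int j * h) * \<bar>step_defect (i - j)\<bar>)
      \<le> (\<Sum>j = - int N..int N. \<eta> * (h * bump \<alpha> (of_int j * h)) + (if j \<in> {i - int M..i + int M} then h * \<alpha> * (step_const + 1) else 0))"
      by (rule sum_mono)
    also have "\<dots> = \<eta> * (\<Sum>j = - int N..int N. h * bump \<alpha> (of_int j * h))
      + (\<Sum>j \<in> {- int N..int N} \<inter> {i - int M..i + int M}. h * \<alpha> * (step_const + 1))"
      unfolding sum.distrib sum_distrib_left by (simp only: sum.inter_restrict finite_atLeastAtMost_int)
    also have "\<dots> \<le> \<eta> * (\<alpha> + 2) + h0 * B"
    proof (rule add_mono)
      show "\<eta> * (\<Sum>j = - int N..int N. h * bump \<alpha> (of_int j * h)) \<le> \<eta> * (\<alpha> + 2)"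
        using eta h h0 al by (intro mult_left_mono sum_bump_le) auto
      have "card ({- int N..int N} \<inter> {i - int M..i + int M}) \<le> card {i - int M..i + int M}"
        by (intro card_mono) auto
      then have cd: "real (card ({- int N..int N} \<inter> {i - int M..i + int M})) \<le> 2 * real M + 1" by simp
      have "(\<Sum>j \<in> {- int N..int N} \<inter> {i - int M..i + int M}. h * \<alpha> * (step_const + 1))
        \<le> (2 * real M + 1) * (h * \<alpha> * (step_const + 1))"
        unfolding sum_constant using h al step_const(1) by (intro mult_right_mono[OF cd]) auto
      also have "\<dots> = h * B" by (simp add: B_def)
      also have "\<dots> \<le> h0 * B" using h B by (intro mult_right_mono) auto
      finally show "(\<Sum>j \<in> {- int N..int N} \<inter> {i - int M..i + int M}. h * \<alpha> * (step_const + 1)) \<le> h0 * B" .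
    qed
    also have "\<eta> * (\<alpha> + 2) = \<epsilon> / 2" using al by (simp add: \<eta>_def field_simps)
    also have "\<epsilon> / 2 + h0 * B \<le> \<epsilon>" using h0(3) by simp
    finally show ?thesis .
  qed
  with h0 show ?thesis by blast
qed

text \<open>The action of \<open>W_mat\<close> on a vector (\<open>W_mat_mult_vec\<close>), with
  general coefficients that already contain the Jacobian: m and p for the outer quadrature, \<kappa>
  for the inner one.\<close>

definition nystrom_op :: "real \<Rightarrow> nat \<Rightarrow> (int \<Rightarrow> complex) \<Rightarrow> (int \<Rightarrow> complex) \<Rightarrow> (int \<Rightarrow> int \<Rightarrow> complex) \<Rightarrow>
    (int \<Rightarrow> complex) \<Rightarrow> int \<Rightarrow> complex" where
  "nystrom_op h N m p \<kappa> v i = (\<Sum>j = - int N..int N.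
     (m j * v j + p j * (\<Sum>l = - int N..int N. \<kappa> j l * v l * of_real (h * step_fun (j - l))))
       * of_real (h * step_fun (i - j)))"

text \<open>With \<open>step_fun\<close> replaced by the Heaviside function, Gronwall bounds the
  solution by the factor E. The replacement costs C \<epsilon> V, where V is the maximum of |v|;
  since E C \<epsilon> \<le> 1/2 this is absorbed on the left, which gives K = 2 E for all N and all
  coefficients obeying the bounds.\<close>

theorem nystrom_stability:
  assumes al: "0 < \<alpha>" and c: "0 \<le> c"
  obtains h0 K where "0 < h0" "0 \<le> K" "\<And>h N m p \<kappa> v r \<rho> i. 0 < h \<Longrightarrow> h \<le> h0 \<Longrightarrow>
    (\<And>j. norm (m j) \<le> c * bump \<alpha> (of_int j * h)) \<Longrightarrow> (\<And>j. norm (p j) \<le> c * bump \<alpha> (of_int j * h)) \<Longrightarrow>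
    (\<And>j l. norm (\<kappa> j l) \<le> c * bump \<alpha> (of_int l * h)) \<Longrightarrow>
    (\<And>i. i \<in> {- int N..int N} \<Longrightarrow> v i = r i + nystrom_op h N m p \<kappa> v i) \<Longrightarrow>
    (\<And>i. i \<in> {- int N..int N} \<Longrightarrow> norm (r i) \<le> \<rho>) \<Longrightarrow> i \<in> {- int N..int N} \<Longrightarrow> norm (v i) \<le> K * \<rho>"
proof -
  define q where "q = \<alpha> + 2"
  \<comment> \<open>Inserting the inner sum into the outer one, \<beta> collects the coefficients of
    the Gronwall sum and C those of \<epsilon> V; q bounds the total weight.\<close>
  define \<beta> where "\<beta> = c * (1 + c * q)"
  define C where "C = c * (1 + c * (q + 1)) + c * c * q"
  define E where "E = exp (\<beta> * q)"
  define \<epsilon> where "\<epsilon> = min 1 (1 / (2 * (E * C) + 1))"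
  have nn: "0 \<le> q" "0 \<le> \<beta>" "0 \<le> C" "0 < E" using al c by (simp_all add: q_def \<beta>_def C_def E_def)
  have EC: "0 \<le> E * C" using nn by simp
  have eps: "0 < \<epsilon>" "\<epsilon> \<le> 1" "E * C * \<epsilon> \<le> 1 / 2"
  proof -
    show "0 < \<epsilon>" "\<epsilon> \<le> 1" using EC by (simp_all add: \<epsilon>_def)
    have "E * C * \<epsilon> \<le> E * C * (1 / (2 * (E * C) + 1))" using EC by (intro mult_left_mono) (auto simp: \<epsilon>_def)
    also have "\<dots> \<le> 1 / 2" using EC by (simp add: field_simps)
    finally show "E * C * \<epsilon> \<le> 1 / 2" .
  qed
  obtain h0 where h0: "0 < h0" "h0 \<le> 1" and small: "\<And>h N i. 0 < h \<Longrightarrow> h \<le> h0 \<Longrightarrow>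
     (\<Sum>j = - int N..int N. h * bump \<alpha> (of_int j * h) * \<bar>step_defect (i - j)\<bar>) \<le> \<epsilon>"
    using weighted_defect_small[OF al eps(1)] by blast
  have bound: "norm (v i) \<le> 2 * E * \<rho>"
    if h: "0 < h" "h \<le> h0" and m: "\<And>j. norm (m j) \<le> c * bump \<alpha> (of_int j * h)"
      and p: "\<And>j. norm (p j) \<le> c * bump \<alpha> (of_int j * h)"
      and \<kappa>: "\<And>j l. norm (\<kappa> j l) \<le> c * bump \<alpha> (of_int l * h)"
      and v: "\<And>i. i\<in>{- int N..int N} \<Longrightarrow> v i = r i + nystrom_op h N m p \<kappa> v i"
      and r: "\<And>i. i\<in>{- int N..int N} \<Longrightarrow> norm (r i) \<le> \<rho>" and i: "i \<in> {- int N..int N}"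
    for h N m p \<kappa> v r \<rho> i
  proof -
    let ?I = "{- int N..int N}"
    define b where "b j = h * bump \<alpha> (of_int j * h)" for j :: int
    define A where "A i = (\<Sum>j = - int N..<i. b j * norm (v j))" for i
    define V where "V = Max ((\<lambda>i. norm (v i)) ` ?I)"
    have b0: "0 \<le> b j" for j using bump_pos[OF al, of "of_int j * h"] h by (simp add: b_def)
    have V: "norm (v j) \<le> V" if "j \<in> ?I" for j using that by (simp add: V_def)
    have V0: "0 \<le> V" using order_trans[OF norm_ge_zero V[OF i]] .
    have Q: "(\<Sum>j\<in>?I. b j) \<le> q"
      using sum_bump_le[OF al h(1)] h h0 by (simp add: b_def q_def)
    have Qi: "(\<Sum>j = - int N..<i. b j) \<le> q" if "i \<in> ?I" for i
      using that b0 by (intro order_trans[OF sum_mono2 Q]) auto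
    have S: "\<bar>step_fun k\<bar> \<le> (if 0 < k then 1 else 0) + \<bar>step_defect k\<bar>" for k
      unfolding step_defect_def by (simp split: if_split) arith
    have small': "(\<Sum>j\<in>?I. b j * \<bar>step_defect (i - j)\<bar>) \<le> \<epsilon>" for i
      using small[OF h] by (simp add: b_def)
    \<comment> \<open>The Heaviside part leaves the indices below i, the defect part at most
      \<epsilon> W. Used with w = |v| for the inner sum and w = |v| + |y| for the outer one.\<close>
    have split: "(\<Sum>j\<in>?I. b j * w j * \<bar>step_fun (i - j)\<bar>) \<le> (\<Sum>j = - int N..<i. b j * w j) + \<epsilon> * W"
      if w: "\<And>j. j \<in> ?I \<Longrightarrow> 0 \<le> w j \<and> w j \<le> W" and "0 \<le> W" and i: "i \<in> ?I" for w W i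
    proof -
      have "b j * w j * \<bar>step_fun (i - j)\<bar> \<le> (if j < i then b j * w j else 0) + b j * \<bar>step_defect (i - j)\<bar> * W" if j: "j \<in> ?I" for j
      proof -
        have "b j * w j * \<bar>step_fun (i - j)\<bar> \<le> b j * w j * ((if 0 < i - j then 1 else 0) + \<bar>step_defect (i - j)\<bar>)"
          using b0 w[OF j] by (intro mult_left_mono S) auto
        also have "\<dots> = (if j < i then b j * w j else 0) + b j * \<bar>step_defect (i - j)\<bar> * w j"
          by (simp add: algebra_simps)
        also have "\<dots> \<le> (if j < i then b j * w j else 0) + b j * \<bar>step_defect (i - j)\<bar> * W"
          using b0 w[OF j] by (intro add_left_mono mult_left_mono) auto
        finally show ?thesis .
      qed
      then have "(\<Sum>j\<in>?I. b j * w j * \<bar>step_fun (i - j)\<bar>) \<le> (\<Sum>j\<in>?I. (if j < i then b j * w j else 0) + b j * \<bar>step_defect (i - j)\<bar> * W)"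
        by (rule sum_mono)
      also have "\<dots> = (\<Sum>j\<in>?I. if j \<in> {- int N..<i} then b j * w j else 0) + (\<Sum>j\<in>?I. b j * \<bar>step_defect (i - j)\<bar>) * W"
        unfolding sum.distrib sum_distrib_right by (intro arg_cong2[where f = "(+)"] sum.cong) auto
      also have "(\<Sum>j\<in>?I. if j \<in> {- int N..<i} then b j * w j else 0) = (\<Sum>j\<in>?I \<inter> {- int N..<i}. b j * w j)"
        by (subst sum.inter_restrict) auto
      also have "?I \<inter> {- int N..<i} = {- int N..<i}" using i by auto
      also have "(\<Sum>j\<in>?I. b j * \<bar>step_defect (i - j)\<bar>) * W \<le> \<epsilon> * W"
        using \<open>0 \<le> W\<close> by (intro mult_right_mono small')
      finally show ?thesis by simp
    qed
    have A_mono: "A j \<le> A i" if "j \<le> i" for i j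
      unfolding A_def using b0 that by (intro sum_mono2) auto
    have A_le: "A i \<le> q * V" if "i \<in> ?I" for i
    proof -
      have "A i \<le> (\<Sum>j = - int N..<i. b j * V)"
        unfolding A_def using b0 that by (intro sum_mono mult_left_mono V) auto
      also have "\<dots> \<le> q * V" unfolding sum_distrib_right[symmetric] using V0 Qi[OF that] by (intro mult_right_mono)
      finally show ?thesis .
    qed
    define y where "y j = (\<Sum>l = - int N..int N. \<kappa> j l * v l * of_real (h * step_fun (j - l)))" for j
    have y: "norm (y j) \<le> c * A j + c * \<epsilon> * V" if j: "j \<in> ?I" for j
    proof -
      have "norm (y j) \<le> (\<Sum>l\<in>?I. c * (b l * norm (v l) * \<bar>step_fun (j - l)\<bar>))"
        unfolding y_def
      proof (rule sum_norm_le)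
        fix l
        have "norm (\<kappa> j l * v l * of_real (h * step_fun (j - l))) = norm (\<kappa> j l) * (norm (v l) * (h * \<bar>step_fun (j - l)\<bar>))"
          using h by (simp add: norm_mult abs_mult)
        also have "\<dots> \<le> (c * bump \<alpha> (of_int l * h)) * (norm (v l) * (h * \<bar>step_fun (j - l)\<bar>))"
          using h by (intro mult_right_mono \<kappa>) auto
        finally show "norm (\<kappa> j l * v l * of_real (h * step_fun (j - l))) \<le> c * (b l * norm (v l) * \<bar>step_fun (j - l)\<bar>)"
          by (simp add: b_def mult_ac)
      qed
      also have "\<dots> \<le> c * (A j + \<epsilon> * V)"
        unfolding sum_distrib_left[symmetric] A_def using c V V0 j by (intro mult_left_mono split) auto
      finally show ?thesis by (simp add: algebra_simps)
    qed
    have y': "norm (y j) \<le> c * (q + 1) * V" if j: "j \<in> ?I" for j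
    proof -
      have "c * A j + c * \<epsilon> * V \<le> c * (q * V) + c * 1 * V"
        using c eps V0 by (intro add_mono mult_left_mono A_le j mult_right_mono) auto
      with y[OF j] show ?thesis by (simp add: algebra_simps)
    qed
    define \<rho>' where "\<rho>' = \<rho> + C * \<epsilon> * V"
    have \<rho>0: "0 \<le> \<rho>" using order_trans[OF norm_ge_zero r[OF i]] .
    have \<rho>'0: "0 \<le> \<rho>'" using \<rho>0 nn eps V0 by (simp add: \<rho>'_def)
    have main: "norm (v i) \<le> \<rho>' + (\<Sum>j = - int N..<i. (\<beta> * b j) * norm (v j))" if i: "i \<in> ?I" for i
    proof -
      let ?w = "\<lambda>j. norm (v j) + norm (y j)"
      have "norm (nystrom_op h N m p \<kappa> v i) \<le> (\<Sum>j\<in>?I. c * (b j * ?w j * \<bar>step_fun (i - j)\<bar>))"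
        unfolding nystrom_op_def y_def[symmetric]
      proof (rule sum_norm_le)
        fix j
        have "norm (m j * v j + p j * y j) \<le> norm (m j) * norm (v j) + norm (p j) * norm (y j)"
          by (metis norm_mult norm_triangle_ineq)
        also have "\<dots> \<le> c * bump \<alpha> (of_int j * h) * norm (v j) + c * bump \<alpha> (of_int j * h) * norm (y j)"
          by (intro add_mono mult_right_mono m p) auto
        finally have le: "norm (m j * v j + p j * y j) \<le> c * bump \<alpha> (of_int j * h) * ?w j"
          by (simp add: distrib_left)
        have "norm ((m j * v j + p j * y j) * of_real (h * step_fun (i - j))) = norm (m j * v j + p j * y j) * (h * \<bar>step_fun (i - j)\<bar>)"
          using h by (simp add: norm_mult abs_mult)
        also have "\<dots> \<le> c * bump \<alpha> (of_int j * h) * ?w j * (h * \<bar>step_fun (i - j)\<bar>)"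
          using h by (intro mult_right_mono le) auto
        finally show "norm ((m j * v j + p j * y j) * of_real (h * step_fun (i - j))) \<le> c * (b j * ?w j * \<bar>step_fun (i - j)\<bar>)"
          by (simp add: b_def mult_ac)
      qed
      also have "\<dots> \<le> c * ((\<Sum>j = - int N..<i. b j * ?w j) + \<epsilon> * (V + c * (q + 1) * V))"
      proof -
        have W: "0 \<le> V + c * (q + 1) * V" using c nn V0 by simp
        have w: "0 \<le> ?w j \<and> ?w j \<le> V + c * (q + 1) * V" if "j \<in> ?I" for j
          using add_mono[OF V[OF that] y'[OF that]] by simp
        show ?thesis
          unfolding sum_distrib_left[symmetric] using c by (intro mult_left_mono split[OF w W i]) auto
      qed
      also have "(\<Sum>j = - int N..<i. b j * ?w j) \<le> A i + q * (c * A i + c * \<epsilon> * V)"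
      proof -
        have A0: "0 \<le> A i" unfolding A_def using b0 by (intro sum_nonneg) auto
        have "(\<Sum>j = - int N..<i. b j * ?w j) = A i + (\<Sum>j = - int N..<i. b j * norm (y j))"
          by (simp add: A_def distrib_left sum.distrib)
        also have "(\<Sum>j = - int N..<i. b j * norm (y j)) \<le> (\<Sum>j = - int N..<i. b j * (c * A i + c * \<epsilon> * V))"
        proof (intro sum_mono mult_left_mono b0)
          fix j assume j: "j \<in> {- int N..<i}"
          then have "j \<in> ?I" using i by auto
          from y[OF this] mult_left_mono[OF A_mono[of j i] c] j
          show "norm (y j) \<le> c * A i + c * \<epsilon> * V" by simp
        qed
        also have "\<dots> \<le> q * (c * A i + c * \<epsilon> * V)"
          unfolding sum_distrib_right[symmetric] using c eps V0 A0 by (intro mult_right_mono Qi i) auto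
        finally show ?thesis by simp
      qed
      also have "c * (A i + q * (c * A i + c * \<epsilon> * V) + \<epsilon> * (V + c * (q + 1) * V)) = C * \<epsilon> * V + \<beta> * A i"
        by (simp add: C_def \<beta>_def algebra_simps)
      finally have "norm (nystrom_op h N m p \<kappa> v i) \<le> C * \<epsilon> * V + \<beta> * A i"
        using c by (simp add: mult_left_mono)
      moreover have "norm (v i) \<le> norm (r i) + norm (nystrom_op h N m p \<kappa> v i)"
        by (subst v[OF i]) (rule norm_triangle_ineq)
      moreover have "(\<Sum>j = - int N..<i. (\<beta> * b j) * norm (v j)) = \<beta> * A i"
        by (simp add: A_def sum_distrib_left mult.assoc)
      ultimately show ?thesis using r[OF i] by (simp add: \<rho>'_def)
    qed
    have bd: "norm (v i) \<le> \<rho>' * E" if i: "i \<in> ?I" for i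
    proof -
      have "norm (v i) \<le> \<rho>' * exp (\<Sum>j = - int N..<i. \<beta> * b j)"
        using nn b0 \<rho>'0 i by (intro gronwall_int[of "- int N" "int N"] main) auto
      also have "\<dots> \<le> \<rho>' * E"
        unfolding E_def sum_distrib_left[symmetric]
        using nn \<rho>'0 Qi[OF i] by (intro mult_left_mono) (auto intro: mult_left_mono)
      finally show ?thesis .
    qed
    have "V \<le> \<rho>' * E" unfolding V_def using bd i by (subst Max_le_iff) auto
    also have "\<dots> = E * \<rho> + (E * C * \<epsilon>) * V" by (simp add: \<rho>'_def algebra_simps)
    also have "\<dots> \<le> E * \<rho> + 1 / 2 * V" using eps V0 by (intro add_left_mono mult_right_mono)
    finally have "V \<le> 2 * E * \<rho>" by simp
    with V[OF i] show ?thesis by simp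
  qed
  show thesis
  proof (rule that[OF h0(1), of "2 * E"])
    show "0 \<le> 2 * E" using nn by simp
  qed (rule bound, assumption+)
qed

section \<open>The SE transformation\<close>

text \<open>Because tanh (x / 2) = 2 logistic 1 x - 1. The Jacobian is therefore (b - a) times the
  weight of rate 1.\<close>

lemma psi_SE_real_eq: "psi_SE a b (x::real) = a + (b - a) * logistic 1 x"
proof -
  have "1 + exp (- x) \<noteq> 0" by (smt (verit) exp_gt_zero)
  then show ?thesis by (simp add: psi_SE_def tanh_real_altdef logistic_def field_simps)
qed

lemma psi_SE_of_real: "psi_SE a b (complex_of_real x) = of_real (psi_SE a b x)"
proof -
  have "sinh (complex_of_real y) = of_real (sinh y)" "cosh (complex_of_real y) = of_real (cosh y)" for y
    by (simp_all add: sinh_def cosh_def exp_of_real scaleR_conv_of_real flip: of_real_minus)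
  from this[of "x / 2"] show ?thesis by (simp add: psi_SE_def tanh_def)
qed

lemma DERIV_psi_SE_real: "(psi_SE a b has_real_derivative (b - a) * bump 1 x) (at x)"
  unfolding psi_SE_real_eq[abs_def] by (auto intro!: derivative_eq_intros DERIV_logistic)

lemma dpsi_SE_eq: "dpsi_SE a b h j = (b - a) * bump 1 (of_int j * h)"
  unfolding dpsi_SE_def by (rule DERIV_imp_deriv[OF DERIV_psi_SE_real])

lemma logistic_inverse:
  assumes "0 < y" "y < 1" shows "logistic 1 (ln (y / (1 - y))) = y"
proof -
  have "exp (- ln (y / (1 - y))) = (1 - y) / y" using assms by (simp add: exp_minus)
  then show ?thesis unfolding logistic_def mult_1 using assms by (simp only:) (simp add: field_simps)
qed

lemma psi_SE_inverse:
  assumes "a < t" "t < b" shows "psi_SE a b (ln ((t - a) / (b - t))) = t"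
proof -
  define y where "y = (t - a) / (b - a)"
  have y: "0 < y" "y < 1" using assms by (simp_all add: y_def)
  have "b - a \<noteq> 0" using assms by simp
  then have "1 - y = (b - t) / (b - a)" by (simp add: y_def diff_divide_eq_iff)
  then have "y / (1 - y) = (t - a) / (b - t)" using \<open>b - a \<noteq> 0\<close> by (simp add: y_def)
  with logistic_inverse[OF y] have "logistic 1 (ln ((t - a) / (b - t))) = y" by simp
  moreover have "(b - a) * y = t - a" using assms by (simp add: y_def)
  ultimately show ?thesis by (simp add: psi_SE_real_eq)
qed

lemma strict_mono_psi_SE: "a < b \<Longrightarrow> strict_mono (psi_SE a b :: real \<Rightarrow> real)"
  by (rule strict_monoI, rule DERIV_pos_imp_increasing) (auto intro!: exI DERIV_psi_SE_real simp: bump_pos)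

lemma psi_SE_bounds: "a < b \<Longrightarrow> a < psi_SE a b (x::real) \<and> psi_SE a b x < b"
proof -
  assume "a < b"
  then have "0 < (b - a) * logistic 1 x" "(b - a) * logistic 1 x < (b - a) * 1"
    using logistic_pos[of 1 x] logistic_less_1[of 1 x] by (auto intro: mult_strict_left_mono)
  then show ?thesis by (simp add: psi_SE_real_eq)
qed

lemma inv_psi_SE: "a < b \<Longrightarrow> inv_into UNIV (psi_SE a b) (psi_SE a b (x::real)) = x"
  by (simp add: strict_mono_psi_SE inv_f_f strict_mono_imp_inj_on)

lemma inv_psi_SE_eq: "a < t \<Longrightarrow> t < b \<Longrightarrow> inv_into UNIV (psi_SE a b) t = ln ((t - a) / (b - t))"
  using inv_psi_SE[of a b "ln ((t - a) / (b - t))"] psi_SE_inverse[of a t b] by simp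

lemma filterlim_inv_psi_SE_left_end:
  assumes "a < b" shows "filterlim (inv_into UNIV (psi_SE a b :: real \<Rightarrow> real)) at_bot (at_right a)"
proof (rule filterlim_mono_eventually[OF _ order_refl order_refl])
  show "filterlim (\<lambda>t. ln ((t - a) / (b - t))) at_bot (at_right a)"
    using assms by real_asymp
  show "\<forall>\<^sub>F t in at_right a. ln ((t - a) / (b - t)) = inv_into UNIV (psi_SE a b) t"
    using eventually_at_right_real[OF assms] by eventually_elim (simp add: inv_psi_SE_eq)
qed

lemma filterlim_inv_psi_SE_right_end:
  assumes "a < b" shows "filterlim (inv_into UNIV (psi_SE a b :: real \<Rightarrow> real)) at_top (at_left b)"
proof (rule filterlim_mono_eventually[OF _ order_refl order_refl])
  show "filterlim (\<lambda>t. ln ((t - a) / (b - t))) at_top (at_left b)"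
    using assms by real_asymp
  show "\<forall>\<^sub>F t in at_left b. ln ((t - a) / (b - t)) = inv_into UNIV (psi_SE a b) t"
    using eventually_at_left_real[OF assms] by eventually_elim (simp add: inv_psi_SE_eq)
qed

lemma tendsto_J_SE_at_top:
  assumes "0 < h" shows "(J_SE j h \<longlongrightarrow> h) at_top"
proof -
  have "filterlim (\<lambda>x. pi * (x / h - of_int j)) at_top at_top" using assms by real_asymp
  from filterlim_compose[OF Si_at_top this]
  have "((\<lambda>x. h * (1 / 2 + 1 / pi * Si (pi * (x / h - of_int j)))) \<longlongrightarrow> h * (1 / 2 + 1 / pi * (pi / 2))) at_top"
    by (intro tendsto_intros)
  then show ?thesis by (simp add: J_SE_def[abs_def])
qed

lemma w_SE_psi: 
  assumes "a < b" shows "w_SE a b h j (psi_SE a b x) = dpsi_SE a b h j * J_SE j h x"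
  using psi_SE_bounds[OF assms, of x] inv_psi_SE[OF assms, of x]
  by (simp add: w_SE_def w_SE_open_def)

text \<open>The \<open>Lim\<close> in \<open>w_SE\<close> is a genuine limit, since
  \<open>J_SE\<close> tends to 0 and to h at the two ends of the real line. This lets the error
  bound pass from the open interval to its end points.\<close>

lemma w_SE_tendsto:
  assumes "a < b" "0 < h"
  shows w_SE_left_end: "(w_SE a b h j \<longlongrightarrow> w_SE a b h j a) (at_right a)"
    and w_SE_right_end: "(w_SE a b h j \<longlongrightarrow> w_SE a b h j b) (at_left b)"
proof -
  have 1: "(w_SE_open a b h j \<longlongrightarrow> dpsi_SE a b h j * 0) (at_right a)"
    unfolding w_SE_open_def
    by (intro tendsto_mult tendsto_const filterlim_compose[OF tendsto_J_SE_at_bot[OF assms(2)] filterlim_inv_psi_SE_left_end[OF assms(1)]])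
  have 2: "(w_SE_open a b h j \<longlongrightarrow> dpsi_SE a b h j * h) (at_left b)"
    unfolding w_SE_open_def
    by (intro tendsto_mult tendsto_const filterlim_compose[OF tendsto_J_SE_at_top[OF assms(2)] filterlim_inv_psi_SE_right_end[OF assms(1)]])
  have e1: "\<forall>\<^sub>F t in at_right a. w_SE_open a b h j t = w_SE a b h j t"
    using eventually_at_right_real[OF assms(1)] by eventually_elim (simp add: w_SE_def)
  have e2: "\<forall>\<^sub>F t in at_left b. w_SE_open a b h j t = w_SE a b h j t"
    using eventually_at_left_real[OF assms(1)] by eventually_elim (simp add: w_SE_def)
  have "w_SE a b h j a = dpsi_SE a b h j * 0"
    using tendsto_Lim[OF _ 1] by (simp add: w_SE_def)
  with 1 e1 show "(w_SE a b h j \<longlongrightarrow> w_SE a b h j a) (at_right a)"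
    using Lim_transform_eventually[OF 1 e1] by simp
  have "w_SE a b h j b = dpsi_SE a b h j * h"
    using tendsto_Lim[OF _ 2] assms(1) by (simp add: w_SE_def)
  with 2 e2 show "(w_SE a b h j \<longlongrightarrow> w_SE a b h j b) (at_left b)"
    using Lim_transform_eventually[OF 2 e2] by simp
qed

section \<open>Decay and derivative of the transformation on the strip\<close>

lemma cosh_half_lower_bound:
  assumes "z \<in> strip d" "d < pi"
  shows "cos (d / 2) * exp (\<bar>Re z\<bar> / 2) / 2 \<le> norm (cosh (z / 2))"
\<comment> \<open>With z / 2 = x + i y: |cosh|^2 = cos^2 y + sinh^2 x \<ge> cos^2 (d / 2) cosh^2 x,
  and cosh^2 x \<ge> exp (2 |x|) / 4. The condition d < pi keeps |y| below pi / 2.\<close>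
proof (rule power2_le_imp_le)
  define x y where "x = Re z / 2" and "y = Im z / 2"
  have y: "\<bar>y\<bar> < d / 2" using assms by (simp add: strip_def y_def)
  have cd: "0 \<le> cos (d / 2)" using assms y by (intro cos_ge_zero) auto
  have cy: "cos (d / 2) \<le> cos y"
    using cos_monotone_0_pi_le[of "\<bar>y\<bar>" "d / 2"] y assms by simp
  have "(norm (cosh (z / 2)))\<^sup>2 = (cos y)\<^sup>2 + (exp x - inverse (exp x))\<^sup>2 / 4"
    unfolding cosh_conv_cos norm_cos_squared by (simp add: x_def y_def)
  moreover have "(cos (d / 2))\<^sup>2 \<le> (cos y)\<^sup>2" using cy cd by (intro power_mono) auto
  moreover have "(cos (d / 2))\<^sup>2 * ((exp x - inverse (exp x))\<^sup>2 / 4) \<le> 1 * ((exp x - inverse (exp x))\<^sup>2 / 4)"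
    by (intro mult_right_mono) (auto simp: abs_square_le_1)
  moreover have "(cos (d / 2))\<^sup>2 * ((exp \<bar>x\<bar>)\<^sup>2 / 4) \<le> (cos (d / 2))\<^sup>2 * (1 + (exp x - inverse (exp x))\<^sup>2 / 4)"
  proof (rule mult_left_mono)
    have "1 + (e - i)\<^sup>2 / 4 = (e\<^sup>2 + i\<^sup>2 + 2) / 4" if "e * i = 1" for e i :: real
      by (simp only: power2_diff mult.assoc that) (simp add: field_simps)
    then have "1 + (exp x - inverse (exp x))\<^sup>2 / 4 = ((exp x)\<^sup>2 + (inverse (exp x))\<^sup>2 + 2) / 4"
      by simp
    moreover have "(exp \<bar>x\<bar>)\<^sup>2 \<le> (exp x)\<^sup>2 + (inverse (exp x))\<^sup>2"
      by (cases "0 \<le> x") (simp_all add: exp_minus)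
    ultimately show "(exp \<bar>x\<bar>)\<^sup>2 / 4 \<le> 1 + (exp x - inverse (exp x))\<^sup>2 / 4" by simp
  qed simp
  ultimately show "(cos (d / 2) * exp (\<bar>Re z\<bar> / 2) / 2)\<^sup>2 \<le> (norm (cosh (z / 2)))\<^sup>2"
    by (simp add: x_def power_mult_distrib power_divide distrib_left)
qed simp

lemma cosh_half_nonzero:
  assumes "z \<in> strip d" "d < pi" shows "cosh (z / 2) \<noteq> 0"
proof -
  have "0 \<le> d" "0 < cos (d / 2)"
    using assms by (auto simp: strip_def intro!: cos_gt_zero_pi)
  then show ?thesis using cosh_half_lower_bound[OF assms] by (auto simp: mult_le_0_iff)
qed

lemma one_minus_tanh_squared:
  fixes w :: complex
  assumes "cosh w \<noteq> 0" shows "1 - (tanh w)\<^sup>2 = 1 / (cosh w)\<^sup>2"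
proof -
  have "1 - (tanh w)\<^sup>2 = ((cosh w)\<^sup>2 - (sinh w)\<^sup>2) / (cosh w)\<^sup>2"
    using assms by (simp add: tanh_def power_divide diff_divide_distrib)
  then show ?thesis by (simp add: cosh_square_eq)
qed

lemma Q_psi_SE:
  assumes "z \<in> strip d" "d < pi"
  shows "Q a b (psi_SE a b z) = (of_real ((b - a) / 2))\<^sup>2 / (cosh (z / 2))\<^sup>2"
proof -
  define T where "T = tanh (z / 2)"
  have "1 - T\<^sup>2 = 1 / (cosh (z / 2))\<^sup>2"
    unfolding T_def by (rule one_minus_tanh_squared[OF cosh_half_nonzero[OF assms]])
  moreover have "Q a b (psi_SE a b z) = (of_real ((b - a) / 2))\<^sup>2 * (1 - T\<^sup>2)"
    by (simp add: Q_def psi_SE_def T_def[symmetric] field_simps power2_eq_square)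
  ultimately show ?thesis by simp
qed

lemma DERIV_psi_SE:
  assumes "a < b" "z \<in> strip d" "d < pi"
  shows "(psi_SE a b has_field_derivative Q a b (psi_SE a b z) / of_real (b - a)) (at z)"
proof -
  have nz: "cosh (z / 2) \<noteq> 0" by (rule cosh_half_nonzero[OF assms(2,3)])
  have "(psi_SE a b has_field_derivative of_real ((b - a) / 2) * ((1 - tanh (z / 2) ^ 2) * (1 / 2))) (at z)"
    unfolding psi_SE_def[abs_def] using nz by (auto intro!: derivative_eq_intros)
  also have "of_real ((b - a) / 2) * ((1 - tanh (z / 2) ^ 2) * (1 / 2)) = Q a b (psi_SE a b z) / of_real (b - a)"
  proof -
    have "B / 2 * (1 / C * (1 / 2)) = (B / 2)\<^sup>2 / C / B" if "B \<noteq> 0" for B C :: complex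
      using that by (simp add: power2_eq_square)
    from this[of "of_real (b - a)"] show ?thesis
      unfolding Q_psi_SE[OF assms(2,3)] one_minus_tanh_squared[OF nz] using assms(1) by simp
  qed
  finally show ?thesis .
qed

definition Q_const :: "real \<Rightarrow> real \<Rightarrow> real \<Rightarrow> real" where
  "Q_const a b d = ((b - a) / cos (d / 2))\<^sup>2"

lemma norm_Q_psi_SE_le:
  assumes "z \<in> strip d" "d < pi"
  shows "norm (Q a b (psi_SE a b z)) \<le> Q_const a b d * exp (- \<bar>Re z\<bar>)"
proof -
  have cd: "0 < cos (d / 2)"
    using assms by (auto simp: strip_def intro!: cos_gt_zero_pi)
  have "norm (Q a b (psi_SE a b z)) = ((b - a) / 2)\<^sup>2 / (norm (cosh (z / 2)))\<^sup>2"
    unfolding Q_psi_SE[OF assms] by (simp add: norm_divide norm_power power_divide del: of_real_diff of_real_divide)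
  also have "\<dots> \<le> ((b - a) / 2)\<^sup>2 / (cos (d / 2) * exp (\<bar>Re z\<bar> / 2) / 2)\<^sup>2"
    using cd cosh_half_nonzero[OF assms]
    by (intro divide_left_mono power_mono cosh_half_lower_bound[OF assms]) auto
  also have "(cos (d / 2) * exp (\<bar>Re z\<bar> / 2) / 2)\<^sup>2 = (cos (d / 2))\<^sup>2 * exp \<bar>Re z\<bar> / 4"
    by (simp add: power_mult_distrib power_divide exp_double[symmetric])
  also have "((b - a) / 2)\<^sup>2 / ((cos (d / 2))\<^sup>2 * exp \<bar>Re z\<bar> / 4) = Q_const a b d * exp (- \<bar>Re z\<bar>)"
    using cd by (simp add: Q_const_def power_divide exp_minus field_simps)
  finally show ?thesis .
qed

lemma norm_Q_psi_SE_powr_le: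
  assumes "z \<in> strip d" "d < pi" "0 < \<alpha>"
  shows "norm (Q a b (psi_SE a b z)) powr \<alpha> \<le> Q_const a b d powr \<alpha> * (4 / \<alpha>) * bump \<alpha> (Re z)"
proof -
  have "norm (Q a b (psi_SE a b z)) powr \<alpha> \<le> (Q_const a b d * exp (- \<bar>Re z\<bar>)) powr \<alpha>"
    using assms by (intro powr_mono2 norm_Q_psi_SE_le) auto
  also have "\<dots> = Q_const a b d powr \<alpha> * exp (- (\<alpha> * \<bar>Re z\<bar>))"
  proof -
    have "(Q_const a b d * exp (- \<bar>Re z\<bar>)) powr \<alpha> = Q_const a b d powr \<alpha> * exp (- \<bar>Re z\<bar>) powr \<alpha>"
      by (rule powr_mult)
    also have "exp (- \<bar>Re z\<bar>) powr \<alpha> = exp (- (\<alpha> * \<bar>Re z\<bar>))" by (simp add: powr_def)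
    finally show ?thesis .
  qed
  also have "\<dots> \<le> Q_const a b d powr \<alpha> * (4 / \<alpha> * bump \<alpha> (Re z))"
    using assms by (intro mult_left_mono exp_le_bump) auto
  finally show ?thesis by simp
qed

text \<open>The bare Jacobian decays like exp (- |Re z|). This is where \<alpha> \<le> 1 enters: it
  lets this decay be weakened to the common rate \<alpha>.\<close>

lemma norm_Q_psi_SE_bump:
  assumes "z \<in> strip d" "d < pi" "0 < \<alpha>" "\<alpha> \<le> 1"
  shows "norm (Q a b (psi_SE a b z)) \<le> Q_const a b d * (4 / \<alpha>) * bump \<alpha> (Re z)"
proof -
  have Qc: "0 \<le> Q_const a b d" by (simp add: Q_const_def)
  have "norm (Q a b (psi_SE a b z)) \<le> Q_const a b d * exp (- \<bar>Re z\<bar>)"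
    by (rule norm_Q_psi_SE_le[OF assms(1,2)])
  also have "\<dots> \<le> Q_const a b d * exp (- (\<alpha> * \<bar>Re z\<bar>))"
    using Qc assms(4) by (intro mult_left_mono) (auto simp: mult_left_le_one_le assms(3) less_imp_le)
  also have "\<dots> \<le> Q_const a b d * (4 / \<alpha> * bump \<alpha> (Re z))"
    using Qc assms by (intro mult_left_mono exp_le_bump) auto
  finally show ?thesis by simp
qed

lemma holomorphic_pullback:
  assumes "a < b" "d < pi" "f analytic_on psi_SE a b ` strip d"
  shows "(\<lambda>z. f (psi_SE a b z) / of_real (b - a)) holomorphic_on strip d"
proof -
  have "psi_SE a b analytic_on strip d"
    unfolding analytic_on_open[OF open_strip] holomorphic_on_open[OF open_strip]
    using DERIV_psi_SE[OF assms(1) _ assms(2)] by blast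
  from analytic_on_compose[OF this assms(3)]
  have "(f \<circ> psi_SE a b) holomorphic_on strip d" by (rule analytic_imp_holomorphic)
  then show ?thesis using assms(1) by (intro holomorphic_intros) (auto simp: o_def)
qed

text \<open>Integrals over \<open>{a..\<psi>(x)}\<close> of possibly singular integrands are read off from primitives in the
  variable of the strip, which avoids any separate integrability argument.\<close>

lemma has_integral_pullback:
  fixes f :: "real \<Rightarrow> complex"
  assumes ab: "a < b"
    and H: "\<And>y. (H has_vector_derivative f (psi_SE a b y) * of_real ((b - a) * bump 1 y)) (at y)"
    and H0: "(H \<longlongrightarrow> 0) at_bot"
  shows "(f has_integral H x) {a..psi_SE a b x}"
proof -
  let ?inv = "inv_into UNIV (psi_SE a b :: real \<Rightarrow> real)"
  \<comment> \<open>The value 0 at a is the limit of H, so F is continuous up to a; the interior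
    form of the fundamental theorem asks for the derivative in the open interval only.\<close>
  define F where "F t = (if t = a then 0 else H (?inv t))" for t
  have der: "(F has_vector_derivative f t) (at t)" if t: "a < t" "t < b" for t
  proof -
    define y where "y = ?inv t"
    have ty: "t = psi_SE a b y" using psi_SE_inverse[OF t] inv_psi_SE_eq[OF t] by (simp add: y_def)
    define D where "D = (b - a) * bump 1 y"
    have D: "0 < D" using ab by (simp add: D_def bump_pos)
    have dinv: "(?inv has_real_derivative inverse D) (at t)"
    proof (rule DERIV_inverse_function)
      show "(psi_SE a b has_real_derivative D) (at (?inv t))"
        using DERIV_psi_SE_real[of a b y] by (simp add: D_def y_def)
      show "psi_SE a b (?inv s) = s" if "a < s" "s < b" for s
        using psi_SE_inverse[OF that] inv_psi_SE_eq[OF that] by simp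
      have "\<forall>\<^sub>F s in nhds t. ln ((s - a) / (b - s)) = ?inv s"
        using eventually_nhds_in_open[of "{a<..<b}" t] t
        by (auto elim!: eventually_mono simp: inv_psi_SE_eq)
      moreover have "isCont (\<lambda>s. ln ((s - a) / (b - s))) t"
        using t by (intro continuous_intros) auto
      ultimately show "isCont ?inv t" using isCont_cong by fastforce
    qed (use D t in auto)
    have "((\<lambda>s. H (?inv s)) has_vector_derivative inverse D *\<^sub>R (f t * of_real D)) (at t)"
      using vector_diff_chain_at[of ?inv "inverse D" t H] H[of y] dinv
      by (simp add: o_def has_real_derivative_iff_has_vector_derivative ty[symmetric] y_def[symmetric] D_def)
    moreover have "inverse D *\<^sub>R (f t * of_real D) = f t" using D by (simp add: scaleR_conv_of_real)
    ultimately have "((\<lambda>s. H (?inv s)) has_vector_derivative f t) (at t)" by simp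
    then show ?thesis
    proof (rule has_vector_derivative_transform_within_open)
      show "H (?inv s) = F s" if "s \<in> {a<..<b}" for s using that by (simp add: F_def)
    qed (use t in auto)
  qed
  have cont: "continuous_on {a..psi_SE a b x} F"
    unfolding continuous_on_eq_continuous_within
  proof
    fix t assume t: "t \<in> {a..psi_SE a b x}"
    show "continuous (at t within {a..psi_SE a b x}) F"
    proof (cases "t = a")
      case True
      have "((\<lambda>s. H (?inv s)) \<longlongrightarrow> 0) (at_right a)"
        by (rule filterlim_compose[OF H0 filterlim_inv_psi_SE_left_end[OF ab]])
      moreover have "\<forall>\<^sub>F s in at_right a. H (?inv s) = F s"
        using eventually_at_right_less by eventually_elim (simp add: F_def)
      ultimately have "(F \<longlongrightarrow> F a) (at_right a)"
        by (simp add: F_def Lim_transform_eventually)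
      moreover have "at a within {a..psi_SE a b x} = at_right a"
        using psi_SE_bounds[OF ab, of x] by (simp add: at_within_Icc_at_right)
      ultimately show ?thesis using True by (simp add: continuous_within)
    next
      case False
      with t have "a < t" "t < b" using psi_SE_bounds[OF ab, of x] by auto
      then show ?thesis
        using der has_vector_derivative_continuous continuous_at_imp_continuous_at_within by blast
    qed
  qed
  have "(f has_integral F (psi_SE a b x) - F a) {a..psi_SE a b x}"
  proof (rule fundamental_theorem_of_calculus_interior[OF _ cont])
    show "a \<le> psi_SE a b x" using psi_SE_bounds[OF ab, of x] by simp
    show "(F has_vector_derivative f t) (at t)" if "t \<in> {a<..<psi_SE a b x}" for t
      using that psi_SE_bounds[OF ab, of x] by (intro der) auto
  qed
  then show ?thesis using psi_SE_bounds[OF ab, of x] inv_psi_SE[OF ab, of x] by (simp add: F_def)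
qed

section \<open>Identification of the given solution with the holomorphic one\<close>

context volterra_strip
begin

text \<open>The given solution lives on the reals and is merely bounded, so it is compared with U
  there. The contraction applies to their difference itself and halves its weighted bound
  indefinitely.\<close>

lemma solution_unique_on_reals:
  assumes pic: "picard U \<Phi> U" and B: "\<And>z. z \<in> strip d \<Longrightarrow> norm (U z) \<le> B"
    and v: "\<And>x. (v has_vector_derivative G (of_real x) + m (of_real x) * v x + p (of_real x) * H x x) (at x)"
    and v0: "(v \<longlongrightarrow> ua) at_bot" and B': "\<And>x. norm (v x) \<le> B'"
    and H: "\<And>x y. (H x has_vector_derivative \<kappa> (of_real x) (of_real y) * v y) (at y)"
    and H0: "\<And>x. (H x \<longlongrightarrow> 0) at_bot"
  shows "v x = U (of_real x)"
proof -
  have z: "complex_of_real x \<in> strip d" for x using d_pos by (simp add: strip_def)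
  have hv: "((\<lambda>x. P (of_real x)) has_vector_derivative F (of_real x)) (at x)" and lim: "((\<lambda>x. P (of_real x)) \<longlongrightarrow> l) at_bot"
    if "bot_prim d l F P" for l F P x
  proof -
    have "(P has_field_derivative F (Complex x 0)) (at (Complex x 0))"
      using that z[of x] by (simp add: bot_prim_def complex_of_real_def)
    from has_vector_derivative_horizontal[OF this]
    show "((\<lambda>x. P (of_real x)) has_vector_derivative F (of_real x)) (at x)"
      by (simp add: complex_of_real_def)
    show "((\<lambda>x. P (of_real x)) \<longlongrightarrow> l) at_bot"
      using that d_pos by (auto simp: bot_prim_def complex_of_real_def)
  qed
  define M where "M = B + B'"
  define e where "e x = U (of_real x) - v x" for x
  have M0: "norm (e x) \<le> M" for x
    using norm_triangle_ineq4[of "U (of_real x)" "v x"] B[OF z[of x]] B'[of x] by (simp add: M_def e_def)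
  have "norm (e x) \<le> M / 2 ^ n * exp (rate * logistic \<alpha> x)" for n x
  proof (induction n arbitrary: x)
    case 0
    have "0 \<le> M" using order_trans[OF norm_ge_zero M0] .
    moreover have "1 \<le> exp (rate * logistic \<alpha> x)" using rate_ge logistic_pos[of \<alpha> x] by simp
    ultimately have "M * 1 \<le> M * exp (rate * logistic \<alpha> x)" by (intro mult_left_mono)
    with M0[of x] show ?case by simp
  next
    case (Suc n)
    have "norm (e x) \<le> M / 2 ^ n / 2 * exp (rate * logistic \<alpha> x)"
    proof (rule volterra_line_contraction[OF alpha_pos c_nonneg rate_def, where
        e = e and m = "\<lambda>x. m (of_real x)" and p = "\<lambda>x. p (of_real x)"
        and K = "\<lambda>x y. \<Phi> (of_real x) (of_real y) - H x y" and kk = "\<lambda>x y. \<kappa> (of_real x) (of_real y)"])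
      have "bot_prim d ua (\<lambda>\<sigma>. G \<sigma> + m \<sigma> * U \<sigma> + p \<sigma> * \<Phi> \<sigma> \<sigma>) U" using pic by (simp add: picard_def)
      note Uh = hv[OF this] and Ul = lim[OF this]
      show "(e has_vector_derivative m (of_real x) * e x + p (of_real x) * (\<Phi> (of_real x) (of_real x) - H x x)) (at x)" for x
        using has_vector_derivative_diff[OF Uh v, of x] by (simp add: e_def[abs_def] algebra_simps)
      show "(e \<longlongrightarrow> 0) at_bot" using tendsto_diff[OF Ul v0] by (simp add: e_def[abs_def])
      fix x y
      have "bot_prim d 0 (\<lambda>\<rho>. \<kappa> (of_real x) \<rho> * U \<rho>) (\<Phi> (of_real x))" using pic z by (simp add: picard_def)
      note Ph = hv[OF this] and Pl = lim[OF this]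
      show "((\<lambda>y. \<Phi> (of_real x) (of_real y) - H x y) has_vector_derivative \<kappa> (of_real x) (of_real y) * e y) (at y)"
        using has_vector_derivative_diff[OF Ph H[of x], of y] by (simp add: e_def algebra_simps)
      show "((\<lambda>y. \<Phi> (of_real x) (of_real y) - H x y) \<longlongrightarrow> 0) at_bot"
        using tendsto_diff[OF Pl H0[of x]] by simp
    qed (use Suc.IH m_bound[OF z] p_bound[OF z] kernel_bound[OF z z] in simp_all)
    then show ?case by (simp add: field_simps)
  qed
  moreover have "(\<lambda>n. M / 2 ^ n * exp (rate * logistic \<alpha> x)) \<longlonglongrightarrow> 0" by real_asymp
  ultimately have "norm (e x) \<le> 0" using LIMSEQ_le_const by blast
  then show ?thesis by (simp add: e_def)
qed

end

lemma Q_psi_SE_of_real: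
  assumes "a < b"
  shows "Q a b (psi_SE a b (of_real x)) / of_real (b - a) = of_real ((b - a) * bump 1 x)"
proof -
  have "Q a b (of_real t) = of_real ((t - a) * (b - t))" for t by (simp add: Q_def)
  then have "Q a b (psi_SE a b (of_real x)) = of_real ((psi_SE a b x - a) * (b - psi_SE a b x))"
    by (simp only: psi_SE_of_real)
  also have "(psi_SE a b x - a) * (b - psi_SE a b x) = (b - a) * ((b - a) * bump 1 x)"
    by (simp add: psi_SE_real_eq bump_def algebra_simps)
  finally show ?thesis using assms by simp
qed

text \<open>\<open>k_L\<close> provides a constant for each z separately, while the kernel bound
  needs one for all z; \<open>k_L_uniform\<close> supplies it. In the proof T converts powers of |Q|
  into \<open>bump\<close>, S bounds the bare Jacobian, and c dominates all four
  coefficients.\<close>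

lemma ex_volterra_strip:
  assumes ab: "a < b" and al: "0 < \<alpha>" "\<alpha> \<le> 1" and d: "0 < d" "d < pi"
    and D: "D = psi_SE a b ` strip d"
    and g: "(\<lambda>z. g z * Q a b z) \<in> L_class a b \<alpha> D"
    and mu: "(\<lambda>z. \<mu> z * Q a b z) \<in> L_class a b \<alpha> D"
    and k_L: "\<forall>z\<in>D. (\<lambda>w. k z w * Q a b w) \<in> L_class a b \<alpha> D"
    and k_L_uniform: "\<exists>K. \<forall>z\<in>D. \<forall>w\<in>D. norm (k z w * Q a b w) \<le> K * norm (Q a b w) powr \<alpha>"
    and k_H: "\<forall>w\<in>D. (\<lambda>z. k z w * Q a b w) \<in> H_inf D"
  shows "\<exists>c. volterra_strip \<alpha> d c (\<lambda>z w. k (psi_SE a b z) (psi_SE a b w) * Q a b (psi_SE a b w) / of_real (b - a))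
    (\<lambda>z. g (psi_SE a b z) * Q a b (psi_SE a b z) / of_real (b - a))
    (\<lambda>z. \<mu> (psi_SE a b z) * Q a b (psi_SE a b z) / of_real (b - a))
    (\<lambda>z. Q a b (psi_SE a b z) / of_real (b - a))"
proof -
  obtain Kg where Kg: "\<And>z. z \<in> D \<Longrightarrow> norm (g z * Q a b z) \<le> Kg * norm (Q a b z) powr \<alpha>"
    using g by (auto simp: L_class_def)
  obtain Km where Km: "\<And>z. z \<in> D \<Longrightarrow> norm (\<mu> z * Q a b z) \<le> Km * norm (Q a b z) powr \<alpha>"
    using mu by (auto simp: L_class_def)
  obtain Kk where Kk: "\<And>z w. z \<in> D \<Longrightarrow> w \<in> D \<Longrightarrow> norm (k z w * Q a b w) \<le> Kk * norm (Q a b w) powr \<alpha>"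
    using k_L_uniform by blast
  define T where "T = Q_const a b d powr \<alpha> * (4 / \<alpha>) / (b - a)"
  define S where "S = Q_const a b d * (4 / \<alpha>) / (b - a)"
  define c where "c = (\<bar>Kg\<bar> + \<bar>Km\<bar> + \<bar>Kk\<bar>) * T + S"
  have TS: "0 \<le> T" "0 \<le> S" using ab al by (simp_all add: T_def S_def Q_const_def)
  have b0: "0 \<le> bump \<alpha> x" for x using bump_pos[OF al(1), of x] by simp
  have psiD: "psi_SE a b z \<in> D" if "z \<in> strip d" for z using that by (simp add: D)
  have bd: "norm (F / of_real (b - a)) \<le> c * bump \<alpha> (Re z)"
    if z: "z \<in> strip d" and F: "norm F \<le> K * norm (Q a b (psi_SE a b z)) powr \<alpha>"
      and K: "\<bar>K\<bar> \<le> \<bar>Kg\<bar> + \<bar>Km\<bar> + \<bar>Kk\<bar>" for z K and F :: complex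
  proof -
    have "norm F \<le> \<bar>K\<bar> * norm (Q a b (psi_SE a b z)) powr \<alpha>"
      using F by (rule order_trans) (auto intro: mult_right_mono)
    also have "\<dots> \<le> \<bar>K\<bar> * (Q_const a b d powr \<alpha> * (4 / \<alpha>) * bump \<alpha> (Re z))"
      by (intro mult_left_mono norm_Q_psi_SE_powr_le z d al) auto
    finally have "norm F / (b - a) \<le> \<bar>K\<bar> * (Q_const a b d powr \<alpha> * (4 / \<alpha>) * bump \<alpha> (Re z)) / (b - a)"
      using ab by (intro divide_right_mono) auto
    also have "\<dots> = \<bar>K\<bar> * T * bump \<alpha> (Re z)" by (simp add: T_def)
    also have "\<dots> \<le> c * bump \<alpha> (Re z)"
    proof (rule mult_right_mono[OF _ b0])
      have "\<bar>K\<bar> * T \<le> (\<bar>Kg\<bar> + \<bar>Km\<bar> + \<bar>Kk\<bar>) * T" using K TS by (intro mult_right_mono) auto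
      then show "\<bar>K\<bar> * T \<le> c" using TS by (simp add: c_def)
    qed
    finally show ?thesis using ab by (simp add: norm_divide del: of_real_diff)
  qed
  have hol: "(\<lambda>z. f (psi_SE a b z) / of_real (b - a)) holomorphic_on strip d" if "f analytic_on D" for f
    using holomorphic_pullback[OF ab d(2), of f] that by (simp add: D)
  have "volterra_strip \<alpha> d c (\<lambda>z w. k (psi_SE a b z) (psi_SE a b w) * Q a b (psi_SE a b w) / of_real (b - a))
    (\<lambda>z. g (psi_SE a b z) * Q a b (psi_SE a b z) / of_real (b - a))
    (\<lambda>z. \<mu> (psi_SE a b z) * Q a b (psi_SE a b z) / of_real (b - a))
    (\<lambda>z. Q a b (psi_SE a b z) / of_real (b - a))"
  proof
    show "0 < \<alpha>" "0 < d" by fact+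
    show "(\<lambda>z. k (psi_SE a b z) (psi_SE a b w) * Q a b (psi_SE a b w) / of_real (b - a)) holomorphic_on strip d"
      if "w \<in> strip d" for w
      using hol[of "\<lambda>z. k z (psi_SE a b w) * Q a b (psi_SE a b w)"] k_H psiD[OF that] by (auto simp: H_inf_def)
    show "(\<lambda>w. k (psi_SE a b z) (psi_SE a b w) * Q a b (psi_SE a b w) / of_real (b - a)) holomorphic_on strip d"
      if "z \<in> strip d" for z
      using hol[of "\<lambda>w. k (psi_SE a b z) w * Q a b w"] k_L psiD[OF that] by (auto simp: L_class_def)
    show "(\<lambda>z. g (psi_SE a b z) * Q a b (psi_SE a b z) / of_real (b - a)) holomorphic_on strip d"
      using hol[of "\<lambda>z. g z * Q a b z"] g by (auto simp: L_class_def)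
    show "(\<lambda>z. \<mu> (psi_SE a b z) * Q a b (psi_SE a b z) / of_real (b - a)) holomorphic_on strip d"
      using hol[of "\<lambda>z. \<mu> z * Q a b z"] mu by (auto simp: L_class_def)
    have "Q a b analytic_on D" unfolding Q_def[abs_def] by (intro analytic_intros)
    from hol[OF this] show "(\<lambda>z. Q a b (psi_SE a b z) / of_real (b - a)) holomorphic_on strip d" .
    fix z assume z: "z \<in> strip d"
    show "norm (k (psi_SE a b w) (psi_SE a b z) * Q a b (psi_SE a b z) / of_real (b - a)) \<le> c * bump \<alpha> (Re z)"
      if "w \<in> strip d" for w
      by (rule bd[OF z Kk[OF psiD[OF that] psiD[OF z]]]) auto
    show "norm (g (psi_SE a b z) * Q a b (psi_SE a b z) / of_real (b - a)) \<le> c * bump \<alpha> (Re z)"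
      by (rule bd[OF z Kg[OF psiD[OF z]]]) auto
    show "norm (\<mu> (psi_SE a b z) * Q a b (psi_SE a b z) / of_real (b - a)) \<le> c * bump \<alpha> (Re z)"
      by (rule bd[OF z Km[OF psiD[OF z]]]) auto
    have "norm (Q a b (psi_SE a b z)) / (b - a) \<le> Q_const a b d * (4 / \<alpha>) * bump \<alpha> (Re z) / (b - a)"
      using ab by (intro divide_right_mono norm_Q_psi_SE_bump z d al) auto
    also have "\<dots> = S * bump \<alpha> (Re z)" by (simp add: S_def)
    also have "\<dots> \<le> c * bump \<alpha> (Re z)"
      using TS by (intro mult_right_mono b0) (auto simp: c_def)
    finally show "norm (Q a b (psi_SE a b z) / of_real (b - a)) \<le> c * bump \<alpha> (Re z)"
      using ab by (simp add: norm_divide del: of_real_diff)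
  qed
  then show ?thesis by blast
qed

text \<open>The integrated equation becomes a differential equation on the real line: primitives H
  and W of the transformed integrands exist by domination and are identified with the two integrals
  by \<open>has_integral_pullback\<close>. Uniqueness on the reals then applies.\<close>

lemma ivp_solution_pullback:
  fixes a b :: real
  defines "\<Psi> \<equiv> (psi_SE a b :: complex \<Rightarrow> complex)"
  assumes ab: "a < b" and u: "IVP_solution a b ua g \<mu> k u"
    and vs: "volterra_strip \<alpha> d c (\<lambda>z w. k (\<Psi> z) (\<Psi> w) * Q a b (\<Psi> w) / of_real (b - a))
      (\<lambda>z. g (\<Psi> z) * Q a b (\<Psi> z) / of_real (b - a))
      (\<lambda>z. \<mu> (\<Psi> z) * Q a b (\<Psi> z) / of_real (b - a))
      (\<lambda>z. Q a b (\<Psi> z) / of_real (b - a))"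
    and pic: "volterra_strip.picard d (\<lambda>z w. k (\<Psi> z) (\<Psi> w) * Q a b (\<Psi> w) / of_real (b - a))
      (\<lambda>z. g (\<Psi> z) * Q a b (\<Psi> z) / of_real (b - a))
      (\<lambda>z. \<mu> (\<Psi> z) * Q a b (\<Psi> z) / of_real (b - a))
      (\<lambda>z. Q a b (\<Psi> z) / of_real (b - a)) ua U \<Phi> U"
    and B: "\<And>z. z \<in> strip d \<Longrightarrow> norm (U z) \<le> B"
  shows "u (psi_SE a b x) = U (of_real x)"
proof -
  define \<kappa> where "\<kappa> = (\<lambda>z w. k (\<Psi> z) (\<Psi> w) * Q a b (\<Psi> w) / of_real (b - a))"
  define G where "G = (\<lambda>z. g (\<Psi> z) * Q a b (\<Psi> z) / of_real (b - a))"
  define m where "m = (\<lambda>z. \<mu> (\<Psi> z) * Q a b (\<Psi> z) / of_real (b - a))"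
  define p where "p = (\<lambda>z. Q a b (\<Psi> z) / of_real (b - a))"
  interpret volterra_strip \<alpha> d c \<kappa> G m p ua
    using vs unfolding \<kappa>_def G_def m_def p_def .
  let ?\<psi> = "psi_SE a b :: real \<Rightarrow> real"
  have z: "complex_of_real x \<in> strip d" for x using d_pos by (simp add: strip_def)
  have \<psi>: "a < ?\<psi> x" "?\<psi> x < b" for x using psi_SE_bounds[OF ab, of x] by auto
  have p_real: "p (of_real x) = of_real ((b - a) * bump 1 x)" for x
    unfolding p_def \<Psi>_def by (rule Q_psi_SE_of_real[OF ab])
  have \<Psi>_real: "\<Psi> (of_real x) = of_real (?\<psi> x)" for x by (simp add: \<Psi>_def psi_SE_of_real)
  have G_p: "G z = g (\<Psi> z) * p z" and m_p: "m z = \<mu> (\<Psi> z) * p z" and k_p: "\<kappa> w z = k (\<Psi> w) (\<Psi> z) * p z" for w z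
    by (simp_all add: G_def m_def \<kappa>_def p_def)
  define v where "v x = u (?\<psi> x)" for x
  have u_cont: "continuous_on {a..b} u" using u by (simp add: IVP_solution_def)
  have v_cont: "continuous_on UNIV v" unfolding v_def
    using \<psi> by (intro continuous_on_compose2[OF u_cont] continuous_at_imp_continuous_on ballI DERIV_isCont[OF DERIV_psi_SE_real])
      (auto simp: \<psi>[THEN less_imp_le])
  have "bounded (u ` {a..b})" using compact_continuous_image[OF u_cont] compact_imp_bounded by blast
  then obtain B' where B': "\<And>t. t \<in> {a..b} \<Longrightarrow> norm (u t) \<le> B'"
    unfolding bounded_iff by blast
  have v_bd: "norm (v x) \<le> B'" for x using \<psi>[of x] by (auto simp: v_def intro!: B')
  have B'0: "0 \<le> B'" using order_trans[OF norm_ge_zero v_bd] .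
  have cont_real: "continuous_on UNIV (\<lambda>x. F (complex_of_real x))" if "F holomorphic_on strip d" for F
    using z by (intro continuous_on_compose2[OF holomorphic_on_imp_continuous_on[OF that]] continuous_intros) auto
  have "\<exists>H. (\<forall>y. (H has_vector_derivative \<kappa> (of_real x) (of_real y) * v y) (at y)) \<and> (H \<longlongrightarrow> 0) at_bot" for x
  proof -
    have "norm (\<kappa> (of_real x) (of_real y) * v y) \<le> c * B' * bump \<alpha> y" for y
      using kernel_mult_bound[OF z z v_bd] by simp
    from ex_primitive_at_bot[OF alpha_pos continuous_on_mult[OF cont_real[OF hol2[OF z]] v_cont] this]
    show ?thesis by blast
  qed
  then obtain H where H: "\<And>x y. (H x has_vector_derivative \<kappa> (of_real x) (of_real y) * v y) (at y)"
    and H0: "\<And>x. (H x \<longlongrightarrow> 0) at_bot" by metis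
  have volt: "volterra a k u (?\<psi> x) = H x x" for x
  proof -
    have "((\<lambda>r. k (of_real (?\<psi> x)) (of_real r) * u r) has_integral H x x) {a..?\<psi> x}"
    proof (rule has_integral_pullback[OF ab _ H0])
      show "(H x has_vector_derivative k (of_real (?\<psi> x)) (of_real (?\<psi> y)) * u (?\<psi> y) * of_real ((b - a) * bump 1 y)) (at y)" for y
        using H[of x y] unfolding p_real[symmetric] by (simp add: k_p \<Psi>_real v_def mult_ac)
    qed
    then show ?thesis by (simp add: volterra_def integral_unique)
  qed
  have H_bd: "norm (H x x) \<le> c * B'" for x
  proof -
    have "norm (H x x - 0) \<le> c * B' * logistic \<alpha> x - 0"
    proof (rule half_line_bound[OF H DERIV_cmult[OF DERIV_logistic] _ H0 tendsto_mult_right_zero[OF tendsto_logistic_at_bot[OF alpha_pos]]])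
      show "norm (\<kappa> (of_real x) (of_real y) * v y) \<le> c * B' * bump \<alpha> y" for y
        using kernel_mult_bound[OF z z v_bd] by simp
    qed
    also have "\<dots> \<le> c * B'"
      using logistic_less_1[of \<alpha> x] c_nonneg B'0 by (simp add: mult_left_le)
    finally show ?thesis by simp
  qed
  \<comment> \<open>Needed because W is obtained as a primitive of a continuous function. The
    Lipschitz estimate in the kernel parameter comes from the disc of radius d around a real
    point.\<close>
  have H_cont: "isCont (\<lambda>x. H x x) x" for x
  proof -
    define C where "C = 4 * c * B' / d"
    have C0: "0 \<le> C" using c_nonneg B'0 d_pos by (simp add: C_def)
    have inc: "norm (H (x + t) (x + t) - H x (x + t)) \<le> C * \<bar>t\<bar>" if t: "\<bar>t\<bar> < d / 2" for t
    proof -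
      have "norm ((H (x + t) (x + t) - H x (x + t)) - (0 - 0)) \<le> C * \<bar>t\<bar> * logistic \<alpha> (x + t) - 0"
      proof (rule half_line_bound[where f = "\<lambda>y. H (x + t) y - H x y", OF has_vector_derivative_diff[OF H H]
            DERIV_cmult[OF DERIV_logistic] _ tendsto_diff[OF H0 H0] tendsto_mult_right_zero[OF tendsto_logistic_at_bot[OF alpha_pos]]])
        fix y
        have "norm (\<kappa> (of_real x + of_real t) (of_real y) - \<kappa> (of_real x) (of_real y)) \<le> 4 * (c * bump \<alpha> y) / d * \<bar>t\<bar>"
          using kernel_increment(1)[OF z z, of "of_real t" x y] t by simp
        then have "norm (\<kappa> (of_real x + of_real t) (of_real y) - \<kappa> (of_real x) (of_real y)) * norm (v y) \<le> 4 * (c * bump \<alpha> y) / d * \<bar>t\<bar> * B'"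
          using c_nonneg d_pos bump_nonneg[of y] by (intro mult_mono v_bd) auto
        then
        show "norm (\<kappa> (of_real (x + t)) (of_real y) * v y - \<kappa> (of_real x) (of_real y) * v y) \<le> C * \<bar>t\<bar> * bump \<alpha> y"
          unfolding left_diff_distrib[symmetric] norm_mult of_real_add by (simp add: C_def mult_ac)
      qed
      also have "\<dots> \<le> C * \<bar>t\<bar>"
        using logistic_less_1[of \<alpha> "x + t"] C0 by (simp add: mult_left_le)
      finally show ?thesis by simp
    qed
    have "((\<lambda>t. H (x + t) (x + t) - H x (x + t)) \<longlongrightarrow> 0) (at 0)"
    proof (rule Lim_null_comparison)
      show "\<forall>\<^sub>F t in at 0. norm (H (x + t) (x + t) - H x (x + t)) \<le> C * \<bar>t\<bar>"
        unfolding eventually_at using inc d_pos by (intro exI[of _ "d / 2"]) (auto simp: dist_real_def)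
      show "((\<lambda>t. C * \<bar>t\<bar>) \<longlongrightarrow> 0) (at (0::real))" by (auto intro!: tendsto_eq_intros)
    qed
    moreover have "((\<lambda>t. H x (x + t)) \<longlongrightarrow> H x x) (at 0)"
      using has_vector_derivative_continuous[OF H[of x x]] by (simp add: isCont_iff)
    ultimately have "((\<lambda>t. H (x + t) (x + t) - H x (x + t) + H x (x + t)) \<longlongrightarrow> 0 + H x x) (at 0)"
      by (rule tendsto_add)
    then show ?thesis by (simp add: isCont_iff)
  qed
  let ?r = "\<lambda>x. G (of_real x) + m (of_real x) * v x + p (of_real x) * H x x"
  have r_cont: "continuous_on UNIV ?r"
    using H_cont by (intro continuous_intros cont_real G_hol m_hol p_hol v_cont continuous_at_imp_continuous_on) auto
  have r_bd: "norm (?r x) \<le> (c + c * B' + c * (c * B')) * bump \<alpha> x" for x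
    using rhs_bound[OF z v_bd H_bd] by simp
  obtain W where W: "\<And>x. (W has_vector_derivative ?r x) (at x)" and W0: "(W \<longlongrightarrow> 0) at_bot"
    using ex_primitive_at_bot[OF alpha_pos r_cont r_bd] by blast
  have v_eq: "v x = ua + W x" for x
  proof -
    have "((\<lambda>s. g (of_real s) + \<mu> (of_real s) * u s + volterra a k u s) has_integral W x) {a..?\<psi> x}"
    proof (rule has_integral_pullback[OF ab _ W0])
      show "(W has_vector_derivative (g (of_real (?\<psi> y)) + \<mu> (of_real (?\<psi> y)) * u (?\<psi> y) + volterra a k u (?\<psi> y))
          * of_real ((b - a) * bump 1 y)) (at y)" for y
        using W[of y] unfolding p_real[symmetric] by (simp add: G_p m_p \<Psi>_real volt v_def algebra_simps)
    qed
    moreover have "?\<psi> x \<in> {a..b}" using \<psi>[of x] by simp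
    ultimately show ?thesis using u by (simp add: IVP_solution_def v_def integral_unique)
  qed
  have "v x = U (of_real x)"
  proof (rule solution_unique_on_reals[where H = H, OF _ B])
    show "picard U \<Phi> U" using pic unfolding \<kappa>_def G_def m_def p_def .
    show "(v has_vector_derivative ?r x) (at x)" for x
      using has_vector_derivative_add[OF has_vector_derivative_const W, of ua x] v_eq[abs_def] by simp
    show "(v \<longlongrightarrow> ua) at_bot" using tendsto_add[OF tendsto_const W0, of ua] v_eq[abs_def] by simp
  qed (use v_bd H H0 in auto)
  then show ?thesis by (simp add: v_def)
qed

section \<open>Convergence of the scheme\<close>

text \<open>The part of \<open>u_SE\<close> at the image of x that depends on the nodal values v. At
  nodes it reduces to \<open>nystrom_op\<close>.\<close>

definition nystrom_eval :: "real \<Rightarrow> nat \<Rightarrow> (int \<Rightarrow> complex) \<Rightarrow> (int \<Rightarrow> complex) \<Rightarrow> (int \<Rightarrow> int \<Rightarrow> complex) \<Rightarrow>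
    (int \<Rightarrow> complex) \<Rightarrow> real \<Rightarrow> complex" where
  "nystrom_eval h N m p \<kappa> v x = (\<Sum>j = - int N..int N.
     (m j * v j + p j * (\<Sum>l = - int N..int N. \<kappa> j l * v l * of_real (h * step_fun (j - l))))
       * of_real (J_SE j h x))"

lemma nystrom_eval_node: "0 < h \<Longrightarrow> nystrom_eval h N m p \<kappa> v (of_int i * h) = nystrom_op h N m p \<kappa> v i"
  by (simp add: nystrom_eval_def nystrom_op_def J_SE_node)

lemma nystrom_eval_diff:
  "nystrom_eval h N m p \<kappa> (\<lambda>j. v j - w j) x = nystrom_eval h N m p \<kappa> v x - nystrom_eval h N m p \<kappa> w x"
proof -
  have "(\<Sum>l = - int N..int N. \<kappa> j l * (v l - w l) * of_real (h * step_fun (j - l)))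
    = (\<Sum>l = - int N..int N. \<kappa> j l * v l * of_real (h * step_fun (j - l)))
      - (\<Sum>l = - int N..int N. \<kappa> j l * w l * of_real (h * step_fun (j - l)))" for j
    unfolding sum_subtractf[symmetric] by (intro sum.cong) (simp_all add: left_diff_distrib right_diff_distrib)
  note inner = this
  show ?thesis unfolding nystrom_eval_def inner
    by (subst sum_subtractf[symmetric]) (intro sum.cong, simp_all only: left_diff_distrib right_diff_distrib distrib_right, simp)
qed

lemma step_sum_bound:
  fixes f :: "int \<Rightarrow> complex"
  assumes al: "0 < \<alpha>" and c: "0 \<le> c" and h: "0 < h" "h \<le> 1"
    and f: "\<And>j. j \<in> {- int N..int N} \<Longrightarrow> norm (f j) \<le> c * bump \<alpha> (of_int j * h) * W"
    and s: "\<And>j. \<bar>s j\<bar> \<le> h * step_const" and W: "0 \<le> W"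
  shows "norm (\<Sum>j = - int N..int N. f j * of_real (s j)) \<le> c * (\<alpha> + 2) * step_const * W"
proof -
  have "norm (\<Sum>j = - int N..int N. f j * of_real (s j))
    \<le> (\<Sum>j = - int N..int N. c * step_const * W * (h * bump \<alpha> (of_int j * h)))"
  proof (rule sum_norm_le)
    fix j assume j: "j \<in> {- int N..int N}"
    have "norm (f j * of_real (s j)) \<le> (c * bump \<alpha> (of_int j * h) * W) * (h * step_const)"
      unfolding norm_mult norm_of_real using c W bump_pos[OF al, of "of_int j * h"]
      by (intro mult_mono f j s) auto
    then show "norm (f j * of_real (s j)) \<le> c * step_const * W * (h * bump \<alpha> (of_int j * h))"
      by (simp add: mult_ac)
  qed
  also have "\<dots> \<le> c * step_const * W * (\<alpha> + 2)"
    unfolding sum_distrib_left[where r = "c * step_const * W", symmetric]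
    using c W step_const(1) by (intro mult_left_mono sum_bump_le al h) auto
  finally show ?thesis by (simp add: mult_ac)
qed

text \<open>It carries a nodal error over to all x with a factor free of N, h and x; the second C in
  the product comes from the nested sum.\<close>

lemma nystrom_eval_bound:
  assumes al: "0 < \<alpha>" and c: "0 \<le> c" and h: "0 < h" "h \<le> 1"
    and m: "\<And>j. norm (m j) \<le> c * bump \<alpha> (of_int j * h)" and p: "\<And>j. norm (p j) \<le> c * bump \<alpha> (of_int j * h)"
    and \<kappa>: "\<And>j l. norm (\<kappa> j l) \<le> c * bump \<alpha> (of_int l * h)"
    and v: "\<And>j. j \<in> {- int N..int N} \<Longrightarrow> norm (v j) \<le> V" and V: "0 \<le> V"
  defines "C \<equiv> c * (\<alpha> + 2) * step_const"
  shows "norm (nystrom_eval h N m p \<kappa> v x) \<le> C * (1 + C) * V"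
proof -
  let ?I = "{- int N..int N}"
  have b0: "0 \<le> bump \<alpha> y" for y using bump_pos[OF al, of y] by simp
  have sf: "\<bar>h * step_fun k\<bar> \<le> h * step_const" for k
    using h abs_step_fun_le[of k] by (simp add: abs_mult)
  have C0: "0 \<le> C" using c al step_const(1) by (simp add: C_def)
  have inner: "norm (\<Sum>l\<in>?I. \<kappa> j l * v l * of_real (h * step_fun (j - l))) \<le> C * V" for j
    unfolding C_def using c b0 V
    by (intro step_sum_bound[OF al c h _ sf]) (auto simp: norm_mult intro!: mult_mono \<kappa> v)
  have "norm (nystrom_eval h N m p \<kappa> v x) \<le> C * ((1 + C) * V)"
    unfolding nystrom_eval_def
  proof (subst (1) C_def, rule step_sum_bound[OF al c h _ J_SE_bound])
    fix j assume j: "j \<in> ?I"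
    let ?y = "\<Sum>l\<in>?I. \<kappa> j l * v l * of_real (h * step_fun (j - l))"
    have "norm (m j * v j + p j * ?y) \<le> norm (m j) * norm (v j) + norm (p j) * norm ?y"
      unfolding norm_mult[symmetric] by (rule norm_triangle_ineq)
    also have "\<dots> \<le> c * bump \<alpha> (of_int j * h) * V + c * bump \<alpha> (of_int j * h) * (C * V)"
      using c b0 V C0 by (intro add_mono mult_mono m p v j inner) auto
    finally show "norm (m j * v j + p j * ?y) \<le> c * bump \<alpha> (of_int j * h) * ((1 + C) * V)"
      by (simp add: algebra_simps)
  qed (use C0 V h in simp_all)
  then show ?thesis by (simp add: mult.assoc)
qed

context volterra_strip
begin

text \<open>Consistency plus stability. The exact nodal values satisfy the discrete system up to a
  residual made of the outer quadrature error and of the inner ones passed on through p. Stability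
  turns it into a nodal error bound, and one more evaluation gives the error at every x. The
  homogeneous case is recorded separately because it yields invertibility.\<close>

theorem nystrom_convergence:
  assumes pic: "picard U \<Phi> U" and bd: "\<forall>z\<in>strip d. norm (U z) \<le> B"
  defines "mm \<equiv> \<lambda>h j::int. m (of_real (of_int j * h))" and "pp \<equiv> \<lambda>h j::int. p (of_real (of_int j * h))"
    and "GG \<equiv> \<lambda>h j::int. G (of_real (of_int j * h))"
    and "kk \<equiv> \<lambda>h (j::int) (l::int). \<kappa> (of_real (of_int j * h)) (of_real (of_int l * h))"
  obtains N0 C where "0 < N0"
    "\<And>N h v i. N0 \<le> N \<Longrightarrow> h = mesh \<alpha> d N \<Longrightarrow>
       (\<And>i. i \<in> {- int N..int N} \<Longrightarrow> v i = nystrom_op h N (mm h) (pp h) (kk h) v i) \<Longrightarrow>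
       i \<in> {- int N..int N} \<Longrightarrow> v i = 0"
    "\<And>N h v x. N0 \<le> N \<Longrightarrow> h = mesh \<alpha> d N \<Longrightarrow>
       (\<And>i. i \<in> {- int N..int N} \<Longrightarrow> v i = ua + (\<Sum>j = - int N..int N. GG h j * of_real (h * step_fun (i - j)))
           + nystrom_op h N (mm h) (pp h) (kk h) v i) \<Longrightarrow>
       norm (U (of_real x) - (ua + (\<Sum>j = - int N..int N. GG h j * of_real (J_SE j h x)) + nystrom_eval h N (mm h) (pp h) (kk h) v x))
         \<le> C * exp (- sqrt (pi * d * \<alpha> * real N))"
proof -
  note B = bspec[OF bd]
  have z: "complex_of_real x \<in> strip d" for x using d_pos by (simp add: strip_def)
  have B0: "0 \<le> B" using order_trans[OF norm_ge_zero B[OF z[of 0]]] .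
  obtain h0 K where h0: "0 < h0" and K0: "0 \<le> K" and stab: "\<And>h N m p \<kappa> v r \<rho> i. 0 < h \<Longrightarrow> h \<le> h0 \<Longrightarrow>
    (\<And>j. norm (m j) \<le> c * bump \<alpha> (of_int j * h)) \<Longrightarrow> (\<And>j. norm (p j) \<le> c * bump \<alpha> (of_int j * h)) \<Longrightarrow>
    (\<And>j l. norm (\<kappa> j l) \<le> c * bump \<alpha> (of_int l * h)) \<Longrightarrow>
    (\<And>i. i \<in> {- int N..int N} \<Longrightarrow> v i = r i + nystrom_op h N m p \<kappa> v i) \<Longrightarrow>
    (\<And>i. i \<in> {- int N..int N} \<Longrightarrow> norm (r i) \<le> \<rho>) \<Longrightarrow> i \<in> {- int N..int N} \<Longrightarrow> norm (v i) \<le> K * \<rho>"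
    by (fact nystrom_stability[OF alpha_pos c_nonneg])
  define S where "S = sinc_err \<alpha> d"
  define C1 where "C1 = c + c * B + c * (c * B)"
  define q where "q = c * (\<alpha> + 2) * step_const"
  \<comment> \<open>Constant of the residual: outer quadrature error plus inner quadrature error
    summed against the outer weights. C adds the nodal error K * C2 fed through
    \<open>nystrom_eval\<close>.\<close>
  define C2 where "C2 = S * C1 + q * (S * (c * B))"
  define C where "C = C2 + q * (1 + q) * (K * C2)"
  have S0: "0 \<le> S"
  proof -
    have "0 \<le> 1 - exp (- (2 * sqrt (pi * d * \<alpha>)))" using d_pos alpha_pos by simp
    then show ?thesis using d_pos alpha_pos step_const(1) by (simp add: S_def sinc_err_def)
  qed
  have nn: "0 \<le> C1" "0 \<le> q" using c_nonneg B0 alpha_pos step_const(1) by (simp_all add: C1_def q_def)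
  then have C2: "0 \<le> C2" using S0 c_nonneg B0 by (simp add: C2_def)
  have "(\<lambda>N. mesh \<alpha> d N) \<longlonglongrightarrow> 0"
    unfolding mesh_def using alpha_pos d_pos by real_asymp
  then have "\<forall>\<^sub>F N in sequentially. mesh \<alpha> d N < min h0 1"
    using h0 by (intro order_tendstoD) auto
  then obtain N1 where N1: "\<And>N. N1 \<le> N \<Longrightarrow> mesh \<alpha> d N < min h0 1"
    by (auto simp: eventually_sequentially)
  show thesis
  proof (rule that[of "max 1 N1" C])
    show "0 < max 1 N1" by simp
    fix N h assume N: "max 1 N1 \<le> N" and h_eq: "h = mesh \<alpha> d N"
    let ?I = "{- int N..int N}"
    let ?n = "\<lambda>j::int. complex_of_real (of_int j * h)"
    define \<epsilon> where "\<epsilon> = exp (- sqrt (pi * d * \<alpha> * real N))"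
    have Npos: "0 < N" and hs: "0 < h" "h \<le> h0" "h \<le> 1"
      using N N1[of N] mesh_pos[OF alpha_pos d_pos, of N] by (auto simp: h_eq)
    have mb: "norm (mm h j) \<le> c * bump \<alpha> (of_int j * h)" and pb: "norm (pp h j) \<le> c * bump \<alpha> (of_int j * h)"
      and kb: "norm (kk h j l) \<le> c * bump \<alpha> (of_int l * h)" for j l
      using m_bound[OF z[of "of_int j * h"]] p_bound[OF z[of "of_int j * h"]]
        kernel_bound[OF z[of "of_int j * h"] z[of "of_int l * h"]]
      unfolding mm_def pp_def kk_def Re_complex_of_real by simp_all
    note stab' = stab[OF hs(1,2) mb pb kb]
    show "v i = 0" if v: "\<And>i. i \<in> ?I \<Longrightarrow> v i = nystrom_op h N (mm h) (pp h) (kk h) v i" and i: "i \<in> ?I" for v i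
    proof -
      have "norm (v i) \<le> K * 0"
      proof (rule stab'[OF _ _ i])
        show "v i = 0 + nystrom_op h N (mm h) (pp h) (kk h) v i" if "i \<in> ?I" for i
          unfolding add_0 by (rule v[OF that])
      qed simp
      then show "v i = 0" by simp
    qed
    fix v x
    assume v: "\<And>i. i \<in> ?I \<Longrightarrow> v i = ua + (\<Sum>j\<in>?I. GG h j * of_real (h * step_fun (i - j)))
           + nystrom_op h N (mm h) (pp h) (kk h) v i"
    define Uj where "Uj j = U (?n j)" for j
    define rhs where "rhs \<sigma> = G \<sigma> + m \<sigma> * U \<sigma> + p \<sigma> * \<Phi> \<sigma> \<sigma>" for \<sigma>
    have bpU: "bot_prim d ua rhs U" and bp\<Phi>: "\<And>\<sigma>. \<sigma> \<in> strip d \<Longrightarrow> bot_prim d 0 (\<lambda>\<rho>. \<kappa> \<sigma> \<rho> * U \<rho>) (\<Phi> \<sigma>)"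
      and V_hol: "(\<lambda>\<sigma>. \<Phi> \<sigma> \<sigma>) holomorphic_on strip d"
      using pic unfolding picard_def rhs_def[abs_def] by auto
    have U_hol: "U holomorphic_on strip d" by (rule bot_prim_holomorphic[OF bpU])
    have rhs_hol: "rhs holomorphic_on strip d" unfolding rhs_def[abs_def]
      by (intro holomorphic_intros G_hol m_hol p_hol U_hol V_hol)
    have e1: "norm (U (of_real x) - ua - (\<Sum>j\<in>?I. rhs (?n j) * of_real (J_SE j h x))) \<le> S * C1 * \<epsilon>" for x
      unfolding S_def C1_def \<epsilon>_def h_eq
    proof (rule sinc_indefinite_error[OF rhs_hol alpha_pos d_pos Npos _ bpU])
      show "norm (rhs \<sigma>) \<le> (c + c * B + c * (c * B)) * bump \<alpha> (Re \<sigma>)" if "\<sigma> \<in> strip d" for \<sigma>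
        unfolding rhs_def by (rule rhs_bound[OF that B[OF that] volterra_bound[OF bp\<Phi> B that]])
    qed
    define y where "y j = (\<Sum>l\<in>?I. kk h j l * Uj l * of_real (h * step_fun (j - l)))" for j
    have e2: "norm (\<Phi> (?n j) (?n j) - y j) \<le> S * (c * B) * \<epsilon>" for j
    proof -
      have "norm (\<Phi> (?n j) (?n j) - 0 - (\<Sum>l\<in>?I. (\<kappa> (?n j) (?n l) * U (?n l)) * of_real (J_SE l h (of_int j * h)))) \<le> S * (c * B) * \<epsilon>"
        unfolding S_def \<epsilon>_def h_eq
      proof (rule sinc_indefinite_error[OF holomorphic_on_mult[OF hol2[OF z] U_hol] alpha_pos d_pos Npos _ bp\<Phi>[OF z]])
        show "norm (\<kappa> (of_real t) w * U w) \<le> c * B * bump \<alpha> (Re w)" if "w \<in> strip d" for t w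
          by (rule kernel_mult_bound[OF z that B[OF that]])
      qed
      then show ?thesis by (simp add: y_def Uj_def kk_def J_SE_node[OF hs(1)])
    qed
    define res where "res x = U (of_real x) - (ua + (\<Sum>j\<in>?I. GG h j * of_real (J_SE j h x)) + nystrom_eval h N (mm h) (pp h) (kk h) Uj x)" for x
    have res: "norm (res x) \<le> C2 * \<epsilon>" for x
    proof -
      have eq: "res x = (U (of_real x) - ua - (\<Sum>j\<in>?I. rhs (?n j) * of_real (J_SE j h x)))
          + (\<Sum>j\<in>?I. pp h j * (\<Phi> (?n j) (?n j) - y j) * of_real (J_SE j h x))"
      proof -
        have "rhs (?n j) * of_real (J_SE j h x) = GG h j * of_real (J_SE j h x)
            + (mm h j * Uj j + pp h j * y j) * of_real (J_SE j h x) + pp h j * (\<Phi> (?n j) (?n j) - y j) * of_real (J_SE j h x)" for j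
          by (simp add: rhs_def GG_def mm_def pp_def Uj_def algebra_simps)
        then have "(\<Sum>j\<in>?I. rhs (?n j) * of_real (J_SE j h x)) = (\<Sum>j\<in>?I. GG h j * of_real (J_SE j h x))
            + nystrom_eval h N (mm h) (pp h) (kk h) Uj x + (\<Sum>j\<in>?I. pp h j * (\<Phi> (?n j) (?n j) - y j) * of_real (J_SE j h x))"
          by (simp only: sum.distrib nystrom_eval_def y_def)
        then show ?thesis by (simp add: res_def)
      qed
      have "norm (pp h j * (\<Phi> (?n j) (?n j) - y j)) \<le> c * bump \<alpha> (of_int j * h) * (S * (c * B) * \<epsilon>)" for j
        unfolding norm_mult using c_nonneg bump_nonneg by (intro mult_mono pb e2) auto
      then have tail: "norm (\<Sum>j\<in>?I. pp h j * (\<Phi> (?n j) (?n j) - y j) * of_real (J_SE j h x)) \<le> q * (S * (c * B) * \<epsilon>)"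
        unfolding q_def using c_nonneg S0 B0 hs
        by (intro step_sum_bound[OF alpha_pos c_nonneg hs(1,3)] J_SE_bound) (auto simp: \<epsilon>_def)
      have "norm (res x) \<le> S * C1 * \<epsilon> + q * (S * (c * B) * \<epsilon>)"
        unfolding eq by (intro norm_triangle_le add_mono e1 tail)
      then show ?thesis by (simp add: C2_def algebra_simps)
    qed
    define e where "e j = Uj j - v j" for j
    have e_eq: "e i = res (of_int i * h) + nystrom_op h N (mm h) (pp h) (kk h) e i" if "i \<in> ?I" for i
    proof -
      have "nystrom_op h N (mm h) (pp h) (kk h) e i = nystrom_op h N (mm h) (pp h) (kk h) Uj i - nystrom_op h N (mm h) (pp h) (kk h) v i"
        using nystrom_eval_diff[of h N "mm h" "pp h" "kk h" Uj v "of_int i * h"]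
        by (simp add: nystrom_eval_node[OF hs(1)] e_def[abs_def])
      moreover have "res (of_int i * h) = Uj i - (ua + (\<Sum>j\<in>?I. GG h j * of_real (h * step_fun (i - j))) + nystrom_op h N (mm h) (pp h) (kk h) Uj i)"
        unfolding res_def nystrom_eval_node[OF hs(1)] J_SE_node[OF hs(1)] Uj_def ..
      ultimately show "e i = res (of_int i * h) + nystrom_op h N (mm h) (pp h) (kk h) e i"
        unfolding e_def[of i] by (subst v[OF that]) simp
    qed
    have e_bd: "norm (e i) \<le> K * (C2 * \<epsilon>)" if "i \<in> ?I" for i
      by (rule stab'[OF e_eq res that])
    have "U (of_real x) - (ua + (\<Sum>j\<in>?I. GG h j * of_real (J_SE j h x)) + nystrom_eval h N (mm h) (pp h) (kk h) v x)
      = res x + nystrom_eval h N (mm h) (pp h) (kk h) e x"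
      using nystrom_eval_diff[of h N "mm h" "pp h" "kk h" Uj v x] by (simp add: res_def e_def[abs_def])
    also have "norm \<dots> \<le> C2 * \<epsilon> + q * (1 + q) * (K * (C2 * \<epsilon>))"
    proof (rule norm_triangle_le, rule add_mono[OF res])
      show "norm (nystrom_eval h N (mm h) (pp h) (kk h) e x) \<le> q * (1 + q) * (K * (C2 * \<epsilon>))"
        unfolding q_def using e_bd K0 C2
        by (intro nystrom_eval_bound[OF alpha_pos c_nonneg hs(1,3) mb pb kb]) (auto simp: \<epsilon>_def)
    qed
    also have "\<dots> = C * exp (- sqrt (pi * d * \<alpha> * real N))" by (simp add: C_def \<epsilon>_def algebra_simps)
    finally show "norm (U (of_real x) - (ua + (\<Sum>j\<in>?I. GG h j * of_real (J_SE j h x)) + nystrom_eval h N (mm h) (pp h) (kk h) v x))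
      \<le> C * exp (- sqrt (pi * d * \<alpha> * real N))" .
  qed
qed

end

section \<open>From matrices to the discrete operator\<close>

lemma sum_ix: "(\<Sum>q = 0..<2 * N + 1. f (ix N q)) = (\<Sum>j = - int N..int N. f j)"
proof (rule sum.reindex_bij_betw)
  show "bij_betw (ix N) {0..<2 * N + 1} {- int N..int N}"
    by (rule bij_betw_byWitness[where f' = "\<lambda>j. nat (j + int N)"]) (auto simp: ix_def)
qed

lemma nat_ix: "nat (ix N q + int N) = q"
  by (simp add: ix_def)

lemma ix_mem: "q < 2 * N + 1 \<Longrightarrow> ix N q \<in> {- int N..int N}"
  by (auto simp: ix_def)

lemma W_mat_carrier: "W_mat a b h \<mu> k N \<in> carrier_mat (2 * N + 1) (2 * N + 1)"
proof -
  have "I_mat N \<in> carrier_mat (2 * N + 1) (2 * N + 1)" "M_mat a b h \<mu> N \<in> carrier_mat (2 * N + 1) (2 * N + 1)"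
    "D_mat a b h N \<in> carrier_mat (2 * N + 1) (2 * N + 1)"
    "hadamard (I_mat N) (K_mat a b h k N) \<in> carrier_mat (2 * N + 1) (2 * N + 1)"
    by (simp_all add: I_mat_def M_mat_def D_mat_def hadamard_def)
  then show ?thesis
    unfolding W_mat_def by (intro add_carrier_mat smult_carrier_mat mult_carrier_mat[where n = "2 * N + 1"])
qed

lemma W_mat_index:
  fixes a b h :: real and N :: nat
  assumes "q < 2 * N + 1" "r < 2 * N + 1"
  defines "s \<equiv> \<lambda>q r. complex_of_real (step_fun (ix N q - ix N r))"
    and "D \<equiv> \<lambda>q. complex_of_real (dpsi_SE a b h (ix N q))"
    and "t \<equiv> \<lambda>q. complex_of_real (t_SE a b h (ix N q))"
  shows "W_mat a b h \<mu> k N $$ (q, r) = of_real h * (s q r * \<mu> (t r) * D r)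
    + of_real (h\<^sup>2) * ((\<Sum>l = 0..<2 * N + 1. s q l * D l * (s l r * k (t l) (t r))) * D r)"
proof -
  let ?n = "2 * N + 1"
  have I: "I_mat N \<in> carrier_mat ?n ?n" by (simp add: I_mat_def)
  have HK: "hadamard (I_mat N) (K_mat a b h k N) = Matrix.mat ?n ?n (\<lambda>(l, r). s l r * k (t l) (t r))"
    by (rule eq_matI) (auto simp: hadamard_def I_mat_def K_mat_def s_def t_def step_fun_def)
  have ID: "I_mat N * D_mat a b h N = Matrix.mat ?n ?n (\<lambda>(q, l). s q l * D l)"
    unfolding D_mat_def mat_diag_mult_right[OF I]
    by (rule eq_matI) (auto simp: I_mat_def s_def D_def step_fun_def)
  have IM: "I_mat N * M_mat a b h \<mu> N = Matrix.mat ?n ?n (\<lambda>(q, r). s q r * \<mu> (t r))"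
    unfolding M_mat_def mat_diag_mult_right[OF I]
    by (rule eq_matI) (auto simp: I_mat_def s_def t_def step_fun_def)
  have IMD: "I_mat N * M_mat a b h \<mu> N * D_mat a b h N = Matrix.mat ?n ?n (\<lambda>(q, r). s q r * \<mu> (t r) * D r)"
    unfolding IM unfolding D_mat_def by (subst mat_diag_mult_right[of _ ?n ?n]) (auto simp: D_def intro!: eq_matI)
  have P: "I_mat N * D_mat a b h N * hadamard (I_mat N) (K_mat a b h k N)
      = Matrix.mat ?n ?n (\<lambda>(q, r). \<Sum>l = 0..<?n. s q l * D l * (s l r * k (t l) (t r)))"
    unfolding ID HK by (rule eq_matI) (auto simp: scalar_prod_def)
  have PD: "I_mat N * D_mat a b h N * hadamard (I_mat N) (K_mat a b h k N) * D_mat a b h N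
      = Matrix.mat ?n ?n (\<lambda>(q, r). (\<Sum>l = 0..<?n. s q l * D l * (s l r * k (t l) (t r))) * D r)"
    unfolding P unfolding D_mat_def by (subst mat_diag_mult_right[of _ ?n ?n]) (auto simp: D_def intro!: eq_matI)
  show ?thesis unfolding W_mat_def IMD PD using assms(1,2) by simp
qed

lemma W_mat_mult_vec:
  assumes v: "v \<in> carrier_vec (2 * N + 1)" and q: "q < 2 * N + 1"
  shows "(W_mat a b h \<mu> k N *\<^sub>v v) $ q = nystrom_op h N
    (\<lambda>j. \<mu> (of_real (t_SE a b h j)) * of_real (dpsi_SE a b h j)) (\<lambda>j. of_real (dpsi_SE a b h j))
    (\<lambda>j l. k (of_real (t_SE a b h j)) (of_real (t_SE a b h l)) * of_real (dpsi_SE a b h l))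
    (\<lambda>j. v $ nat (j + int N)) (ix N q)"
proof -
  let ?n = "2 * N + 1"
  let ?s = "\<lambda>q r. complex_of_real (step_fun (ix N q - ix N r))"
  let ?D = "\<lambda>q. complex_of_real (dpsi_SE a b h (ix N q))"
  let ?t = "\<lambda>q. complex_of_real (t_SE a b h (ix N q))"
  have "(W_mat a b h \<mu> k N *\<^sub>v v) $ q = (\<Sum>r = 0..<?n. W_mat a b h \<mu> k N $$ (q, r) * v $ r)"
    using q v W_mat_carrier[of a b h \<mu> k N] by (simp add: scalar_prod_def)
  also have "\<dots> = (\<Sum>r = 0..<?n. \<mu> (?t r) * ?D r * v $ r * (of_real h * ?s q r)
      + (\<Sum>l = 0..<?n. ?D l * (k (?t l) (?t r) * ?D r * v $ r * (of_real h * ?s l r)) * (of_real h * ?s q l)))"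
  proof (rule sum.cong)
    fix r assume "r \<in> {0..<?n}"
    then have r: "r < ?n" by simp
    show "W_mat a b h \<mu> k N $$ (q, r) * v $ r = \<mu> (?t r) * ?D r * v $ r * (of_real h * ?s q r)
      + (\<Sum>l = 0..<?n. ?D l * (k (?t l) (?t r) * ?D r * v $ r * (of_real h * ?s l r)) * (of_real h * ?s q l))"
      unfolding W_mat_index[OF q r] distrib_right sum_distrib_left sum_distrib_right
      by (intro arg_cong2[where f = "(+)"] sum.cong) (simp_all add: power2_eq_square mult_ac)
  qed simp
  \<comment> \<open>Exchanging the sums places the inner quadrature inside the outer one, as in
    \<open>nystrom_op\<close>.\<close>
  also have "\<dots> = (\<Sum>r = 0..<?n. \<mu> (?t r) * ?D r * v $ r * (of_real h * ?s q r))
      + (\<Sum>l = 0..<?n. \<Sum>r = 0..<?n. ?D l * (k (?t l) (?t r) * ?D r * v $ r * (of_real h * ?s l r)) * (of_real h * ?s q l))"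
    unfolding sum.distrib by (subst sum.swap) simp
  also have "\<dots> = (\<Sum>l = 0..<?n. (\<mu> (?t l) * ?D l * v $ l
      + ?D l * (\<Sum>r = 0..<?n. k (?t l) (?t r) * ?D r * v $ r * (of_real h * ?s l r))) * (of_real h * ?s q l))"
    by (simp only: sum.distrib[symmetric] distrib_right sum_distrib_left sum_distrib_right)
  also have "\<dots> = nystrom_op h N
    (\<lambda>j. \<mu> (of_real (t_SE a b h j)) * of_real (dpsi_SE a b h j)) (\<lambda>j. of_real (dpsi_SE a b h j))
    (\<lambda>j l. k (of_real (t_SE a b h j)) (of_real (t_SE a b h l)) * of_real (dpsi_SE a b h l))
    (\<lambda>j. v $ nat (j + int N)) (ix N q)"
    unfolding nystrom_op_def sum_ix[symmetric] nat_ix of_real_mult ..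
  finally show ?thesis .
qed

lemma invertible_mat_if_det_nonzero:
  fixes A :: "'a::field mat"
  assumes A: "A \<in> carrier_mat n n" and det: "det A \<noteq> 0"
  obtains B where "B \<in> carrier_mat n n" "A * B = 1\<^sub>m n" "B * A = 1\<^sub>m n" "invertible_mat A"
proof -
  from det_non_zero_imp_unit[OF A det, of "()"]
  obtain B where B: "B \<in> carrier_mat n n" "A * B = 1\<^sub>m n" "B * A = 1\<^sub>m n"
    by (auto simp: Units_def ring_mat_def)
  moreover have "invertible_mat A"
    using A B by (auto simp: invertible_mat_def inverts_mat_def square_mat.simps)
  ultimately show thesis by (rule that)
qed

theorem theorem3p3:
  fixes a b \<alpha> d :: real and ua :: complex
    and g \<mu> :: "complex \<Rightarrow> complex" and k :: "complex \<Rightarrow> complex \<Rightarrow> complex"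
    and u :: "real \<Rightarrow> complex" and D :: "complex set"
  assumes ab: "a < b"
    and alpha: "0 < \<alpha>" "\<alpha> \<le> 1"
    and d: "0 < d" "d < pi"
    and D: "D = psi_SE a b ` strip d"
    and g: "(\<lambda>z. g z * Q a b z) \<in> L_class a b \<alpha> D"
    and mu: "(\<lambda>z. \<mu> z * Q a b z) \<in> L_class a b \<alpha> D"
    and k_L: "\<forall>z\<in>D. (\<lambda>w. k z w * Q a b w) \<in> L_class a b \<alpha> D"
    and k_L_uniform: "\<exists>K. \<forall>z\<in>D. \<forall>w\<in>D. norm (k z w * Q a b w) \<le> K * norm (Q a b w) powr \<alpha>"
    and k_H: "\<forall>w\<in>D. (\<lambda>z. k z w * Q a b w) \<in> H_inf D"
    and mu_cont: "continuous_on {a..b} (\<lambda>t. \<mu> (of_real t))"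
    and k_cont2: "\<forall>t\<in>{a..b}. continuous_on {a..b}
                    (\<lambda>s. k (of_real t) (of_real s) * Q a b (of_real s))"
    and k_cont1: "\<forall>s\<in>{a..b}. continuous_on {a..b}
                    (\<lambda>t. k (of_real t) (of_real s) * Q a b (of_real s))"
    and u: "IVP_solution a b ua g \<mu> k u"
  shows "\<exists>N0 > 0.
    (\<forall>N\<ge>N0. invertible_mat (1\<^sub>m (2 * N + 1) - W_mat a b (mesh \<alpha> d N) \<mu> k N)) \<and>
    (\<exists>C. \<forall>N\<ge>N0. \<forall>t\<in>{a..b}.
       norm (u t - u_SE a b (mesh \<alpha> d N) ua g \<mu> k N t) \<le> C * exp (- sqrt (pi * d * \<alpha> * real N)))"
proof -
  let ?\<Psi> = "psi_SE a b :: complex \<Rightarrow> complex"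
  define \<kappa> where "\<kappa> = (\<lambda>z w. k (?\<Psi> z) (?\<Psi> w) * Q a b (?\<Psi> w) / of_real (b - a))"
  define G where "G = (\<lambda>z. g (?\<Psi> z) * Q a b (?\<Psi> z) / of_real (b - a))"
  define m where "m = (\<lambda>z. \<mu> (?\<Psi> z) * Q a b (?\<Psi> z) / of_real (b - a))"
  define p where "p = (\<lambda>z. Q a b (?\<Psi> z) / of_real (b - a))"
  obtain c where vs: "volterra_strip \<alpha> d c \<kappa> G m p"
    using ex_volterra_strip[OF ab alpha d D g mu k_L k_L_uniform k_H]
    unfolding \<kappa>_def G_def m_def p_def by blast
  interpret volterra_strip \<alpha> d c \<kappa> G m p ua by (rule vs)
  obtain U \<Phi> B where pic: "picard U \<Phi> U" and B: "\<And>z. z \<in> strip d \<Longrightarrow> norm (U z) \<le> B"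
    using ex_solution by blast
  then have bd: "\<forall>z\<in>strip d. norm (U z) \<le> B" by blast
  have uU: "u (psi_SE a b x) = U (of_real x)" for x
    by (rule ivp_solution_pullback[OF ab u vs[unfolded \<kappa>_def G_def m_def p_def] pic[unfolded \<kappa>_def G_def m_def p_def] B])
  have nodes: "p (of_real (of_int j * h)) = of_real (dpsi_SE a b h j)"
    "m (of_real (of_int j * h)) = \<mu> (of_real (t_SE a b h j)) * of_real (dpsi_SE a b h j)"
    "G (of_real (of_int j * h)) = g (of_real (t_SE a b h j)) * of_real (dpsi_SE a b h j)"
    "\<kappa> (of_real (of_int j * h)) (of_real (of_int l * h))
      = k (of_real (t_SE a b h j)) (of_real (t_SE a b h l)) * of_real (dpsi_SE a b h l)" for j l :: int and h
  proof -
    show p: "p (of_real (of_int j * h)) = of_real (dpsi_SE a b h j)" for j :: int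
      unfolding p_def Q_psi_SE_of_real[OF ab] dpsi_SE_eq ..
    have \<Psi>: "?\<Psi> (of_real (of_int j * h)) = of_real (t_SE a b h j)" for j :: int
      unfolding psi_SE_of_real t_SE_def ..
    show "m (of_real (of_int j * h)) = \<mu> (of_real (t_SE a b h j)) * of_real (dpsi_SE a b h j)"
      "G (of_real (of_int j * h)) = g (of_real (t_SE a b h j)) * of_real (dpsi_SE a b h j)"
      "\<kappa> (of_real (of_int j * h)) (of_real (of_int l * h))
      = k (of_real (t_SE a b h j)) (of_real (t_SE a b h l)) * of_real (dpsi_SE a b h l)"
      unfolding m_def G_def \<kappa>_def \<Psi> p[symmetric] by (simp_all only: p_def \<Psi> times_divide_eq_right)
  qed
  let ?mm = "\<lambda>h j. \<mu> (of_real (t_SE a b h j)) * of_real (dpsi_SE a b h j)"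
  let ?pp = "\<lambda>h j. complex_of_real (dpsi_SE a b h j)"
  let ?kk = "\<lambda>h j l. k (of_real (t_SE a b h j)) (of_real (t_SE a b h l)) * of_real (dpsi_SE a b h l)"
  obtain N0 C where N0: "0 < N0"
    and kernel: "\<And>N h v i. N0 \<le> N \<Longrightarrow> h = mesh \<alpha> d N \<Longrightarrow>
       (\<And>i. i \<in> {- int N..int N} \<Longrightarrow> v i = nystrom_op h N (?mm h) (?pp h) (?kk h) v i) \<Longrightarrow>
       i \<in> {- int N..int N} \<Longrightarrow> v i = 0"
    and conv: "\<And>N h v x. N0 \<le> N \<Longrightarrow> h = mesh \<alpha> d N \<Longrightarrow>
       (\<And>i. i \<in> {- int N..int N} \<Longrightarrow> v i = ua
           + (\<Sum>j = - int N..int N. g (of_real (t_SE a b h j)) * of_real (dpsi_SE a b h j) * of_real (h * step_fun (i - j)))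
           + nystrom_op h N (?mm h) (?pp h) (?kk h) v i) \<Longrightarrow>
       norm (U (of_real x) - (ua
           + (\<Sum>j = - int N..int N. g (of_real (t_SE a b h j)) * of_real (dpsi_SE a b h j) * of_real (J_SE j h x))
           + nystrom_eval h N (?mm h) (?pp h) (?kk h) v x))
         \<le> C * exp (- sqrt (pi * d * \<alpha> * real N))"
    by (fact nystrom_convergence[OF pic bd, unfolded nodes])
  have inv: "\<exists>B. B \<in> carrier_mat (2 * N + 1) (2 * N + 1) \<and>
      (1\<^sub>m (2 * N + 1) - W_mat a b (mesh \<alpha> d N) \<mu> k N) * B = 1\<^sub>m (2 * N + 1) \<and>
      B * (1\<^sub>m (2 * N + 1) - W_mat a b (mesh \<alpha> d N) \<mu> k N) = 1\<^sub>m (2 * N + 1) \<and>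
      invertible_mat (1\<^sub>m (2 * N + 1) - W_mat a b (mesh \<alpha> d N) \<mu> k N)" if N: "N0 \<le> N" for N
  proof -
    let ?n = "2 * N + 1"
    define h where "h = mesh \<alpha> d N"
    define W where "W = W_mat a b h \<mu> k N"
    have W: "W \<in> carrier_mat ?n ?n" unfolding W_def by (rule W_mat_carrier)
    then have A: "1\<^sub>m ?n - W \<in> carrier_mat ?n ?n" by (rule minus_carrier_mat)
    \<comment> \<open>A vector in the null space would solve the homogeneous discrete system, whose
      only solution is zero by \<open>kernel\<close>.\<close>
    have "det (1\<^sub>m ?n - W) \<noteq> 0"
    proof
      assume "det (1\<^sub>m ?n - W) = 0"
      then obtain v where v: "v \<in> carrier_vec ?n" "v \<noteq> 0\<^sub>v ?n" "(1\<^sub>m ?n - W) *\<^sub>v v = 0\<^sub>v ?n"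
        using det_0_iff_vec_prod_zero_field[OF A] by blast
      have "v - W *\<^sub>v v = 0\<^sub>v ?n"
        using v W minus_mult_distrib_mat_vec[of "1\<^sub>m ?n" ?n ?n W v] by simp
      then have vq: "v $ q = (W *\<^sub>v v) $ q" if "q < ?n" for q
        using that v(1) W by (metis carrier_matD(1) dim_mult_mat_vec index_minus_vec(1) index_zero_vec(1) right_minus_eq)
      have z: "v $ nat (i + int N) = 0" if "i \<in> {- int N..int N}" for i
      proof (rule kernel[OF N h_def _ that, where v = "\<lambda>i. v $ nat (i + int N)"])
        fix i assume i: "i \<in> {- int N..int N}"
        then have q: "nat (i + int N) < ?n" and ix: "ix N (nat (i + int N)) = i" by (auto simp: ix_def)
        show "v $ nat (i + int N) = nystrom_op h N (?mm h) (?pp h) (?kk h) (\<lambda>j. v $ nat (j + int N)) i"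
          using vq[OF q] W_mat_mult_vec[OF v(1) q, of a b h \<mu> k] unfolding W_def ix by (simp only:)
      qed
      have "v = 0\<^sub>v ?n"
      proof (rule eq_vecI)
        fix q assume "q < dim_vec (0\<^sub>v ?n :: complex Matrix.vec)"
        then have "q < ?n" by simp
        with z[OF ix_mem[OF this]] show "v $ q = 0\<^sub>v ?n $ q" by (simp add: nat_ix)
      qed (use v in simp)
      with v(2) show False by simp
    qed
    from invertible_mat_if_det_nonzero[OF A this] show ?thesis unfolding W_def h_def by blast
  qed
  have err: "norm (u t - u_SE a b (mesh \<alpha> d N) ua g \<mu> k N t) \<le> C * exp (- sqrt (pi * d * \<alpha> * real N))"
    if N: "N0 \<le> N" and t: "t \<in> {a..b}" for N t
  proof -
    let ?n = "2 * N + 1" and ?I = "{- int N..int N}"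
    define h where "h = mesh \<alpha> d N"
    have h: "0 < h" unfolding h_def using N N0 by (intro mesh_pos alpha d) simp
    define W where "W = W_mat a b h \<mu> k N"
    have W: "W \<in> carrier_mat ?n ?n" unfolding W_def by (rule W_mat_carrier)
    then have A: "1\<^sub>m ?n - W \<in> carrier_mat ?n ?n" by (rule minus_carrier_mat)
    obtain A' where A': "A' \<in> carrier_mat ?n ?n" "(1\<^sub>m ?n - W) * A' = 1\<^sub>m ?n" "A' * (1\<^sub>m ?n - W) = 1\<^sub>m ?n"
      using inv[OF N] unfolding W_def h_def by blast
    define gv where "gv = g_vec a b h ua g N"
    have gv: "gv \<in> carrier_vec ?n" by (simp add: gv_def g_vec_def)
    define uv where "uv = u_vec a b h ua g \<mu> k N"
    \<comment> \<open>Unique solvability is what makes the definite description in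
      \<open>u_vec\<close> denote the solution.\<close>
    have "\<exists>!v. v \<in> carrier_vec ?n \<and> (1\<^sub>m ?n - W) *\<^sub>v v = gv"
    proof (rule ex1I[of _ "A' *\<^sub>v gv"])
      show "A' *\<^sub>v gv \<in> carrier_vec ?n \<and> (1\<^sub>m ?n - W) *\<^sub>v (A' *\<^sub>v gv) = gv"
        using A A' gv by (simp add: assoc_mult_mat_vec[symmetric])
      fix v assume v: "v \<in> carrier_vec ?n \<and> (1\<^sub>m ?n - W) *\<^sub>v v = gv"
      then have "A' *\<^sub>v gv = (A' * (1\<^sub>m ?n - W)) *\<^sub>v v"
        using assoc_mult_mat_vec[OF A'(1) A, of v] by simp
      then show "v = A' *\<^sub>v gv" using v one_mult_mat_vec[of v ?n] unfolding A'(3) by simp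
    qed
    from theI'[OF this] have uv: "uv \<in> carrier_vec ?n" "(1\<^sub>m ?n - W) *\<^sub>v uv = gv"
      unfolding uv_def u_vec_def W_def gv_def by auto
    define v where "v = u_node a b h ua g \<mu> k N"
    have v_uv: "v = (\<lambda>j. uv $ nat (j + int N))" by (simp add: v_def u_node_def uv_def fun_eq_iff)
    have w_node: "w_SE a b h j (t_SE a b h i) = dpsi_SE a b h j * (h * step_fun (i - j))" for i j
      unfolding t_SE_def w_SE_psi[OF ab] J_SE_node[OF h] ..
    have eqn: "v i = ua + (\<Sum>j\<in>?I. g (of_real (t_SE a b h j)) * of_real (dpsi_SE a b h j) * of_real (h * step_fun (i - j)))
      + nystrom_op h N (?mm h) (?pp h) (?kk h) v i" if i: "i \<in> ?I" for i
    proof -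
      define q where "q = nat (i + int N)"
      have q: "q < ?n" and ix: "ix N q = i" using i by (auto simp: ix_def q_def)
      have "uv - W *\<^sub>v uv = gv"
        using uv W minus_mult_distrib_mat_vec[of "1\<^sub>m ?n" ?n ?n W uv] by simp
      then have "uv $ q - (W *\<^sub>v uv) $ q = gv $ q"
        using q uv(1) W by (metis carrier_matD(1) dim_mult_mat_vec index_minus_vec(1))
      moreover have "(W *\<^sub>v uv) $ q = nystrom_op h N (?mm h) (?pp h) (?kk h) v i"
        unfolding W_def v_uv W_mat_mult_vec[OF uv(1) q] ix ..
      moreover have "gv $ q = ua + (\<Sum>j\<in>?I. g (of_real (t_SE a b h j)) * of_real (dpsi_SE a b h j) * of_real (h * step_fun (i - j)))"
        using q by (simp add: gv_def g_vec_def ix w_node mult.assoc)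
      moreover have "v i = uv $ q" by (simp add: v_uv q_def)
      ultimately show "v i = ua + (\<Sum>j\<in>?I. g (of_real (t_SE a b h j)) * of_real (dpsi_SE a b h j) * of_real (h * step_fun (i - j)))
        + nystrom_op h N (?mm h) (?pp h) (?kk h) v i" by (simp add: diff_eq_eq)
    qed
    have eval: "u_SE a b h ua g \<mu> k N (psi_SE a b x) = ua
        + (\<Sum>j\<in>?I. g (of_real (t_SE a b h j)) * of_real (dpsi_SE a b h j) * of_real (J_SE j h x))
        + nystrom_eval h N (?mm h) (?pp h) (?kk h) v x" for x
      unfolding u_SE_def v_def[symmetric] w_SE_psi[OF ab] w_node nystrom_eval_def add.assoc sum.distrib[symmetric]
      by (intro arg_cong2[where f = "(+)"] refl sum.cong)
        (simp add: algebra_simps sum_distrib_left)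
    have inner: "norm (u t - u_SE a b h ua g \<mu> k N t) \<le> C * exp (- sqrt (pi * d * \<alpha> * real N))"
      if "a < t" "t < b" for t
    proof -
      define x where "x = ln ((t - a) / (b - t))"
      have tx: "t = psi_SE a b x" using psi_SE_inverse[OF that] by (simp add: x_def)
      show ?thesis unfolding tx uU eval by (rule conv[OF N h_def eqn])
    qed
    have u_cont: "continuous_on {a..b} u" using u by (simp add: IVP_solution_def)
    \<comment> \<open>The end points are not images of real x; the bound reaches them through the
      continuity of u and of the weights \<open>w_SE\<close> there.\<close>
    consider "t = a" | "t = b" | "a < t" "t < b" using t by fastforce
    then show ?thesis unfolding h_def[symmetric]
    proof cases
      case 1
      have "((\<lambda>t. norm (u t - u_SE a b h ua g \<mu> k N t)) \<longlongrightarrow> norm (u a - u_SE a b h ua g \<mu> k N a)) (at_right a)"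
        unfolding u_SE_def
        by (intro tendsto_intros continuous_on_Icc_at_rightD[OF u_cont ab] w_SE_left_end[OF ab h])
      then show "norm (u t - u_SE a b h ua g \<mu> k N t) \<le> C * exp (- sqrt (pi * d * \<alpha> * real N))"
        unfolding 1
      proof (rule tendsto_upperbound)
        show "\<forall>\<^sub>F t in at_right a. norm (u t - u_SE a b h ua g \<mu> k N t) \<le> C * exp (- sqrt (pi * d * \<alpha> * real N))"
          using eventually_at_right_real[OF ab] by eventually_elim (rule inner, auto)
      qed simp
    next
      case 2
      have "((\<lambda>t. norm (u t - u_SE a b h ua g \<mu> k N t)) \<longlongrightarrow> norm (u b - u_SE a b h ua g \<mu> k N b)) (at_left b)"
        unfolding u_SE_def
        by (intro tendsto_intros continuous_on_Icc_at_leftD[OF u_cont ab] w_SE_right_end[OF ab h])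
      then show "norm (u t - u_SE a b h ua g \<mu> k N t) \<le> C * exp (- sqrt (pi * d * \<alpha> * real N))"
        unfolding 2
      proof (rule tendsto_upperbound)
        show "\<forall>\<^sub>F t in at_left b. norm (u t - u_SE a b h ua g \<mu> k N t) \<le> C * exp (- sqrt (pi * d * \<alpha> * real N))"
          using eventually_at_left_real[OF ab] by eventually_elim (rule inner, auto)
      qed simp
    next
      case 3
      then show "norm (u t - u_SE a b h ua g \<mu> k N t) \<le> C * exp (- sqrt (pi * d * \<alpha> * real N))" by (rule inner)
    qed
  qed
  show ?thesis using N0 inv err by blast
qed

end
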